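(* Let $\mathbf{Z}_i=\boldsymbol\mu+\boldsymbol\epsilon_i$, $i=1,\dots,n$, where $\boldsymbol\mu=(\mu_1,\dots,\mu_p)^T\in\mathbb{R}^p$ and $\boldsymbol\epsilon_1,\dots,\boldsymbol\epsilon_n$ are i.i.d. mean-zero random vectors with covariance matrix $\boldsymbol\Sigma=(\Sigma_{ij})$. Assume there are constants $C_1,C_2>0$ with $\max_{1\le j\le p}\mathbb{E}|Z_{ij}|^3\le C_1$ and $\min_{1\le j\le p}\Sigma_{jj}\ge C_2$. Assume, as $n\to\infty$, that $\log(p/\alpha)=o(n^{1/3})$ and $\tau\gg n^{1/3}$ (i.e. $n^{1/3}=o(\tau)$). For $\alpha\in(0,1)$ let $t_0$ satisfy $$\frac{t_0}{1+t_0^2/n}=\Phi^{-1}\Big(1-\frac{\alpha}{2p}\Big),$$ and for $1\le j\le p$ let $$(L_j,U_j)=\frac{\sum_{i=1}^nf(Z_{ij})}{n}\pm\frac{t_0}{n}\sqrt{\sum_{i=1}^n\big(f(Z_{ij})\big)^2-\frac1n\Big[\sum_{i=1}^nf(Z_{ij})\Big]^2}.$$ Then $(L_j,U_j)$, $1\le j\le p$, are $1-\alpha-o(1)$ simultaneous confidence intervals for $(\mu_j)_{j=1}^p$, i.e. $\mathbb{P}(\mu_j\in(L_j,U_j)\text{ for all }1\le j\le p)\ge1-\alpha-o(1)$.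
   Context: $Z_{ij}$ is the $j$-th coordinate of $\mathbf{Z}_i$. For the threshold $\tau>0$, $f(x)=x\mathbb{1}(|x|\le\tau)+\tau\mathbb{1}(x>\tau)-\tau\mathbb{1}(x<-\tau)$. $\Phi$ is the standard normal distribution function. $p=p(n)$ and $\tau=\tau(n)$ may depend on $n$. *)

theory Defs
  imports "HOL-Probability.Probability"
begin

definition Phi :: "real \<Rightarrow> real" where
  "Phi x = measure (density lborel std_normal_density) {..x}"

definition Phi_inv :: "real \<Rightarrow> real" where
  "Phi_inv q = (THE x. Phi x = q)"

definition trunc :: "real \<Rightarrow> real \<Rightarrow> real" where
  "trunc \<tau> x = x * (if \<bar>x\<bar> \<le> \<tau> then 1 else 0) + \<tau> * (if x > \<tau> then 1 else 0)
                 - \<tau> * (if x < - \<tau> then 1 else 0)"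

definition ci_L :: "real \<Rightarrow> real \<Rightarrow> nat \<Rightarrow> (nat \<Rightarrow> real) \<Rightarrow> real" where
  "ci_L \<tau> t0 n xs = (\<Sum>i<n. trunc \<tau> (xs i)) / real n
     - t0 / real n * sqrt ((\<Sum>i<n. (trunc \<tau> (xs i))\<^sup>2) - (1 / real n) * (\<Sum>i<n. trunc \<tau> (xs i))\<^sup>2)"

definition ci_U :: "real \<Rightarrow> real \<Rightarrow> nat \<Rightarrow> (nat \<Rightarrow> real) \<Rightarrow> real" where
  "ci_U \<tau> t0 n xs = (\<Sum>i<n. trunc \<tau> (xs i)) / real n
     + t0 / real n * sqrt ((\<Sum>i<n. (trunc \<tau> (xs i))\<^sup>2) - (1 / real n) * (\<Sum>i<n. trunc \<tau> (xs i))\<^sup>2)"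

end

theory Submission
  imports Defs "HOL-Real_Asymp.Real_Asymp"
begin

text \<open>
  Failure of the interval for \<open>\<mu>\<^sub>j\<close> forces \<open>z * sqrt (\<Sum> X\<^sub>i\<^sup>2) \<le> \<bar>\<Sum> X\<^sub>i\<bar>\<close> with \<open>X\<^sub>i = f(Z\<^sub>i\<^sub>j) - \<mu>\<^sub>j\<close> and
  \<open>z\<close> the normal quantile, so by the union bound it suffices to prove a moderate deviation upper
  bound for self-normalized sums: the probability of \<open>z * sqrt (\<Sum> X\<^sub>i\<^sup>2) \<le> \<Sum> X\<^sub>i\<close> is at most
  \<open>(1 + o(1)) * \<Phi>(- z)\<close>, uniformly for \<open>z = o(n\<^sup>1\<^sup>/\<^sup>6)\<close> bounded away from 0. The truncation bias is
  \<open>O(1 / \<tau>\<^sup>2) = o(n\<^sup>-\<^sup>2\<^sup>/\<^sup>3)\<close>, which is negligible at this precision.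

  Scale to \<open>s\<^sub>i = b * X\<^sub>i\<close> with \<open>n * E s\<^sup>2 = z\<^sup>2\<close>, and put \<open>r = sqrt (\<Sum> s\<^sub>i\<^sup>2)\<close> and
  \<open>Y = \<Sum> (s\<^sub>i - s\<^sub>i\<^sup>2 / 2)\<close>. The event implies \<open>Y \<ge> z\<^sup>2 / 2 - (r - z)\<^sup>2 / 2\<close>. The part with \<open>\<bar>r - z\<bar> \<ge> \<delta>\<close>
  is removed by exponential Markov inequalities. On the rest one changes measure by \<open>exp Y\<close>, whose
  mean is \<open>1 + o(1)\<close> because \<open>exp (s - s\<^sup>2 / 2) = 1 + s + O(\<bar>s\<bar>\<^sup>3)\<close>. Under the new measure \<open>Y / z\<close> is nearly
  normal with mean \<open>z / 2\<close> and variance 1, and the required expectation of \<open>exp (- Y)\<close> is computed by a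
  Lindeberg replacement argument applied to a Gaussian smoothing of \<open>exp (- z * u) * 1(u \<ge> 0)\<close>. The
  normal steps already inserted regularize the test function, which makes the error \<open>o(1 / z)\<close>.
\<close>

section \<open>The standard normal distribution function and the Mills ratio\<close>

text \<open>The target is a relative error. \<open>Phi (- x)\<close> is of order
  \<open>exp (- x\<^sup>2 / 2) / x\<close>, so once the exponential is split off, every other
  contribution must be small against \<open>1 / x\<close>, uniformly over
  \<open>x \<ge> c0 > 0\<close>; a fixed level \<alpha> < 1 provides such a \<open>c0\<close>. Only
  third moments are available, so \<open>exp s\<close> need not be integrable. Weights
  \<open>exp (s - c * s\<^sup>2)\<close> with \<open>c > 0\<close> are bounded, and this dictates
  both the tilt and the Chernoff weights. Smoothing at width \<open>h = \<eta> / x\<close> alone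
  does not suffice: third derivatives of order \<open>h^-3\<close> against a total third moment
  error of order \<open>\<beta> / x^3\<close> give \<open>\<beta> / \<eta>^3\<close>. After
  \<open>l\<close> replacements the variance of the smoothing is about \<open>h^2 + l / n\<close>,
  and summing its power \<open>-3/2\<close> over \<open>l\<close> gains the missing factor.
  Estimates take the form "for every \<epsilon> there is a threshold for \<open>\<beta>\<close>,
  valid for all laws, all \<open>n\<close> and all \<open>x\<close> in range", because the space,
  the dimension and the coordinate all change with \<open>n\<close>.\<close>

lemma Phi_diff:
  assumes "a \<le> b"
  shows "Phi b - Phi a = integral {a..b} std_normal_density"
proof -
  interpret real_distribution std_normal_distribution
    by (rule real_dist_normal_dist)
  have "Phi b - Phi a = measure std_normal_distribution {a<..b}"
    unfolding Phi_def using cdf_diff_eq[of a b] assms by (cases "a = b") (auto simp: cdf_def)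
  also have "\<dots> = (LINT z|lborel. indicator {a<..b} z *\<^sub>R std_normal_density z)"
    using integral_density[of "indicator {a<..b} :: real \<Rightarrow> real" lborel std_normal_density]
    by (simp add: mult.commute)
  also have "\<dots> = (LINT z|lborel. indicator {a..b} z *\<^sub>R std_normal_density z)"
    by (rule integral_cong_AE) (auto intro!: AE_I[where N="{a}"] split: split_indicator)
  also have "\<dots> = integral {a..b} std_normal_density"
    by (rule set_borel_integral_eq_integral(2)[unfolded set_lebesgue_integral_def])
       (simp add: set_integrable_def integrable_mult_indicator[where 'b=real, unfolded real_scaleR_def])
  finally show ?thesis .
qed

lemma DERIV_Phi [derivative_intros]:
  assumes "(g has_field_derivative g') (at x within S)"
  shows "((\<lambda>x. Phi (g x)) has_field_derivative std_normal_density (g x) * g') (at x within S)"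
proof (rule DERIV_chain2[OF _ assms])
  let ?y = "g x"
  have "((\<lambda>u. integral {?y - 1..u} std_normal_density) has_real_derivative std_normal_density ?y)
      (at ?y within {?y - 1..?y + 1})"
    by (rule integral_has_real_derivative)
       (auto simp: normal_density_def intro!: continuous_intros)
  then have "((\<lambda>u. integral {?y - 1..u} std_normal_density) has_real_derivative std_normal_density ?y) (at ?y)"
    by (subst (asm) at_within_interior) (auto simp: interior_atLeastAtMost_real)
  then have "((\<lambda>u. Phi (?y - 1) + integral {?y - 1..u} std_normal_density)
      has_real_derivative std_normal_density ?y) (at ?y)"
    by (auto intro!: derivative_eq_intros)
  then show "(Phi has_real_derivative std_normal_density ?y) (at ?y)"
  proof (rule has_field_derivative_transform_within_open[where S="{?y - 1<..}"])
    show "Phi (?y - 1) + integral {?y - 1..u} std_normal_density = Phi u" if "u \<in> {?y - 1<..}" for u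
      using Phi_diff[of "?y - 1" u] that by simp
  qed auto
qed

lemma Phi_nonneg [simp]: "0 \<le> Phi x"
  by (simp add: Phi_def)

lemma Phi_tendsto_at_top: "(Phi \<longlongrightarrow> 1) at_top"
  and Phi_tendsto_at_bot: "(Phi \<longlongrightarrow> 0) at_bot"
proof -
  interpret real_distribution std_normal_distribution
    by (rule real_dist_normal_dist)
  have "Phi = cdf std_normal_distribution"
    by (auto simp: Phi_def cdf_def)
  then show "(Phi \<longlongrightarrow> 1) at_top" "(Phi \<longlongrightarrow> 0) at_bot"
    using cdf_lim_at_top_prob cdf_lim_at_bot by simp_all
qed

lemma isCont_Phi [simp]: "isCont Phi x"
  using DERIV_Phi[OF DERIV_ident] by (rule DERIV_isCont)

lemma Phi_strict_mono: "x < y \<Longrightarrow> Phi x < Phi y"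
  by (rule DERIV_pos_imp_increasing)
     (auto intro!: exI DERIV_Phi[OF DERIV_ident] normal_density_pos)

lemma Phi_mono: "x \<le> y \<Longrightarrow> Phi x \<le> Phi y"
  using Phi_strict_mono by (cases "x = y") (auto intro: less_imp_le)

lemma Phi_pos [simp]: "0 < Phi x"
  using Phi_strict_mono[of "x - 1" x] Phi_nonneg[of "x - 1"] by linarith

lemma DERIV_std_normal_density [derivative_intros]:
  assumes "(g has_field_derivative g') (at x within S)"
  shows "((\<lambda>x. std_normal_density (g x)) has_field_derivative
    - g x * std_normal_density (g x) * g') (at x within S)"
proof -
  have "((\<lambda>x. exp (- (g x)\<^sup>2 / 2)) has_field_derivative - g x * exp (- (g x)\<^sup>2 / 2) * g') (at x within S)"
    using assms by (auto intro!: derivative_eq_intros)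
  from DERIV_cmult[OF this, of "1 / sqrt (2 * pi)"] show ?thesis
    by (simp add: std_normal_density_def mult_ac)
qed

lemma std_normal_density_minus [simp]: "std_normal_density (- x) = std_normal_density x"
  by (simp add: std_normal_density_def)

lemma Phi_minus: "Phi (- x) = 1 - Phi x"
proof -
  have d: "((\<lambda>x. Phi x + Phi (- x)) has_real_derivative 0) (at x)" for x
    by (auto intro!: derivative_eq_intros)
  have const: "Phi x + Phi (- x) = Phi y + Phi (- y)" for x y
    using DERIV_isconst_all[of "\<lambda>x. Phi x + Phi (- x)" x y] d by simp
  have "((\<lambda>y. Phi y + Phi (- y)) \<longlongrightarrow> 1 + 0) at_top"
    by (intro tendsto_add Phi_tendsto_at_top
        filterlim_compose[OF Phi_tendsto_at_bot filterlim_uminus_at_bot_at_top])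
  moreover have "(\<lambda>y. Phi y + Phi (- y)) = (\<lambda>_. Phi x + Phi (- x))"
    using const by blast
  ultimately have "Phi x + Phi (- x) = 1"
    by (simp add: tendsto_const_iff)
  then show ?thesis by simp
qed

lemma Phi_0: "Phi 0 = 1 / 2"
  using Phi_minus[of 0] by simp

text \<open>\<open>Phi_inv\<close> is a definite description, so both halves must be checked: a root
  exists by the intermediate value theorem between the limits 0 and 1, and strict monotonicity makes
  it unique.\<close>

lemma Phi_Phi_inv:
  assumes "0 < q" "q < 1"
  shows "Phi (Phi_inv q) = q"
proof -
  have "eventually (\<lambda>x. Phi x < q) at_bot" "eventually (\<lambda>x. Phi x > q) at_top"
    using order_tendstoD[OF Phi_tendsto_at_bot] order_tendstoD[OF Phi_tendsto_at_top] assms by auto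
  then obtain a b where ab: "Phi a < q" "q < Phi b"
    unfolding eventually_at_bot_linorder eventually_at_top_linorder by blast
  then have "a \<le> b"
    using Phi_mono[of b a] by linarith
  then have "\<exists>x. a \<le> x \<and> x \<le> b \<and> Phi x = q"
    using ab by (intro IVT) auto
  then obtain x where "Phi x = q" by blast
  moreover have "y = x" if "Phi y = q" for y
    using Phi_strict_mono[of x y] Phi_strict_mono[of y x] that \<open>Phi x = q\<close>
    by (cases x y rule: linorder_cases) auto
  ultimately show ?thesis
    unfolding Phi_inv_def by (rule theI)
qed

text \<open>The Mills ratio \<open>Phi (- y) / std_normal_density y\<close> divided by
  \<open>sqrt (2 * pi)\<close>: the factor left when \<open>exp (- y\<^sup>2 / 2)\<close> is split
  off from the tail.\<close>

definition mills :: "real \<Rightarrow> real" where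
  "mills y = exp (y\<^sup>2 / 2) * Phi (- y)"

lemma mills_pos [simp]: "0 < mills y"
  by (simp add: mills_def)

lemma Phi_minus_eq_mills: "Phi (- y) = exp (- y\<^sup>2 / 2) * mills y"
  by (simp add: mills_def exp_minus field_simps)

lemma DERIV_mills:
  "(mills has_real_derivative y * mills y - 1 / sqrt (2 * pi)) (at y)"
  unfolding mills_def
  by (auto intro!: derivative_eq_intros
      simp: normal_density_def exp_minus field_simps power2_eq_square)

section \<open>Two-sided bounds on the Mills ratio and their monotonicity consequences\<close>

lemma antimono_tendsto_0_nonneg:
  fixes f :: "real \<Rightarrow> real"
  assumes "\<And>x. c \<le> x \<Longrightarrow> \<exists>d. (f has_real_derivative d) (at x) \<and> d \<le> 0"
    and "(f \<longlongrightarrow> 0) at_top" and "c \<le> x"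
  shows "0 \<le> f x"
proof -
  have "f y \<le> f x" if "x \<le> y" for y
  proof (rule DERIV_nonpos_imp_nonincreasing[OF that])
    fix z assume "x \<le> z"
    then have "c \<le> z" using assms(3) by simp
    then show "\<exists>d. (f has_real_derivative d) (at z) \<and> d \<le> 0"
      by (rule assms(1))
  qed
  then have "eventually (\<lambda>y. f y \<le> f x) at_top"
    using eventually_ge_at_top[of x] by (rule eventually_mono[rotated])
  then show ?thesis
    by (rule tendsto_upperbound[OF assms(2)]) simp
qed

lemma std_normal_density_tendsto_0: "(std_normal_density \<longlongrightarrow> 0) at_top"
  unfolding normal_density_def by real_asymp

lemma Phi_minus_tendsto_0: "((\<lambda>y. Phi (- y)) \<longlongrightarrow> 0) at_top"
  by (rule filterlim_compose[OF Phi_tendsto_at_bot filterlim_uminus_at_bot_at_top])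

text \<open>\<open>std_normal_density x / x - Phi (- x)\<close> has derivative
  \<open>- std_normal_density x / x\<^sup>2\<close> and vanishes at infinity, so it decreases to 0
  from above.\<close>

lemma mills_upper:
  assumes "0 < y"
  shows "y * mills y \<le> 1 / sqrt (2 * pi)"
proof -
  let ?f = "\<lambda>x. std_normal_density x / x - Phi (- x)"
  have "0 \<le> ?f y"
  proof (rule antimono_tendsto_0_nonneg[where f="?f" and c=y])
    fix x :: real assume "y \<le> x"
    then have x: "x > 0" using assms by simp
    have "(?f has_real_derivative - std_normal_density x / x\<^sup>2) (at x)"
      using x by (auto intro!: derivative_eq_intros simp: field_simps power2_eq_square)
    then show "\<exists>d. (?f has_real_derivative d) (at x) \<and> d \<le> 0"
      by (intro exI conjI) auto
  next
    show "(?f \<longlongrightarrow> 0) at_top"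
      using tendsto_diff[OF tendsto_divide_0[OF std_normal_density_tendsto_0
          filterlim_at_top_imp_at_infinity[OF filterlim_ident]] Phi_minus_tendsto_0]
      by simp
  qed simp
  then show ?thesis
    using assms by (simp add: Phi_minus_eq_mills std_normal_density_def field_simps)
qed

text \<open>Same scheme: the difference of the two tails has derivative
  \<open>- 2 * std_normal_density x / (1 + x\<^sup>2)\<^sup>2\<close>. This form of the lower bound
  is exactly what the monotonicity of \<open>y * mills y\<close> asks for.\<close>

lemma mills_lower:
  assumes "0 < y"
  shows "y / (1 + y\<^sup>2) / sqrt (2 * pi) \<le> mills y"
proof -
  let ?f = "\<lambda>x. Phi (- x) - std_normal_density x * (x / (1 + x\<^sup>2))"
  have "0 \<le> ?f y"
  proof (rule antimono_tendsto_0_nonneg[where f="?f" and c=y])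
    fix x :: real
    have nz: "1 + x\<^sup>2 \<noteq> 0" by (smt (verit) zero_le_power2)
    have "((\<lambda>x. x / (1 + x\<^sup>2)) has_real_derivative (1 - x\<^sup>2) / (1 + x\<^sup>2)\<^sup>2) (at x)"
      using nz by (auto intro!: derivative_eq_intros simp: power2_eq_square)
    then have "(?f has_real_derivative
        - std_normal_density x - (- x * std_normal_density x * (x / (1 + x\<^sup>2))
        + std_normal_density x * ((1 - x\<^sup>2) / (1 + x\<^sup>2)\<^sup>2))) (at x)"
      by (intro DERIV_diff[OF DERIV_Phi[OF DERIV_minus[OF DERIV_ident], THEN DERIV_cong]
            DERIV_mult'[OF DERIV_std_normal_density[OF DERIV_ident], THEN DERIV_cong]]) auto
    moreover have "- std_normal_density x - (- x * std_normal_density x * (x / (1 + x\<^sup>2))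
        + std_normal_density x * ((1 - x\<^sup>2) / (1 + x\<^sup>2)\<^sup>2))
      = - (std_normal_density x * (2 / (1 + x\<^sup>2)\<^sup>2))"
    proof -
      have "- 1 + x * (x / (1 + x\<^sup>2)) - (1 - x\<^sup>2) / (1 + x\<^sup>2)\<^sup>2 = - (2 / (1 + x\<^sup>2)\<^sup>2)"
        using nz by (simp add: divide_simps) algebra
      from arg_cong[OF this, of "\<lambda>u. std_normal_density x * u"] show ?thesis
        by (simp add: algebra_simps)
    qed
    ultimately show "\<exists>d. (?f has_real_derivative d) (at x) \<and> d \<le> 0"
      by (intro exI conjI) auto
  next
    have "((\<lambda>x::real. x / (1 + x\<^sup>2)) \<longlongrightarrow> 0) at_top" by real_asymp
    from tendsto_diff[OF Phi_minus_tendsto_0 tendsto_mult[OF std_normal_density_tendsto_0 this]]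
    show "(?f \<longlongrightarrow> 0) at_top" by simp
  qed auto
  then have "exp (- y\<^sup>2 / 2) * (y / (1 + y\<^sup>2) / sqrt (2 * pi)) \<le> exp (- y\<^sup>2 / 2) * mills y"
    by (simp add: Phi_minus_eq_mills std_normal_density_def mult_ac)
  then show ?thesis by (rule mult_left_le_imp_le) simp
qed

lemma mills_antimono:
  assumes "0 < x" "x \<le> y"
  shows "mills y \<le> mills x"
  using assms
  by (intro DERIV_nonpos_imp_nonincreasing[of x y mills])
     (auto intro!: exI DERIV_mills simp: mills_upper)

text \<open>The derivative of \<open>y * mills y\<close> is nonnegative by
  \<open>mills_lower\<close>. Consequently \<open>mills x \<ge> c0 * mills c0 / x\<close> for
  \<open>x \<ge> c0\<close>, which turns an error of order \<open>1 / x\<close> into a relative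
  one.\<close>

lemma mult_mills_mono:
  assumes "0 < x" "x \<le> y"
  shows "x * mills x \<le> y * mills y"
proof (rule DERIV_nonneg_imp_nondecreasing[of x y "\<lambda>y. y * mills y"])
  fix z assume "x \<le> z" "z \<le> y"
  then have z: "0 < z" using assms by simp
  have "((\<lambda>y. y * mills y) has_real_derivative (1 + z\<^sup>2) * mills z - z / sqrt (2 * pi)) (at z)"
    by (auto intro!: derivative_eq_intros DERIV_mills simp: algebra_simps power2_eq_square)
  moreover have "0 < 1 + z\<^sup>2" using z by (simp add: add_pos_pos)
  then have "(1 + z\<^sup>2) * mills z - z / sqrt (2 * pi) \<ge> 0"
    using mult_left_mono[OF mills_lower[OF z], of "1 + z\<^sup>2"] by simp
  ultimately show "\<exists>d. ((\<lambda>y. y * mills y) has_real_derivative d) (at z) \<and> 0 \<le> d"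
    by blast
qed (use assms in auto)

text \<open>Shrinking the argument by a factor \<open>c\<close> near 1 costs only
  \<open>1 / c\<close>; this absorbs the perturbed mean and variance in the final Gaussian
  value.\<close>

lemma mills_scale:
  assumes "0 < x" "0 < c" "c \<le> 1"
  shows "mills (c * x) \<le> mills x / c"
proof -
  have "c * x * mills (c * x) \<le> x * mills x"
    using assms by (intro mult_mills_mono) auto
  then show ?thesis using assms by (simp add: field_simps)
qed

lemma Phi_minus_le_exp:
  assumes "0 < x"
  shows "Phi (- x) \<le> exp (- x\<^sup>2 / 2)"
proof -
  have "mills x \<le> mills 0"
  proof (rule DERIV_nonpos_imp_nonincreasing[of 0 x mills])
    fix z :: real assume "0 \<le> z"
    then have "z * mills z - 1 / sqrt (2 * pi) \<le> 0"
      using mills_upper[of z] by (cases "z = 0") auto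
    then show "\<exists>d. (mills has_real_derivative d) (at z) \<and> d \<le> 0"
      using DERIV_mills by blast
  qed (use assms in auto)
  then have "mills x \<le> 1" by (simp add: mills_def Phi_0)
  then show ?thesis by (simp add: Phi_minus_eq_mills)
qed

section \<open>A Gaussian smoothing of the truncated exponential\<close>

text \<open>\<open>gexp x \<sigma> a\<close> is the expectation of \<open>exp (- x * V)\<close> over the event \<open>V \<ge> 0\<close> for \<open>V\<close> normal
  with mean \<open>a\<close> and standard deviation \<open>\<sigma>\<close>; the definition is its closed form.\<close>

definition gexp :: "real \<Rightarrow> real \<Rightarrow> real \<Rightarrow> real" where
  "gexp x \<sigma> a = exp (- x * a + x\<^sup>2 * \<sigma>\<^sup>2 / 2) * Phi (a / \<sigma> - x * \<sigma>)"

text \<open>Completing the square. For \<open>a\<close> near 0 and \<open>\<sigma>\<close> near 1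
  the value is close to \<open>mills x\<close>, which is how the Gaussian side of the replacement
  reproduces the normal tail.\<close>

lemma gexp_eq_mills:
  assumes "0 < \<sigma>"
  shows "gexp x \<sigma> a = exp (- a\<^sup>2 / (2 * \<sigma>\<^sup>2)) * mills (x * \<sigma> - a / \<sigma>)"
proof -
  have "- x * a + x\<^sup>2 * \<sigma>\<^sup>2 / 2 = - a\<^sup>2 / (2 * \<sigma>\<^sup>2) + (x * \<sigma> - a / \<sigma>)\<^sup>2 / 2"
    using assms by (simp add: field_simps power2_eq_square)
  then show ?thesis
    by (simp only: gexp_def mills_def exp_add) simp
qed

lemma gexp_nonneg [simp]: "0 \<le> gexp x \<sigma> a"
  by (simp add: gexp_def)

lemma nn_integral_normal_density_atLeast:
  assumes "0 < \<sigma>"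
  shows "(\<integral>\<^sup>+z. ennreal (indicator {0..} z * normal_density m \<sigma> z) \<partial>lborel) = ennreal (Phi (m / \<sigma>))"
proof -
  interpret real_distribution std_normal_distribution
    by (rule real_dist_normal_dist)
  have "(\<integral>\<^sup>+z. ennreal (indicator {0..} z * normal_density m \<sigma> z) \<partial>lborel)
      = ennreal \<bar>- \<sigma>\<bar> * (\<integral>\<^sup>+t. ennreal (indicator {0..} (m + (- \<sigma>) * t) * normal_density m \<sigma> (m + (- \<sigma>) * t)) \<partial>lborel)"
    using assms by (intro nn_integral_real_affine) auto
  also have "\<dots> = (\<integral>\<^sup>+t. ennreal \<sigma> * ennreal (indicator {0..} (m + (- \<sigma>) * t) * normal_density m \<sigma> (m + (- \<sigma>) * t)) \<partial>lborel)"
    using assms by (subst nn_integral_cmult) auto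
  also have "\<dots> = (\<integral>\<^sup>+t. ennreal (std_normal_density t) * indicator {..m / \<sigma>} t \<partial>lborel)"
  proof (rule nn_integral_cong)
    fix t
    have "\<sigma> * normal_density m \<sigma> (m + (- \<sigma>) * t) = std_normal_density t"
      using assms by (simp add: normal_density_def real_sqrt_mult power_mult_distrib)
    moreover have "indicator {0..} (m + (- \<sigma>) * t) = (indicator {..m / \<sigma>} t :: real)"
      using assms by (auto simp: indicator_def field_simps)
    ultimately show "ennreal \<sigma> * ennreal (indicator {0..} (m + (- \<sigma>) * t) * normal_density m \<sigma> (m + (- \<sigma>) * t))
      = ennreal (std_normal_density t) * indicator {..m / \<sigma>} t"
      using assms by (auto simp: ennreal_mult[symmetric] indicator_def split: if_splits)
  qed
  also have "\<dots> = emeasure std_normal_distribution {..m / \<sigma>}"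
    by (subst emeasure_density) auto
  also have "\<dots> = ennreal (Phi (m / \<sigma>))"
    by (simp add: Phi_def emeasure_eq_measure)
  finally show ?thesis .
qed

text \<open>Multiplying a normal density by \<open>exp (- x * z)\<close> shifts its mean by
  \<open>- x * \<sigma>\<^sup>2\<close> and produces the constant \<open>?c\<close>; the half-line
  mass of the shifted density is a value of \<open>Phi\<close>.\<close>

lemma nn_integral_gexp:
  assumes "0 < \<sigma>"
  shows "(\<integral>\<^sup>+z. ennreal (indicator {0..} z * exp (- x * z) * normal_density a \<sigma> z) \<partial>lborel)
    = ennreal (gexp x \<sigma> a)"
proof -
  let ?c = "exp (- x * a + x\<^sup>2 * \<sigma>\<^sup>2 / 2)"
  have "exp (- x * z) * normal_density a \<sigma> z = ?c * normal_density (a - x * \<sigma>\<^sup>2) \<sigma> z" for z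
  proof -
    have "- x * z + - (z - a)\<^sup>2 / (2 * \<sigma>\<^sup>2)
      = - x * a + x\<^sup>2 * \<sigma>\<^sup>2 / 2 + - (z - (a - x * \<sigma>\<^sup>2))\<^sup>2 / (2 * \<sigma>\<^sup>2)"
      using assms by (simp add: field_simps power2_eq_square)
    then have "exp (- x * z) * exp (- (z - a)\<^sup>2 / (2 * \<sigma>\<^sup>2))
      = ?c * exp (- (z - (a - x * \<sigma>\<^sup>2))\<^sup>2 / (2 * \<sigma>\<^sup>2))"
      by (simp only: exp_add[symmetric])
    then show ?thesis
      by (simp add: normal_density_def)
  qed
  then have "(\<integral>\<^sup>+z. ennreal (indicator {0..} z * exp (- x * z) * normal_density a \<sigma> z) \<partial>lborel)
    = (\<integral>\<^sup>+z. ennreal ?c * ennreal (indicator {0..} z * normal_density (a - x * \<sigma>\<^sup>2) \<sigma> z) \<partial>lborel)"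
    by (intro nn_integral_cong) (simp add: ennreal_mult[symmetric] mult_ac)
  also have "\<dots> = ennreal ?c * ennreal (Phi ((a - x * \<sigma>\<^sup>2) / \<sigma>))"
    using nn_integral_normal_density_atLeast[OF assms, of "a - x * \<sigma>\<^sup>2"]
    by (subst nn_integral_cmult) auto
  also have "(a - x * \<sigma>\<^sup>2) / \<sigma> = a / \<sigma> - x * \<sigma>"
    using assms by (simp add: field_simps power2_eq_square)
  finally show ?thesis
    by (simp add: gexp_def ennreal_mult)
qed

lemma gexp_le_1:
  assumes "0 < \<sigma>" "0 \<le> x"
  shows "gexp x \<sigma> a \<le> 1"
proof -
  have "ennreal (gexp x \<sigma> a) \<le> (\<integral>\<^sup>+z. ennreal (normal_density a \<sigma> z) \<partial>lborel)"
    unfolding nn_integral_gexp[OF assms(1), symmetric]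
    using assms(2) by (intro nn_integral_mono ennreal_leI)
      (auto simp: indicator_def intro!: mult_left_le_one_le)
  also have "\<dots> = 1"
    using assms(1) by (subst nn_integral_eq_integral) auto
  finally show ?thesis by simp
qed

lemma borel_measurable_Phi [measurable]: "Phi \<in> borel_measurable borel"
  by (intro borel_measurable_continuous_onI continuous_at_imp_continuous_on) auto

lemma borel_measurable_gexp [measurable]: "gexp x \<sigma> \<in> borel_measurable borel"
  unfolding gexp_def[abs_def] by measurable

text \<open>After Fubini the inner integral is a convolution of normal densities. Hence a normal
  step keeps the test function inside the family \<open>gexp\<close>, with a larger variance and a
  shifted argument.\<close>

lemma nn_integral_gexp_normal:
  assumes "0 < \<sigma>" "0 < \<tau>"
  shows "(\<integral>\<^sup>+u. ennreal (normal_density \<theta> \<tau> u * gexp x \<sigma> (a + u)) \<partial>lborel)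
    = ennreal (gexp x (sqrt (\<sigma>\<^sup>2 + \<tau>\<^sup>2)) (a + \<theta>))"
proof -
  let ?g = "\<lambda>z. indicator {0..} z * exp (- x * z)"
  have nn: "0 \<le> ?g z" for z by simp
  have "(\<integral>\<^sup>+u. ennreal (normal_density \<theta> \<tau> u * gexp x \<sigma> (a + u)) \<partial>lborel)
    = (\<integral>\<^sup>+u. \<integral>\<^sup>+z. ennreal (?g z * (normal_density \<theta> \<tau> u * normal_density (a + u) \<sigma> z)) \<partial>lborel \<partial>lborel)"
  proof (rule nn_integral_cong)
    fix u
    have "ennreal (normal_density \<theta> \<tau> u * gexp x \<sigma> (a + u))
      = ennreal (normal_density \<theta> \<tau> u) * (\<integral>\<^sup>+z. ennreal (?g z * normal_density (a + u) \<sigma> z) \<partial>lborel)"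
      by (simp only: nn_integral_gexp[OF assms(1)]) (simp add: ennreal_mult)
    also have "\<dots> = (\<integral>\<^sup>+z. ennreal (normal_density \<theta> \<tau> u) * ennreal (?g z * normal_density (a + u) \<sigma> z) \<partial>lborel)"
      by (subst nn_integral_cmult) auto
    also have "\<dots> = (\<integral>\<^sup>+z. ennreal (?g z * (normal_density \<theta> \<tau> u * normal_density (a + u) \<sigma> z)) \<partial>lborel)"
      by (intro nn_integral_cong) (simp add: ennreal_mult[symmetric] mult_ac)
    finally show "ennreal (normal_density \<theta> \<tau> u * gexp x \<sigma> (a + u)) = \<dots>" .
  qed
  also have "\<dots> = (\<integral>\<^sup>+z. \<integral>\<^sup>+u. ennreal (?g z * (normal_density \<theta> \<tau> u * normal_density (a + u) \<sigma> z)) \<partial>lborel \<partial>lborel)"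
    by (rule lborel_pair.Fubini') (unfold normal_density_def, measurable)
  also have "\<dots> = (\<integral>\<^sup>+z. ennreal (?g z * normal_density (a + \<theta>) (sqrt (\<sigma>\<^sup>2 + \<tau>\<^sup>2)) z) \<partial>lborel)"
  proof (rule nn_integral_cong)
    fix z
    have "(\<integral>\<^sup>+u. ennreal (?g z * (normal_density \<theta> \<tau> u * normal_density (a + u) \<sigma> z)) \<partial>lborel)
      = ennreal (?g z) * (\<integral>\<^sup>+u. ennreal (normal_density \<theta> \<tau> u * normal_density (a + u) \<sigma> z) \<partial>lborel)"
      by (subst nn_integral_cmult[symmetric])
         (measurable, simp_all add: ennreal_mult[symmetric] normal_density_def)
    also have "(\<integral>\<^sup>+u. ennreal (normal_density \<theta> \<tau> u * normal_density (a + u) \<sigma> z) \<partial>lborel)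
      = (\<integral>\<^sup>+u. ennreal (normal_density \<theta> \<tau> (\<theta> + 1 * u) * normal_density (a + (\<theta> + 1 * u)) \<sigma> z) \<partial>lborel)"
      by (subst nn_integral_real_affine[where t=\<theta> and c=1])
         (auto simp: normal_density_def)
    also have "\<dots> = (\<integral>\<^sup>+u. ennreal (normal_density 0 \<sigma> (z - (a + \<theta>) - u) * normal_density 0 \<tau> u) \<partial>lborel)"
      by (intro nn_integral_cong) (simp add: normal_density_def mult_ac algebra_simps)
    also have "\<dots> = ennreal (normal_density 0 (sqrt (\<sigma>\<^sup>2 + \<tau>\<^sup>2)) (z - (a + \<theta>)))"
      by (rule fun_cong[OF conv_normal_density_zero_mean[OF assms]])
    also have "\<dots> = ennreal (normal_density (a + \<theta>) (sqrt (\<sigma>\<^sup>2 + \<tau>\<^sup>2)) z)"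
      by (simp add: normal_density_def)
    finally show "(\<integral>\<^sup>+u. ennreal (?g z * (normal_density \<theta> \<tau> u * normal_density (a + u) \<sigma> z)) \<partial>lborel)
      = ennreal (?g z * normal_density (a + \<theta>) (sqrt (\<sigma>\<^sup>2 + \<tau>\<^sup>2)) z)"
      by (simp add: ennreal_mult)
  qed
  also have "\<dots> = ennreal (gexp x (sqrt (\<sigma>\<^sup>2 + \<tau>\<^sup>2)) (a + \<theta>))"
    using assms by (intro nn_integral_gexp) (simp add: add_pos_pos)
  finally show ?thesis .
qed

text \<open>The first three derivatives in \<open>a\<close>, each obtained from \<open>f' = - x * f\<close> plus a normal density term.\<close>

definition gexp1 where "gexp1 x \<sigma> a = - x * gexp x \<sigma> a + normal_density 0 \<sigma> a"
definition gexp2 where "gexp2 x \<sigma> a = - x * gexp1 x \<sigma> a - a / \<sigma>\<^sup>2 * normal_density 0 \<sigma> a"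
definition gexp3 where
  "gexp3 x \<sigma> a = - x * gexp2 x \<sigma> a + (a\<^sup>2 / \<sigma>^4 - 1 / \<sigma>\<^sup>2) * normal_density 0 \<sigma> a"

section \<open>Derivatives of the smoothed test function and a third-order Taylor bound\<close>

lemma DERIV_normal_density_0:
  assumes "0 < \<sigma>"
  shows "(normal_density 0 \<sigma> has_real_derivative - (a / \<sigma>\<^sup>2) * normal_density 0 \<sigma> a) (at a)"
proof -
  have "((\<lambda>a. exp (- a\<^sup>2 / (2 * \<sigma>\<^sup>2))) has_real_derivative - (a / \<sigma>\<^sup>2) * exp (- a\<^sup>2 / (2 * \<sigma>\<^sup>2))) (at a)"
    using assms by (auto intro!: derivative_eq_intros simp: field_simps)
  from DERIV_cmult[OF this, of "1 / sqrt (2 * pi * \<sigma>\<^sup>2)"] show ?thesis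
    by (simp add: normal_density_def[abs_def] mult_ac)
qed

lemma DERIV_gexp:
  assumes "0 < \<sigma>"
  shows "(gexp x \<sigma> has_real_derivative gexp1 x \<sigma> a) (at a)"
proof -
  let ?e = "exp (- x * a + x\<^sup>2 * \<sigma>\<^sup>2 / 2)"
  have "- x * a + x\<^sup>2 * \<sigma>\<^sup>2 / 2 + - (a / \<sigma> - x * \<sigma>)\<^sup>2 / 2 = - a\<^sup>2 / (2 * \<sigma>\<^sup>2)"
    using assms by (simp add: field_simps power2_eq_square)
  then have "?e * exp (- (a / \<sigma> - x * \<sigma>)\<^sup>2 / 2) = exp (- a\<^sup>2 / (2 * \<sigma>\<^sup>2))"
    by (simp only: exp_add[symmetric])
  then have "?e * std_normal_density (a / \<sigma> - x * \<sigma>) * (1 / \<sigma>) = normal_density 0 \<sigma> a"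
    using assms by (simp add: normal_density_def real_sqrt_mult)
  moreover have "(gexp x \<sigma> has_real_derivative
      - x * ?e * Phi (a / \<sigma> - x * \<sigma>) + ?e * std_normal_density (a / \<sigma> - x * \<sigma>) * (1 / \<sigma>)) (at a)"
    unfolding gexp_def[abs_def] using assms
    by (auto intro!: derivative_eq_intros)
  ultimately show ?thesis
    by (simp only: gexp1_def gexp_def mult.assoc)
qed

lemma DERIV_gexp1:
  assumes "0 < \<sigma>"
  shows "(gexp1 x \<sigma> has_real_derivative gexp2 x \<sigma> a) (at a)"
  unfolding gexp1_def[abs_def]
  by (rule DERIV_cong, rule derivative_intros, rule DERIV_cmult, rule DERIV_gexp[OF assms],
      rule DERIV_normal_density_0[OF assms]) (simp add: gexp2_def)

lemma DERIV_gexp2: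
  assumes "0 < \<sigma>"
  shows "(gexp2 x \<sigma> has_real_derivative gexp3 x \<sigma> a) (at a)"
  unfolding gexp2_def[abs_def] divide_inverse
  by (rule DERIV_cong, rule derivative_intros, rule DERIV_cmult, rule DERIV_gexp1[OF assms],
      rule DERIV_mult, rule DERIV_cmult_right, rule DERIV_ident, rule DERIV_normal_density_0[OF assms])
     (use assms in \<open>simp add: gexp3_def gexp2_def field_simps power2_eq_square power4_eq_xxxx\<close>)

lemma DERIV_gexp3:
  assumes "0 < \<sigma>"
  shows "(gexp3 x \<sigma> has_real_derivative
    (3 * a / \<sigma>^4 - a^3 / \<sigma>^6) * normal_density 0 \<sigma> a - x * gexp3 x \<sigma> a) (at a)"
proof -
  have "((\<lambda>a. a\<^sup>2 / \<sigma>^4 - 1 / \<sigma>\<^sup>2) has_real_derivative 2 * a / \<sigma>^4) (at a)"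
    unfolding divide_inverse by (auto intro!: derivative_eq_intros)
  from DERIV_add[OF DERIV_cmult[OF DERIV_gexp2[OF assms], of "- x"] DERIV_mult[OF this DERIV_normal_density_0[OF assms]]]
  show ?thesis
    unfolding gexp3_def[abs_def]
    by (rule DERIV_cong) (use assms in \<open>simp add: gexp3_def field_simps eval_nat_numeral\<close>)
qed

text \<open>The integrating factor makes \<open>exp (x * a) * (H a - c / x)\<close> nonincreasing,
  and boundedness of \<open>H\<close> gives it an upper bound that tends to 0 at minus infinity; so
  it is nonpositive everywhere.\<close>

lemma bounded_decay_ode_upper:
  fixes H f :: "real \<Rightarrow> real"
  assumes "\<And>a. (H has_real_derivative f a - x * H a) (at a)"
    and "\<And>a. H a \<le> B" and "\<And>a. f a \<le> c" and "0 < x"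
  shows "H a \<le> c / x"
proof -
  let ?F = "\<lambda>a. exp (x * a) * (H a - c / x)"
  have dF: "(?F has_real_derivative exp (x * a) * (f a - c)) (at a)" for a
    using assms(4) by (auto intro!: derivative_eq_intros assms(1) simp: field_simps)
  have "?F a \<le> ?F b" if "b \<le> a" for b
    by (rule DERIV_nonpos_imp_nonincreasing[OF that], intro exI conjI, rule dF)
       (simp add: mult_nonneg_nonpos assms(3))
  moreover have "?F b \<le> exp (x * b) * (B - c / x)" for b
    using assms(2) by (intro mult_left_mono) auto
  ultimately have "eventually (\<lambda>b. ?F a \<le> exp (x * b) * (B - c / x)) at_bot"
    by (intro eventually_at_bot_linorderI[of a]) (meson order_trans)
  moreover have "((\<lambda>b. exp (x * b) * (B - c / x)) \<longlongrightarrow> 0) at_bot"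
    using assms(4) by real_asymp
  ultimately have "?F a \<le> 0"
    by (intro tendsto_lowerbound[where F="at_bot :: real filter"]) auto
  then show ?thesis
    by (simp add: mult_le_0_iff)
qed

lemma abs_power_le_exp_half_square:
  fixes t :: real
  shows "\<bar>t\<bar> \<le> exp (t\<^sup>2 / 2)" "t\<^sup>2 \<le> 2 * exp (t\<^sup>2 / 2)" "\<bar>t\<bar>^3 \<le> 4 * exp (t\<^sup>2 / 2)"
proof -
  have e: "1 + t\<^sup>2 / 2 + (t\<^sup>2 / 2)\<^sup>2 / 2 \<le> exp (t\<^sup>2 / 2)"
    by (rule exp_lower_Taylor_quadratic) simp
  \<comment> \<open>The first square gives \<open>2 * \<bar>t\<bar> \<le> 1 + t\<^sup>2\<close>, the
    second \<open>4 * \<bar>t\<bar>^3 \<le> t^4 + 4 * t\<^sup>2\<close>; the right sides are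
    compared with the quadratic Taylor polynomial of the exponential.\<close>
  have *: "0 \<le> (\<bar>t\<bar> - 1)\<^sup>2" "0 \<le> (\<bar>t\<bar> - 2)\<^sup>2 * t\<^sup>2" "0 \<le> (t\<^sup>2)\<^sup>2"
    by auto
  show "\<bar>t\<bar> \<le> exp (t\<^sup>2 / 2)"
    using e *(1,3) by (simp add: power2_eq_square algebra_simps)
  show "t\<^sup>2 \<le> 2 * exp (t\<^sup>2 / 2)"
    using e zero_le_power2[of "t\<^sup>2 / 2"] by linarith
  have e4: "1 + t\<^sup>2 / 2 + t^4 / 8 \<le> exp (t\<^sup>2 / 2)"
    using e by (simp add: power_divide)
  have t3: "4 * \<bar>t\<bar>^3 \<le> t^4 + 4 * t\<^sup>2"
    using *(2) by (simp add: eval_nat_numeral algebra_simps)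
  show "\<bar>t\<bar>^3 \<le> 4 * exp (t\<^sup>2 / 2)"
  proof -
    have "0 \<le> t^4" "0 \<le> t\<^sup>2" by auto
    then show ?thesis using e4 t3 by linarith
  qed
qed

text \<open>These are the density and its first three derivatives. With
  \<open>a = t * \<sigma>\<close> each is a polynomial in \<open>t\<close> times
  \<open>exp (- t\<^sup>2 / 2)\<close> and a negative power of \<open>\<sigma>\<close>; the factor
  \<open>1 / sqrt (2 * pi)\<close> is estimated by 1.\<close>

lemma normal_density_0_bounds:
  assumes "0 < \<sigma>"
  shows "normal_density 0 \<sigma> a \<le> 1 / \<sigma>"
    "\<bar>a / \<sigma>\<^sup>2 * normal_density 0 \<sigma> a\<bar> \<le> 1 / \<sigma>\<^sup>2"
    "\<bar>(a\<^sup>2 / \<sigma>^4 - 1 / \<sigma>\<^sup>2) * normal_density 0 \<sigma> a\<bar> \<le> 3 / \<sigma>^3"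
    "\<bar>(3 * a / \<sigma>^4 - a^3 / \<sigma>^6) * normal_density 0 \<sigma> a\<bar> \<le> 7 / \<sigma>^4"
proof -
  define t where "t = a / \<sigma>"
  have a: "a = t * \<sigma>" using assms by (simp add: t_def)
  have pi: "1 \<le> sqrt (2 * pi)" using pi_gt3 by simp
  have E: "0 < exp (t\<^sup>2 / 2)" "1 \<le> exp (t\<^sup>2 / 2)" by auto
  have nd: "normal_density 0 \<sigma> a = inverse (sqrt (2 * pi)) * inverse (exp (t\<^sup>2 / 2)) / \<sigma>"
    using assms by (simp add: normal_density_def a real_sqrt_mult power_mult_distrib exp_minus field_simps)
  have main: "\<bar>u * normal_density 0 \<sigma> a\<bar> \<le> k / \<sigma>" if "\<bar>u\<bar> \<le> k * exp (t\<^sup>2 / 2)" for u k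
  proof -
    have "\<bar>u * normal_density 0 \<sigma> a\<bar> = \<bar>u\<bar> * inverse (exp (t\<^sup>2 / 2)) * inverse (sqrt (2 * pi)) / \<sigma>"
      using assms by (simp add: nd abs_mult)
    also have "\<dots> \<le> (\<bar>u\<bar> * inverse (exp (t\<^sup>2 / 2))) * 1 / \<sigma>"
      using pi assms by (intro divide_right_mono mult_left_mono) (auto simp: field_simps)
    also have "\<dots> \<le> k / \<sigma>"
      using that assms by (intro divide_right_mono) (auto simp: field_simps)
    finally show ?thesis .
  qed
  note p = abs_power_le_exp_half_square[of t]
  show "normal_density 0 \<sigma> a \<le> 1 / \<sigma>"
    using main[of 1 1] by simp
  show "\<bar>a / \<sigma>\<^sup>2 * normal_density 0 \<sigma> a\<bar> \<le> 1 / \<sigma>\<^sup>2"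
    using divide_right_mono[OF main[of t 1], of \<sigma>] p assms
    by (simp add: a power2_eq_square abs_mult mult_ac)
  have "\<bar>t\<^sup>2 - 1\<bar> \<le> 3 * exp (t\<^sup>2 / 2)" "\<bar>3 * t - t^3\<bar> \<le> 7 * exp (t\<^sup>2 / 2)"
  proof -
    have "\<bar>t^3\<bar> \<le> 4 * exp (t\<^sup>2 / 2)" using p(3) by (simp add: power_abs)
    then show "\<bar>t\<^sup>2 - 1\<bar> \<le> 3 * exp (t\<^sup>2 / 2)" "\<bar>3 * t - t^3\<bar> \<le> 7 * exp (t\<^sup>2 / 2)"
      using p(1,2) E(2) zero_le_power2[of t] by arith+
  qed
  note q = this
  have "(a\<^sup>2 / \<sigma>^4 - 1 / \<sigma>\<^sup>2) * normal_density 0 \<sigma> a = (t\<^sup>2 - 1) * normal_density 0 \<sigma> a / \<sigma>\<^sup>2"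
    using assms by (simp add: a field_simps eval_nat_numeral)
  then show "\<bar>(a\<^sup>2 / \<sigma>^4 - 1 / \<sigma>\<^sup>2) * normal_density 0 \<sigma> a\<bar> \<le> 3 / \<sigma>^3"
    using divide_right_mono[OF main[OF q(1)], of "\<sigma>\<^sup>2"] assms
    by (simp add: abs_mult eval_nat_numeral mult_ac)
  have "(3 * a / \<sigma>^4 - a^3 / \<sigma>^6) * normal_density 0 \<sigma> a = (3 * t - t^3) * normal_density 0 \<sigma> a / \<sigma>^3"
    using assms by (simp add: a field_simps eval_nat_numeral)
  then show "\<bar>(3 * a / \<sigma>^4 - a^3 / \<sigma>^6) * normal_density 0 \<sigma> a\<bar> \<le> 7 / \<sigma>^4"
    using divide_right_mono[OF main[OF q(2)], of "\<sigma>^3"] assms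
    by (simp add: abs_mult eval_nat_numeral mult_ac)
qed

text \<open>For \<open>x * \<sigma> \<le> 1\<close> the explicit formula suffices. For \<open>x * \<sigma> > 1\<close> it is too lossy, but the
  third derivative is a bounded solution of \<open>H' + x * H = f\<close>, hence bounded by \<open>sup f / x\<close>.\<close>

lemma gexp3_bound:
  assumes "0 < \<sigma>" "0 < x"
  shows "\<bar>gexp3 x \<sigma> a\<bar> \<le> 7 / \<sigma>^3"
proof -
  note nd = normal_density_0_bounds[OF assms(1)]
  have crude: "\<bar>gexp3 x \<sigma> a\<bar> \<le> x^3 + x\<^sup>2 / \<sigma> + x / \<sigma>\<^sup>2 + 3 / \<sigma>^3" for a
  proof -
    have "\<bar>- A + B + C + D\<bar> \<le> A' + B' + C' + D'"
      if "\<bar>A\<bar> \<le> A'" "\<bar>B\<bar> \<le> B'" "\<bar>C\<bar> \<le> C'" "\<bar>D\<bar> \<le> D'" for A B C D A' B' C' D' :: real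
      using that by arith
    moreover have "gexp3 x \<sigma> a = - (x^3 * gexp x \<sigma> a) + x\<^sup>2 * normal_density 0 \<sigma> a
        + x * (a / \<sigma>\<^sup>2 * normal_density 0 \<sigma> a) + (a\<^sup>2 / \<sigma>^4 - 1 / \<sigma>\<^sup>2) * normal_density 0 \<sigma> a"
      by (simp add: gexp3_def gexp2_def gexp1_def algebra_simps power2_eq_square power3_eq_cube)
    moreover have "\<bar>x^3 * gexp x \<sigma> a\<bar> \<le> x^3"
      using assms gexp_le_1[of \<sigma> x a] by (simp add: abs_mult mult_left_le)
    moreover have "\<bar>x\<^sup>2 * normal_density 0 \<sigma> a\<bar> \<le> x\<^sup>2 / \<sigma>"
      using mult_left_mono[OF nd(1)[of a], of "x\<^sup>2"] by (simp add: abs_mult)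
    moreover have "\<bar>x * (a / \<sigma>\<^sup>2 * normal_density 0 \<sigma> a)\<bar> \<le> x / \<sigma>\<^sup>2"
      using mult_left_mono[OF nd(2)[of a], of x] assms by (simp add: abs_mult)
    ultimately show ?thesis
      using nd(3)[of a] by presburger
  qed
  show ?thesis
  proof (cases "x * \<sigma> \<le> 1")
    case True
    then have x: "x \<le> 1 / \<sigma>" using assms by (simp add: field_simps)
    have "x^3 \<le> 1 / \<sigma>^3" "x\<^sup>2 / \<sigma> \<le> 1 / \<sigma>^3" "x / \<sigma>\<^sup>2 \<le> 1 / \<sigma>^3"
      using power_mono[OF x, of 3] divide_right_mono[OF power_mono[OF x, of 2], of \<sigma>]
        divide_right_mono[OF x, of "\<sigma>\<^sup>2"] assms
      by (auto simp: power_divide eval_nat_numeral mult_ac)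
    then have "\<bar>gexp3 x \<sigma> a\<bar> \<le> 6 / \<sigma>^3"
      using crude[of a] by simp
    also have "\<dots> \<le> 7 / \<sigma>^3"
      using assms by (simp add: divide_right_mono)
    finally show ?thesis .
  next
    case False
    let ?f = "\<lambda>a. (3 * a / \<sigma>^4 - a^3 / \<sigma>^6) * normal_density 0 \<sigma> a"
    \<comment> \<open>Only an a priori bound for the differential inequality; its size does not
      enter the result.\<close>
    let ?B = "x^3 + x\<^sup>2 / \<sigma> + x / \<sigma>\<^sup>2 + 3 / \<sigma>^3"
    have "gexp3 x \<sigma> a \<le> 7 / \<sigma>^4 / x"
    proof (rule bounded_decay_ode_upper[where H="gexp3 x \<sigma>" and f="?f" and B="?B"])
      show "(gexp3 x \<sigma> has_real_derivative ?f a - x * gexp3 x \<sigma> a) (at a)" for a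
        by (rule DERIV_gexp3[OF assms(1)])
      show "gexp3 x \<sigma> a \<le> ?B" for a using crude[of a] by linarith
      show "?f a \<le> 7 / \<sigma>^4" for a using nd(4)[of a] by linarith
    qed fact
    moreover have "- gexp3 x \<sigma> a \<le> 7 / \<sigma>^4 / x"
    proof (rule bounded_decay_ode_upper[where H="\<lambda>a. - gexp3 x \<sigma> a" and f="\<lambda>a. - ?f a" and B="?B"])
      show "((\<lambda>a. - gexp3 x \<sigma> a) has_real_derivative - ?f a - x * - gexp3 x \<sigma> a) (at a)" for a
        using DERIV_minus[OF DERIV_gexp3[OF assms(1), of x a]] by (rule DERIV_cong) simp
      show "- gexp3 x \<sigma> a \<le> ?B" for a using crude[of a] by linarith
      show "- ?f a \<le> 7 / \<sigma>^4" for a using nd(4)[of a] by linarith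
    qed fact
    moreover have "7 / \<sigma>^4 / x \<le> 7 / \<sigma>^3"
      using False assms by (simp add: field_simps eval_nat_numeral)
    ultimately show ?thesis by linarith
  qed
qed

lemma gexp_taylor:
  assumes "0 < \<sigma>" "0 < x"
  shows "\<bar>gexp x \<sigma> (a + q) - (gexp x \<sigma> a + q * gexp1 x \<sigma> a + q\<^sup>2 / 2 * gexp2 x \<sigma> a)\<bar> \<le> 2 * \<bar>q\<bar>^3 / \<sigma>^3"
proof (cases "q = 0")
  case False
  define df where "df m = (if m = 0 then gexp x \<sigma> else if m = 1 then gexp1 x \<sigma>
    else if m = 2 then gexp2 x \<sigma> else gexp3 x \<sigma>)" for m :: nat
  have "\<exists>t. (if a + q < a then a + q < t \<and> t < a else a < t \<and> t < a + q) \<and>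
    gexp x \<sigma> (a + q) = (\<Sum>m<3. df m a / fact m * (a + q - a)^m) + df 3 t / fact 3 * (a + q - a)^3"
  proof (rule Taylor[where a="a - \<bar>q\<bar>" and b="a + \<bar>q\<bar>"])
    show "\<forall>m t. m < 3 \<and> a - \<bar>q\<bar> \<le> t \<and> t \<le> a + \<bar>q\<bar> \<longrightarrow> (df m has_real_derivative df (Suc m) t) (at t)"
      using DERIV_gexp[OF assms(1), of x] DERIV_gexp1[OF assms(1), of x] DERIV_gexp2[OF assms(1), of x]
      by (auto simp: df_def less_Suc_eq numeral_3_eq_3)
  qed (use False in \<open>auto simp: df_def\<close>)
  then obtain t where "gexp x \<sigma> (a + q) = (\<Sum>m<3. df m a / fact m * q^m) + df 3 t / fact 3 * q^3"
    by auto
  then have "gexp x \<sigma> (a + q) - (gexp x \<sigma> a + q * gexp1 x \<sigma> a + q\<^sup>2 / 2 * gexp2 x \<sigma> a) = gexp3 x \<sigma> t / 6 * q^3"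
    by (simp add: df_def numeral_3_eq_3 power2_eq_square fact_numeral)
  also have "\<bar>\<dots>\<bar> \<le> (7 / \<sigma>^3) / 6 * \<bar>q\<bar>^3"
    using gexp3_bound[OF assms, of t]
    by (simp only: abs_mult power_abs abs_divide) (intro mult_right_mono divide_right_mono, auto)
  also have "\<dots> \<le> 2 * \<bar>q\<bar>^3 / \<sigma>^3"
    using assms by (simp add: field_simps)
  finally show ?thesis .
qed auto

section \<open>Elementary inequalities\<close>

lemma power_le_one_plus_cube:
  fixes a :: real
  assumes "0 \<le> a" "k \<le> 3"
  shows "a^k \<le> 1 + a^3"
proof (cases "a \<le> 1")
  case True
  then have "a^k \<le> 1" using assms by (intro power_le_one) auto
  moreover have "0 \<le> a^3" using assms by simp
  ultimately show ?thesis by linarith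
next
  case False
  then have "a^k \<le> a^3" using assms by (intro power_increasing) auto
  then show ?thesis by linarith
qed

lemma add_cube_le:
  fixes a b :: real
  assumes "0 \<le> a" "0 \<le> b"
  shows "(a + b)^3 \<le> 4 * a^3 + 4 * b^3"
proof -
  have "0 \<le> 3 * (a + b) * (a - b)\<^sup>2" using assms by simp
  then show ?thesis by (simp add: power2_eq_square power3_eq_cube algebra_simps)
qed

lemma exp_remainder:
  fixes u :: real
  shows "\<bar>exp u - 1\<bar> \<le> exp \<bar>u\<bar> * \<bar>u\<bar>"
    and "\<bar>exp u - 1 - u\<bar> \<le> exp \<bar>u\<bar> * \<bar>u\<bar>\<^sup>2 / 2"
    and "\<bar>exp u - 1 - u - u\<^sup>2 / 2\<bar> \<le> exp \<bar>u\<bar> * \<bar>u\<bar>^3 / 6"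
proof -
  have *: "\<bar>exp u - (\<Sum>m<k. u^m / fact m)\<bar> \<le> exp \<bar>u\<bar> * \<bar>u\<bar>^k / fact k" for k
  proof -
    obtain t where t: "\<bar>t\<bar> \<le> \<bar>u\<bar>" "exp u = (\<Sum>m<k. u^m / fact m) + exp t / fact k * u^k"
      using Maclaurin_exp_le[of u k] by blast
    have "exp t \<le> exp \<bar>u\<bar>" using t(1) by simp
    then have "exp t * \<bar>u\<bar>^k / fact k \<le> exp \<bar>u\<bar> * \<bar>u\<bar>^k / fact k"
      by (intro divide_right_mono mult_right_mono) auto
    then show ?thesis
      by (simp add: t(2) abs_mult power_abs)
  qed
  show "\<bar>exp u - 1\<bar> \<le> exp \<bar>u\<bar> * \<bar>u\<bar>"
    "\<bar>exp u - 1 - u\<bar> \<le> exp \<bar>u\<bar> * \<bar>u\<bar>\<^sup>2 / 2"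
    "\<bar>exp u - 1 - u - u\<^sup>2 / 2\<bar> \<le> exp \<bar>u\<bar> * \<bar>u\<bar>^3 / 6"
    using *[of 1] *[of 2] *[of 3]
    by (auto simp: numeral_2_eq_2 numeral_3_eq_3 fact_numeral diff_diff_eq)
qed

text \<open>Taylor's formula for \<open>\<bar>s\<bar> \<le> 1\<close>; beyond 1 the cubic term
  outweighs whatever the linear and quadratic terms subtract. Truncating the exponential allows a
  majorant of degree 3 in \<open>\<bar>s\<bar>\<close>, which the available moments can
  integrate.\<close>

lemma exp_quadratic_le_truncated:
  fixes a c :: real
  shows "\<exists>C\<ge>0. \<forall>s. (if \<bar>s\<bar> \<le> 1 then exp (a * s + c * s\<^sup>2) else 1)
    \<le> 1 + a * s + (a\<^sup>2 / 2 + c) * s\<^sup>2 + C * \<bar>s\<bar>^3"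
proof -
  define L where "L = \<bar>a\<bar> + \<bar>c\<bar>"
  \<comment> \<open>\<open>exp L * L^3\<close> pays for the Taylor remainder and
    \<open>L\<^sup>2\<close> for the terms of order at least 3 in \<open>u\<^sup>2\<close>;
    \<open>\<bar>a\<bar>\<close> and \<open>L\<close> offset negative linear and quadratic terms
    when \<open>\<bar>s\<bar> > 1\<close>.\<close>
  define C where "C = exp L * L^3 + L\<^sup>2 + \<bar>a\<bar> + a\<^sup>2 + L"
  have L: "0 \<le> L" "\<bar>a\<bar> \<le> L" "\<bar>c\<bar> \<le> L" by (auto simp: L_def)
  have "(if \<bar>s\<bar> \<le> 1 then exp (a * s + c * s\<^sup>2) else 1)
    \<le> 1 + a * s + (a\<^sup>2 / 2 + c) * s\<^sup>2 + C * \<bar>s\<bar>^3" for s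
  proof (cases "\<bar>s\<bar> \<le> 1")
    case True
    define u where "u = a * s + c * s\<^sup>2"
    have s2: "s\<^sup>2 \<le> \<bar>s\<bar>"
      using True mult_left_le[of "\<bar>s\<bar>" "\<bar>s\<bar>"] by (simp add: power2_eq_square)
    have s4: "s^4 \<le> \<bar>s\<bar>^3"
      using True power_decreasing[of 3 4 "\<bar>s\<bar>"] by (simp add: power_even_abs)
    have "\<bar>u\<bar> \<le> \<bar>a\<bar> * \<bar>s\<bar> + \<bar>c\<bar> * s\<^sup>2"
      unfolding u_def using abs_triangle_ineq[of "a * s" "c * s\<^sup>2"] by (simp add: abs_mult)
    also have "\<dots> \<le> L * \<bar>s\<bar>"
      using mult_left_mono[OF s2, of "\<bar>c\<bar>"] by (simp add: L_def algebra_simps)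
    finally have u: "\<bar>u\<bar> \<le> L * \<bar>s\<bar>" .
    then have uL: "\<bar>u\<bar> \<le> L"
      using True L mult_left_le[of "\<bar>s\<bar>" L] by linarith
    have "exp \<bar>u\<bar> * \<bar>u\<bar>^3 / 6 \<le> exp L * (L * \<bar>s\<bar>)^3 / 1"
      using u uL L by (intro frac_le mult_mono power_mono) auto
    then have r: "exp u \<le> 1 + u + u\<^sup>2 / 2 + exp L * L^3 * \<bar>s\<bar>^3"
      using exp_remainder(3)[of u] by (simp only: power_mult_distrib mult.assoc)
    have "u\<^sup>2 = a\<^sup>2 * s\<^sup>2 + 2 * a * c * s^3 + c\<^sup>2 * s^4"
      by (simp add: u_def power2_eq_square eval_nat_numeral algebra_simps)
    moreover have "2 * a * c * s^3 \<le> 2 * \<bar>a\<bar> * \<bar>c\<bar> * \<bar>s\<bar>^3"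
      using abs_ge_self[of "2 * a * c * s^3"] by (simp add: abs_mult power_abs)
    moreover have "c\<^sup>2 * s^4 \<le> c\<^sup>2 * \<bar>s\<bar>^3"
      using s4 by (intro mult_left_mono) auto
    moreover have "2 * \<bar>a\<bar> * \<bar>c\<bar> * \<bar>s\<bar>^3 + c\<^sup>2 * \<bar>s\<bar>^3 \<le> L\<^sup>2 * \<bar>s\<bar>^3"
    proof -
      have "2 * \<bar>a\<bar> * \<bar>c\<bar> + c\<^sup>2 \<le> L\<^sup>2"
        by (simp add: L_def power2_sum)
      from mult_right_mono[OF this, of "\<bar>s\<bar>^3"] show ?thesis
        by (simp add: distrib_right)
    qed
    moreover have "0 \<le> L\<^sup>2 * \<bar>s\<bar>^3" "0 \<le> (\<bar>a\<bar> + a\<^sup>2 + L) * \<bar>s\<bar>^3" using L by auto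
    ultimately have "exp u \<le> 1 + u + a\<^sup>2 * s\<^sup>2 / 2 + C * \<bar>s\<bar>^3"
      using r unfolding C_def distrib_right by linarith
    then show ?thesis
      using True by (simp add: u_def algebra_simps)
  next
    case False
    have "\<bar>s\<bar> \<le> \<bar>s\<bar>^3" "s\<^sup>2 \<le> \<bar>s\<bar>^3"
      using False power_increasing[of 1 3 "\<bar>s\<bar>"] power_increasing[of 2 3 "\<bar>s\<bar>"] by auto
    then have "\<bar>a\<bar> * \<bar>s\<bar> \<le> \<bar>a\<bar> * \<bar>s\<bar>^3" "\<bar>c\<bar> * s\<^sup>2 \<le> L * \<bar>s\<bar>^3"
      using L by (auto intro!: mult_left_mono mult_mono)
    moreover have "- (a * s) \<le> \<bar>a\<bar> * \<bar>s\<bar>" "- (c * s\<^sup>2) \<le> \<bar>c\<bar> * s\<^sup>2"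
      using abs_ge_minus_self[of "a * s"] abs_ge_minus_self[of "c * s\<^sup>2"] by (auto simp: abs_mult)
    moreover have "0 \<le> (exp L * L^3 + L\<^sup>2 + a\<^sup>2) * \<bar>s\<bar>^3" "0 \<le> a\<^sup>2 / 2 * s\<^sup>2" using L by auto
    ultimately have "0 \<le> a * s + (a\<^sup>2 / 2 + c) * s\<^sup>2 + C * \<bar>s\<bar>^3"
      unfolding C_def distrib_right by linarith
    then show ?thesis using False by simp
  qed
  moreover have "0 \<le> C" using L by (simp add: C_def)
  ultimately show ?thesis by blast
qed

text \<open>Here the weight is bounded without truncation:
  \<open>s + c * s\<^sup>2 \<le> s - s\<^sup>2 / 4 \<le> 1\<close> by
  \<open>(s - 2)\<^sup>2 \<ge> 0\<close>, so the exponential is at most 3, and for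
  \<open>\<bar>s\<bar> > 1\<close> three extra copies of \<open>\<bar>s\<bar>^3\<close> cover
  it.\<close>

lemma exp_quadratic_le:
  fixes c :: real
  assumes "c \<le> - 1 / 4"
  shows "\<exists>C\<ge>0. \<forall>s. exp (s + c * s\<^sup>2) \<le> 1 + s + (1 / 2 + c) * s\<^sup>2 + C * \<bar>s\<bar>^3"
proof -
  obtain C where C: "0 \<le> C" "\<And>s. (if \<bar>s\<bar> \<le> 1 then exp (1 * s + c * s\<^sup>2) else 1)
    \<le> 1 + 1 * s + (1\<^sup>2 / 2 + c) * s\<^sup>2 + C * \<bar>s\<bar>^3"
    using exp_quadratic_le_truncated[of 1 c] by blast
  have "exp (s + c * s\<^sup>2) \<le> 1 + s + (1 / 2 + c) * s\<^sup>2 + (C + 3) * \<bar>s\<bar>^3" for s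
  proof (cases "\<bar>s\<bar> \<le> 1")
    case True
    have "exp (s + c * s\<^sup>2) \<le> 1 + s + (1 / 2 + c) * s\<^sup>2 + C * \<bar>s\<bar>^3"
      using C(2)[of s] True by simp
    moreover have "0 \<le> 3 * \<bar>s\<bar>^3" by simp
    ultimately show ?thesis
      unfolding distrib_right by linarith
  next
    case False
    have "s + c * s\<^sup>2 \<le> s + (- 1 / 4) * s\<^sup>2"
      using assms by (intro add_left_mono mult_right_mono) auto
    also have "\<dots> \<le> 1"
      using zero_le_power2[of "s - 2"] by (simp add: power2_eq_square algebra_simps)
    finally have "exp (s + c * s\<^sup>2) \<le> exp 1" by simp
    also have "\<dots> \<le> 3" by (rule exp_le)
    finally have "exp (s + c * s\<^sup>2) \<le> 3" .
    moreover have "1 \<le> 1 + s + (1 / 2 + c) * s\<^sup>2 + C * \<bar>s\<bar>^3"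
      using C(2)[of s] False by simp
    moreover have "1 \<le> \<bar>s\<bar>^3"
      using False by (intro one_le_power) auto
    ultimately show ?thesis
      unfolding distrib_right by linarith
  qed
  then show ?thesis
    using C(1) by (intro exI[of _ "C + 3"]) auto
qed

text \<open>The tilting weight is \<open>exp (tilt s)\<close>; the quadratic terms of its expansion cancel.\<close>

definition tilt :: "real \<Rightarrow> real" where "tilt s = s - s\<^sup>2 / 2"

lemma borel_measurable_tilt [measurable]: "tilt \<in> borel_measurable borel"
  unfolding tilt_def[abs_def] by measurable

lemma tilt_le: "tilt s \<le> 1 / 2"
  using zero_le_power2[of "s - 1"] by (simp add: tilt_def power2_eq_square algebra_simps)

lemma exp_half_le: "exp (1 / 2 :: real) \<le> 7 / 4"
proof -
  have "(exp (1 / 2 :: real))\<^sup>2 = exp 1"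
    by (simp add: power2_eq_square exp_add[symmetric])
  also have "\<dots> \<le> 3" by (rule exp_le)
  also have "\<dots> \<le> (7 / 4)\<^sup>2" by (simp add: power2_eq_square)
  finally show ?thesis by (rule power2_le_imp_le) simp
qed

text \<open>Expand in \<open>u = s - s\<^sup>2 / 2\<close>. Up to third order \<open>exp u\<close>
  is \<open>1 + u + u\<^sup>2 / 2\<close>, where the squares cancel, and \<open>exp u * u\<close> is
  \<open>u + u\<^sup>2\<close>, that is \<open>s + s\<^sup>2 / 2\<close>; the last coefficient is
  the origin of the tilted mean \<open>x / 2\<close>. The constant 20 is one value that serves all
  four estimates.\<close>

lemma tilt_bounds:
  "\<bar>exp (tilt s) - 1 - s\<bar> \<le> 20 * \<bar>s\<bar>^3"
  "\<bar>exp (tilt s) * tilt s - s - s\<^sup>2 / 2\<bar> \<le> 20 * \<bar>s\<bar>^3"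
  "\<bar>exp (tilt s) * (tilt s)\<^sup>2 - s\<^sup>2\<bar> \<le> 20 * \<bar>s\<bar>^3"
  "exp (tilt s) * \<bar>tilt s\<bar>^3 \<le> 20 * \<bar>s\<bar>^3"
proof -
  define u where "u = tilt s"
  define p where "p = \<bar>s\<bar>^3"
  have p0: "0 \<le> p" by (simp add: p_def)
  have "\<bar>exp u - 1 - s\<bar> \<le> 20 * p \<and> \<bar>exp u * u - s - s\<^sup>2 / 2\<bar> \<le> 20 * p
    \<and> \<bar>exp u * u\<^sup>2 - s\<^sup>2\<bar> \<le> 20 * p \<and> exp u * \<bar>u\<bar>^3 \<le> 20 * p"
  proof (cases "\<bar>s\<bar> \<le> 1")
    case True
    have s2: "s\<^sup>2 \<le> \<bar>s\<bar>"
      using True mult_left_le[of "\<bar>s\<bar>" "\<bar>s\<bar>"] by (simp add: power2_eq_square)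
    have s4: "\<bar>s^4\<bar> \<le> p"
      using True power_decreasing[of 3 4 "\<bar>s\<bar>"] by (simp add: p_def power_even_abs)
    have s3: "\<bar>s^3\<bar> = p" by (simp add: p_def power_abs)
    have u: "\<bar>u\<bar> \<le> 3 / 2 * \<bar>s\<bar>"
      using s2 zero_le_power2[of s] unfolding u_def tilt_def by arith
    then have "\<bar>u\<bar> \<le> 3 / 2" using True by simp
    then have "exp \<bar>u\<bar> \<le> exp (1 + 1 / 2)" by simp
    also have "\<dots> \<le> 3 * (7 / 4)"
      unfolding exp_add by (intro mult_mono exp_le exp_half_le) auto
    finally have e: "exp \<bar>u\<bar> \<le> 21 / 4" by simp
    have "\<bar>u\<bar>^3 \<le> (3 / 2 * \<bar>s\<bar>)^3"
      using u by (intro power_mono) auto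
    then have u3: "\<bar>u\<bar>^3 \<le> 27 / 8 * p"
      by (simp add: p_def power_mult_distrib eval_nat_numeral)
    \<comment> \<open>The product of 21/4 and 27/8 is just below 18. The remainders below take one
      sixth, one half and all of it, hence the bounds 3, 10 and 18.\<close>
    have eu3: "exp \<bar>u\<bar> * \<bar>u\<bar>^3 \<le> 21 / 4 * (27 / 8 * p)"
      using e u3 by (intro mult_mono) auto
    have r1: "\<bar>exp u - 1 - u - u\<^sup>2 / 2\<bar> \<le> 3 * p"
      using exp_remainder(3)[of u] eu3 p0 by linarith
    have "exp u * u - u - u\<^sup>2 = u * (exp u - 1 - u)"
      by (simp add: algebra_simps power2_eq_square)
    then have "\<bar>exp u * u - u - u\<^sup>2\<bar> = \<bar>u\<bar> * \<bar>exp u - 1 - u\<bar>"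
      by (simp only: abs_mult)
    also have "\<dots> \<le> \<bar>u\<bar> * (exp \<bar>u\<bar> * \<bar>u\<bar>\<^sup>2 / 2)"
      by (intro mult_left_mono exp_remainder) auto
    also have "\<dots> = exp \<bar>u\<bar> * \<bar>u\<bar>^3 / 2"
      by (simp add: eval_nat_numeral)
    finally have r2: "\<bar>exp u * u - u - u\<^sup>2\<bar> \<le> 10 * p"
      using eu3 p0 by linarith
    have "exp u * u\<^sup>2 - u\<^sup>2 = u\<^sup>2 * (exp u - 1)"
      by (simp add: algebra_simps)
    then have "\<bar>exp u * u\<^sup>2 - u\<^sup>2\<bar> = \<bar>u\<bar>\<^sup>2 * \<bar>exp u - 1\<bar>"
      by (simp only: abs_mult power_abs)
    also have "\<dots> \<le> \<bar>u\<bar>\<^sup>2 * (exp \<bar>u\<bar> * \<bar>u\<bar>)"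
      by (intro mult_left_mono exp_remainder) auto
    also have "\<dots> = exp \<bar>u\<bar> * \<bar>u\<bar>^3"
      by (simp add: eval_nat_numeral)
    finally have tabs3: "\<bar>exp u * u\<^sup>2 - u\<^sup>2\<bar> \<le> 18 * p"
      using eu3 p0 by linarith
    have uu: "u\<^sup>2 = s\<^sup>2 - s^3 + s^4 / 4"
      by (simp add: u_def tilt_def power2_eq_square eval_nat_numeral algebra_simps)
    have u': "u = s - s\<^sup>2 / 2" by (simp add: u_def tilt_def)
    have "exp u \<le> exp \<bar>u\<bar>" by simp
    then have "exp u * \<bar>u\<bar>^3 \<le> exp \<bar>u\<bar> * \<bar>u\<bar>^3"
      by (intro mult_right_mono) auto
    then have r4: "exp u * \<bar>u\<bar>^3 \<le> 20 * p"
      using eu3 p0 by linarith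
    have "exp u - 1 - s = (exp u - 1 - u - u\<^sup>2 / 2) - s^3 / 2 + s^4 / 8"
      using uu u' by linarith
    then have q1: "\<bar>exp u - 1 - s\<bar> \<le> 20 * p"
      using r1 s3 s4 p0 by arith
    have "exp u * u - s - s\<^sup>2 / 2 = (exp u * u - u - u\<^sup>2) - s^3 + s^4 / 4"
      using uu u' by linarith
    then have tsq: "\<bar>exp u * u - s - s\<^sup>2 / 2\<bar> \<le> 20 * p"
      using r2 s3 s4 p0 by arith
    have "exp u * u\<^sup>2 - s\<^sup>2 = (exp u * u\<^sup>2 - u\<^sup>2) - s^3 + s^4 / 4"
      using uu by simp
    then have q3: "\<bar>exp u * u\<^sup>2 - s\<^sup>2\<bar> \<le> 20 * p"
      using tabs3 s3 s4 p0 by arith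
    show ?thesis using q1 tsq q3 r4 by blast
  next
    case False
    have s: "\<bar>s\<bar> \<le> p" "s\<^sup>2 \<le> p" "1 \<le> p"
      using False power_increasing[of 1 3 "\<bar>s\<bar>"] power_increasing[of 2 3 "\<bar>s\<bar>"]
        one_le_power[of "\<bar>s\<bar>" 3] by (auto simp: p_def)
    \<comment> \<open>Beyond 1 boundedness suffices, since \<open>\<bar>s\<bar>^3 \<ge> 1\<close>.
      For positive \<open>u\<close> one has \<open>u \<le> 1 / 2\<close>; for negative
      \<open>u\<close> a single term of the exponential series gives
      \<open>\<bar>u\<bar>^k \<le> fact k * exp \<bar>u\<bar>\<close>, so 6 is
      \<open>fact 3\<close>.\<close>
    have b: "exp u * \<bar>u\<bar>^k \<le> 6" if "k \<le> 3" for k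
    proof (cases "0 \<le> u")
      case True
      have "u \<le> 1 / 2" using tilt_le[of s] by (simp add: u_def)
      then have "exp u \<le> exp (1 / 2)" "\<bar>u\<bar>^k \<le> 1"
        using True by (auto intro!: power_le_one)
      then have "exp u * \<bar>u\<bar>^k \<le> (7 / 4) * 1"
        using order_trans[OF \<open>exp u \<le> exp (1 / 2)\<close> exp_half_le] by (intro mult_mono) auto
      then show ?thesis by simp
    next
      case False
      have "\<bar>u\<bar>^k / fact k \<le> exp \<bar>u\<bar>"
      proof -
        have "(\<Sum>m<Suc k. \<bar>u\<bar>^m / fact m) \<le> exp \<bar>u\<bar>"
          using Maclaurin_exp_le[of "\<bar>u\<bar>" "Suc k"] by (auto simp: zero_le_mult_iff)
        moreover have "0 \<le> (\<Sum>m<k. \<bar>u\<bar>^m / fact m)" by (intro sum_nonneg) auto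
        ultimately show ?thesis by simp
      qed
      then have "exp u * \<bar>u\<bar>^k \<le> fact k"
        using False by (simp add: abs_if exp_minus field_simps)
      also have "\<dots> \<le> fact 3" using that by (intro fact_mono) auto
      finally show ?thesis by (simp add: fact_numeral)
    qed
    have "\<bar>exp u - 1 - s\<bar> \<le> 20 * p"
      using b[of 0] s exp_gt_zero[of u] by (simp only: power_0 mult_1_right) arith
    moreover have "\<bar>exp u * u\<bar> \<le> 6" using b[of 1] by (simp add: abs_mult)
    then have "\<bar>exp u * u - s - s\<^sup>2 / 2\<bar> \<le> 20 * p"
      using s zero_le_power2[of s] by arith
    moreover have "\<bar>exp u * u\<^sup>2\<bar> \<le> 6" using b[of 2] by (simp add: abs_mult)
    then have "\<bar>exp u * u\<^sup>2 - s\<^sup>2\<bar> \<le> 20 * p"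
      using s zero_le_power2[of s] by arith
    moreover have "exp u * \<bar>u\<bar>^3 \<le> 20 * p"
      using b[of 3] s by simp
    ultimately show ?thesis by blast
  qed
  then show "\<bar>exp (tilt s) - 1 - s\<bar> \<le> 20 * \<bar>s\<bar>^3"
    "\<bar>exp (tilt s) * tilt s - s - s\<^sup>2 / 2\<bar> \<le> 20 * \<bar>s\<bar>^3"
    "\<bar>exp (tilt s) * (tilt s)\<^sup>2 - s\<^sup>2\<bar> \<le> 20 * \<bar>s\<bar>^3"
    "exp (tilt s) * \<bar>tilt s\<bar>^3 \<le> 20 * \<bar>s\<bar>^3"
    by (simp_all add: u_def p_def)
qed

text \<open>\<open>add_cube_le\<close> splits off the mean; the central absolute third moment is
  \<open>2 * \<tau>^3 * sqrt (2 / pi)\<close>, and \<open>2 / pi\<close> is below 1. This is the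
  source of the constants 4 and 8 in \<open>step_err\<close>.\<close>

lemma normal_abs_third_moment:
  assumes "0 < \<tau>"
  shows "(\<integral>u. normal_density \<theta> \<tau> u * \<bar>u\<bar>^3 \<partial>lborel) \<le> 4 * \<bar>\<theta>\<bar>^3 + 8 * \<tau>^3"
    and "integrable lborel (\<lambda>u. normal_density \<theta> \<tau> u * \<bar>u\<bar>^3)"
proof -
  let ?f = "\<lambda>u. normal_density \<theta> \<tau> u * \<bar>u\<bar>^3"
  let ?g = "\<lambda>u. 4 * \<bar>\<theta>\<bar>^3 * normal_density \<theta> \<tau> u + 4 * (normal_density \<theta> \<tau> u * \<bar>u - \<theta>\<bar>^3)"
  have le: "?f u \<le> ?g u" for u
  proof -
    have "\<bar>u\<bar>^3 \<le> (\<bar>\<theta>\<bar> + \<bar>u - \<theta>\<bar>)^3" by (intro power_mono) auto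
    also have "\<dots> \<le> 4 * \<bar>\<theta>\<bar>^3 + 4 * \<bar>u - \<theta>\<bar>^3" by (rule add_cube_le) auto
    finally have "normal_density \<theta> \<tau> u * \<bar>u\<bar>^3
        \<le> normal_density \<theta> \<tau> u * (4 * \<bar>\<theta>\<bar>^3 + 4 * \<bar>u - \<theta>\<bar>^3)"
      by (intro mult_left_mono) auto
    then show ?thesis by (simp add: algebra_simps)
  qed
  have ig: "integrable lborel ?g"
    using integrable_normal_moment_abs[OF assms, of \<theta> 3] assms by auto
  show int: "integrable lborel ?f"
    by (rule Bochner_Integration.integrable_bound[OF ig])
       (auto intro!: AE_I2 order_trans[OF le] simp: abs_mult)
  have "(\<integral>u. ?f u \<partial>lborel) \<le> (\<integral>u. ?g u \<partial>lborel)"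
    by (rule integral_mono[OF int ig le])
  also have "\<dots> = 4 * \<bar>\<theta>\<bar>^3 + 4 * (2 * \<tau>^3 * sqrt (2 / pi))"
    using integrable_normal_moment_abs[OF assms, of \<theta> 3] integral_normal_moment_abs_odd[OF assms, of \<theta> 1] assms
    by simp
  also have "\<dots> \<le> 4 * \<bar>\<theta>\<bar>^3 + 4 * (2 * \<tau>^3 * 1)"
    using assms pi_gt3 by (intro add_left_mono mult_left_mono) auto
  finally show "(\<integral>u. ?f u \<partial>lborel) \<le> 4 * \<bar>\<theta>\<bar>^3 + 8 * \<tau>^3" by simp
qed


section \<open>Exponential bounds for atypical self-normalizers\<close>

text \<open>A row of the array: \<open>n\<close> independent copies of a variable with law \<open>D\<close>, scaled so that
  the second moments add up to \<open>x\<^sup>2\<close>. The parameter \<open>\<beta>\<close> controls both the Lyapunov ratio and the bias.\<close>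

locale small_array =
  fixes D :: "real measure" and n :: nat and x \<beta> :: real
  assumes prob_D: "prob_space D"
    and sets_D [measurable_cong]: "sets D = sets borel"
    and int3: "integrable D (\<lambda>s. \<bar>s\<bar>^3)"
    and n_pos: "0 < n"
    and x_pos: "0 < x"
    and m2: "real n * (\<integral>s. s\<^sup>2 \<partial>D) = x\<^sup>2"
    and m3: "real n * (\<integral>s. \<bar>s\<bar>^3 \<partial>D) \<le> \<beta>"
    and m1: "real n * \<bar>\<integral>s. s \<partial>D\<bar> \<le> \<beta>"
begin

sublocale D: prob_space D by (rule prob_D)

abbreviation P where "P \<equiv> PiM {..<n} (\<lambda>_. D)"

sublocale P: prob_space P
  by (intro prob_space_PiM prob_D)

sublocale PP: product_sigma_finite "\<lambda>_::nat. D"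
  by standard

lemma beta_nonneg: "0 \<le> \<beta>"
  by (rule order_trans[OF _ m3]) simp

lemma measurable_sum_P:
  assumes [measurable]: "f \<in> borel_measurable borel"
  shows "(\<lambda>v. \<Sum>i<n. f (v i) :: real) \<in> borel_measurable P"
  by measurable

lemma measurable_sum_id_P: "(\<lambda>v. sum v {..<n}) \<in> borel_measurable P"
  using measurable_sum_P[of "\<lambda>s. s"] by simp

lemma measurable_sqrt_sum_P: "(\<lambda>v. sqrt (\<Sum>i<n. (v i)\<^sup>2)) \<in> borel_measurable P"
  using measurable_sum_P[of "\<lambda>s. s\<^sup>2"] by measurable

lemmas sets_Collect_le_P = sets.sets_Collect_conj borel_measurable_le
  borel_measurable_const borel_measurable_add borel_measurable_diff borel_measurable_times
  measurable_sum_id_P measurable_sqrt_sum_P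

lemma integrable_cubic_bound:
  assumes [measurable]: "f \<in> borel_measurable borel"
    and "\<And>s. \<bar>f s\<bar> \<le> K * (1 + \<bar>s\<bar>^3)"
  shows "integrable D (f :: real \<Rightarrow> real)"
proof (rule Bochner_Integration.integrable_bound)
  show "integrable D (\<lambda>s. K * (1 + \<bar>s\<bar>^3))"
    using int3 by (intro integrable_mult_right Bochner_Integration.integrable_add) auto
  show "AE s in D. norm (f s) \<le> norm (K * (1 + \<bar>s\<bar>^3))"
    using assms(2) by (auto intro!: AE_I2) (meson abs_ge_self order_trans)
qed measurable

lemma integrable_id: "integrable D (\<lambda>s. s)"
  and integrable_square: "integrable D (\<lambda>s. s\<^sup>2)"
proof -
  have "\<bar>s\<bar> \<le> 1 * (1 + \<bar>s\<bar>^3) \<and> \<bar>s\<^sup>2\<bar> \<le> 1 * (1 + \<bar>s\<bar>^3)" for s :: real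
    using power_le_one_plus_cube[of "\<bar>s\<bar>" 1] power_le_one_plus_cube[of "\<bar>s\<bar>" 2] by simp
  then show "integrable D (\<lambda>s. s)" "integrable D (\<lambda>s. s\<^sup>2)"
    by (auto intro!: integrable_cubic_bound[where K=1])
qed

text \<open>Exponential Markov inequality with independent factors: the expected product is at most
  \<open>(1 + b / n)^n \<le> exp b\<close>, where \<open>b\<close> collects the three moment
  conditions of the locale. \<open>A\<close> may be any set on which the product is large, so one
  statement serves all tail events.\<close>

lemma chernoff:
  assumes [measurable]: "\<psi> \<in> borel_measurable borel"
    and nonneg: "\<And>s. 0 \<le> \<psi> s"
    and bound: "\<And>s. \<psi> s \<le> 1 + a * s + \<kappa> * s\<^sup>2 + C * \<bar>s\<bar>^3"
    and "0 \<le> C"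
    and A: "\<And>v. v \<in> A \<Longrightarrow> exp t \<le> (\<Prod>i<n. \<psi> (v i))"
  shows "measure P A \<le> exp (- t + \<kappa> * x\<^sup>2 + (\<bar>a\<bar> + C) * \<beta>)"
\<comment> \<open>A set outside the sigma-algebra has measure 0 by convention, so no measurability
  of \<open>A\<close> has to be assumed.\<close>
proof (cases "A \<in> sets P")
  case True
  let ?q = "\<lambda>s. 1 + a * s + \<kappa> * s\<^sup>2 + C * \<bar>s\<bar>^3"
  let ?B = "\<kappa> * x\<^sup>2 + (\<bar>a\<bar> + C) * \<beta>"
  have iq: "integrable D ?q"
    using int3 integrable_id integrable_square by auto
  have q0: "0 \<le> ?q s" for s using nonneg[of s] bound[of s] by linarith
  have "(\<integral>s. ?q s \<partial>D) = 1 + a * (\<integral>s. s \<partial>D) + \<kappa> * (\<integral>s. s\<^sup>2 \<partial>D) + C * (\<integral>s. \<bar>s\<bar>^3 \<partial>D)"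
    using int3 integrable_id integrable_square by (simp add: D.prob_space)
  also have "\<dots> \<le> 1 + ?B / real n"
  proof -
    have "real n * (a * (\<integral>s. s \<partial>D)) \<le> \<bar>a\<bar> * (real n * \<bar>\<integral>s. s \<partial>D\<bar>)"
      using abs_ge_self[of "real n * (a * (\<integral>s. s \<partial>D))"] by (simp add: abs_mult mult_ac)
    also have "\<dots> \<le> \<bar>a\<bar> * \<beta>" using m1 by (intro mult_left_mono) auto
    finally have "real n * (a * (\<integral>s. s \<partial>D) + \<kappa> * (\<integral>s. s\<^sup>2 \<partial>D) + C * (\<integral>s. \<bar>s\<bar>^3 \<partial>D)) \<le> ?B"
      using m2 mult_left_mono[OF m3 \<open>0 \<le> C\<close>]
        by (simp add: distrib_left distrib_right mult.left_commute[of "real n"])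
    then show ?thesis
      using n_pos by (simp add: field_simps)
  qed
  also have "\<dots> \<le> exp (?B / real n)" by (rule exp_ge_add_one_self)
  finally have Eq: "(\<integral>s. ?q s \<partial>D) \<le> exp (?B / real n)" .
  have "(\<integral>\<^sup>+s. ennreal (\<psi> s) \<partial>D) \<le> (\<integral>\<^sup>+s. ennreal (?q s) \<partial>D)"
    by (intro nn_integral_mono ennreal_leI bound)
  also have "\<dots> = ennreal (\<integral>s. ?q s \<partial>D)"
    by (rule nn_integral_eq_integral[OF iq]) (use q0 in auto)
  also have "\<dots> \<le> ennreal (exp (?B / real n))"
    by (intro ennreal_leI Eq)
  finally have E: "(\<integral>\<^sup>+s. ennreal (\<psi> s) \<partial>D) \<le> ennreal (exp (?B / real n))" .
  have "ennreal (exp t) * emeasure P A = (\<integral>\<^sup>+v. ennreal (exp t) * indicator A v \<partial>P)"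
    using True by (simp add: nn_integral_cmult_indicator)
  also have "\<dots> \<le> (\<integral>\<^sup>+v. (\<Prod>i<n. ennreal (\<psi> (v i))) \<partial>P)"
    using A nonneg by (intro nn_integral_mono) (auto simp: indicator_def prod_ennreal intro!: ennreal_leI)
  also have "\<dots> = (\<Prod>i<n. \<integral>\<^sup>+s. ennreal (\<psi> s) \<partial>D)"
    by (rule PP.product_nn_integral_prod) auto
  also have "\<dots> \<le> (\<Prod>i<n. ennreal (exp (?B / real n)))"
    using E by (rule prod_mono_ennreal)
  also have "\<dots> = ennreal (exp ?B)"
    using n_pos by (simp add: ennreal_power exp_of_nat_mult[symmetric])
  finally have "exp t * measure P A \<le> exp ?B"
    by (simp add: P.emeasure_eq_measure ennreal_mult[symmetric])
  then have "measure P A \<le> exp ?B / exp t"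
    by (simp add: field_simps)
  then show ?thesis
    by (simp add: exp_diff[symmetric] algebra_simps)
qed (simp add: measure_notin_sets)

text \<open>The indicator of \<open>\<bar>s\<bar> > 1\<close> is at most
  \<open>\<bar>s\<bar>^3\<close>, so the number of large coordinates is governed by
  \<open>\<beta>\<close> alone.\<close>

lemma count_tail:
  assumes "0 < \<kappa>"
  shows "measure P {v \<in> space P. y \<le> (\<Sum>i<n. if \<bar>v i\<bar> \<le> 1 then 0 else 1)} \<le> exp (- (\<kappa> * y) + exp \<kappa> * \<beta>)"
proof -
  let ?A = "{v \<in> space P. y \<le> (\<Sum>i<n. if \<bar>v i\<bar> \<le> 1 then 0 else 1)}"
  have "measure P ?A \<le> exp (- (\<kappa> * y) + 0 * x\<^sup>2 + (\<bar>0\<bar> + exp \<kappa>) * \<beta>)"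
  proof (rule chernoff[where \<psi>="\<lambda>s. exp (\<kappa> * (if \<bar>s\<bar> \<le> 1 then 0 else 1))"])
    show "exp (\<kappa> * (if \<bar>s\<bar> \<le> 1 then 0 else 1)) \<le> 1 + 0 * s + 0 * s\<^sup>2 + exp \<kappa> * \<bar>s\<bar>^3" for s :: real
    proof (cases "\<bar>s\<bar> \<le> 1")
      case False
      then have "exp \<kappa> * 1 \<le> exp \<kappa> * \<bar>s\<bar>^3" by (intro mult_left_mono one_le_power) auto
      then have "exp \<kappa> * (1::real) \<le> 1 + exp \<kappa> * \<bar>s\<bar>^3" by linarith
      then show ?thesis using False by simp
    qed auto
    show "exp (\<kappa> * y) \<le> (\<Prod>i<n. exp (\<kappa> * (if \<bar>v i\<bar> \<le> 1 then 0 else 1)))" if "v \<in> ?A" for v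
      using that assms unfolding exp_sum[OF finite_lessThan, symmetric] sum_distrib_left[symmetric] by simp
  qed auto
  then show ?thesis by simp
qed

lemma mult_beta_le_1:
  assumes "\<beta> \<le> 1 / B" "0 < B" "c \<le> B" "0 \<le> c"
  shows "c * \<beta> \<le> 1"
proof -
  have "c * \<beta> \<le> B * (1 / B)"
    using assms beta_nonneg by (intro mult_mono) auto
  then show ?thesis using assms by simp
qed

end

text \<open>Conversion to relative form: \<open>x * mills x\<close> is at least
  \<open>c0 * mills c0\<close>, so it suffices that \<open>B * x\<close> be small against this
  constant.\<close>

lemma le_Phi_minusI:
  assumes "0 < c0" "c0 \<le> x" "A \<le> exp (- x\<^sup>2 / 2) * B" "B * x \<le> \<epsilon> * (c0 * mills c0)" "0 \<le> \<epsilon>"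
  shows "A \<le> \<epsilon> * Phi (- x)"
proof -
  have "B * x \<le> \<epsilon> * (x * mills x)"
    using assms by (intro order_trans[OF assms(4)] mult_left_mono mult_mills_mono) auto
  then have "B \<le> \<epsilon> * mills x"
    using assms by (simp add: mult.left_commute[of \<epsilon>] mult.commute[of B])
  then have "exp (- x\<^sup>2 / 2) * B \<le> exp (- x\<^sup>2 / 2) * (\<epsilon> * mills x)"
    by (intro mult_left_mono) auto
  then show ?thesis
    using assms(3) unfolding Phi_minus_eq_mills by (simp only: mult.left_commute[of \<epsilon>])
qed

text \<open>On the event the weights \<open>exp (s + (- 1 / 2 - \<kappa>) * s\<^sup>2)\<close>
  multiply to exponent at least \<open>x * r - (1 / 2 + \<kappa>) * r\<^sup>2\<close>. The value at
  \<open>r = x\<close> would give the rate \<open>exp (- x\<^sup>2 / 2)\<close>; staying below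
  \<open>x - \<delta>\<close> gains the further factor
  \<open>exp (- \<delta> * (\<kappa> - 1 / 2) * x)\<close>.\<close>

lemma lower_tail:
  assumes "0 < \<delta>" "0 < \<epsilon>" "0 < c0"
  shows "\<exists>\<eta>>0. \<forall>D n x \<beta>. small_array D n x \<beta> \<longrightarrow> c0 \<le> x \<longrightarrow> \<beta> \<le> \<eta> \<longrightarrow>
    measure (PiM {..<n} (\<lambda>_. D)) {v \<in> space (PiM {..<n} (\<lambda>_. D)).
      x * sqrt (\<Sum>i<n. (v i)\<^sup>2) \<le> (\<Sum>i<n. v i) \<and> sqrt (\<Sum>i<n. (v i)\<^sup>2) \<le> x - \<delta>} \<le> \<epsilon> * Phi (- x)"
proof -
  define c1 where "c1 = c0 * mills c0"
  have c1: "0 < c1" using assms by (simp add: c1_def)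
  \<comment> \<open>Chosen so that \<open>exp 1 / (\<delta> * (\<kappa> - 1 / 2)) \<le> \<epsilon> *
    c1\<close>; the left side is what \<open>exp (- y) \<le> 1 / y\<close> leaves after
    multiplication by \<open>x\<close>.\<close>
  define \<kappa> where "\<kappa> = 1 + exp 1 / (\<delta> * \<epsilon> * c1)"
  have k: "1 \<le> \<kappa>" "0 < \<kappa> - 1 / 2" using assms c1 by (auto simp: \<kappa>_def add_pos_nonneg)
  have k2: "exp 1 / (\<delta> * (\<kappa> - 1 / 2)) \<le> \<epsilon> * c1"
  proof -
    have "exp 1 / (\<delta> * \<epsilon> * c1) \<le> \<kappa> - 1 / 2" by (simp add: \<kappa>_def)
    then show ?thesis using assms c1 k by (simp add: field_simps)
  qed
  obtain C where C: "0 \<le> C" "\<And>s::real. exp (s + (- 1 / 2 - \<kappa>) * s\<^sup>2)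
      \<le> 1 + s + (1 / 2 + (- 1 / 2 - \<kappa>)) * s\<^sup>2 + C * \<bar>s\<bar>^3"
    using exp_quadratic_le[of "- 1 / 2 - \<kappa>"] k by auto
  show ?thesis
  proof (intro exI[of _ "1 / (1 + C)"] conjI allI impI)
    show "0 < 1 / (1 + C)" using C by simp
    fix D n x \<beta>
    assume sa: "small_array D n x \<beta>" and x: "c0 \<le> x" and \<beta>: "\<beta> \<le> 1 / (1 + C)"
    interpret small_array D n x \<beta> by fact
    let ?r = "\<lambda>v. sqrt (\<Sum>i<n. (v i)\<^sup>2)"
    let ?A = "{v \<in> space P. x * ?r v \<le> (\<Sum>i<n. v i) \<and> ?r v \<le> x - \<delta>}"
    let ?t = "x\<^sup>2 / 2 - \<kappa> * x\<^sup>2 + \<delta> * x * (\<kappa> - 1 / 2)"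
    have "measure P ?A \<le> exp (- ?t + (- \<kappa>) * x\<^sup>2 + (\<bar>1\<bar> + C) * \<beta>)"
    proof (rule chernoff[where \<psi>="\<lambda>s. exp (s + (- 1 / 2 - \<kappa>) * s\<^sup>2)"])
      fix v assume "v \<in> ?A"
      then have S: "x * ?r v \<le> (\<Sum>i<n. v i)" and r: "?r v \<le> x - \<delta>" by auto
      define r where "r = ?r v"
      have r0: "0 \<le> r" by (simp add: r_def sum_nonneg)
      have r2: "r\<^sup>2 = (\<Sum>i<n. (v i)\<^sup>2)" by (simp add: r_def sum_nonneg)
      \<comment> \<open>The right side is the exponent at \<open>r\<close> minus the exponent at
        \<open>x\<close>, factored; the two factors are bounded below separately.\<close>
      have "\<delta> * ((\<kappa> - 1 / 2) * x) \<le> (x - r) * (\<kappa> * (x + r) - (x - r) / 2)"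
      proof (rule mult_mono)
        show "(\<kappa> - 1 / 2) * x \<le> \<kappa> * (x + r) - (x - r) / 2"
          using r0 k by (simp add: algebra_simps)
      qed (use r r0 k x_pos assms in \<open>auto simp: r_def\<close>)
      then have "?t \<le> x * r + (- 1 / 2 - \<kappa>) * r\<^sup>2"
        by (simp add: power2_eq_square field_simps)
      also have "\<dots> \<le> (\<Sum>i<n. v i) + (- 1 / 2 - \<kappa>) * r\<^sup>2"
        using S by (simp add: r_def)
      also have "\<dots> = (\<Sum>i<n. v i + (- 1 / 2 - \<kappa>) * (v i)\<^sup>2)"
        by (simp add: r2 sum.distrib sum_distrib_left)
      finally show "exp ?t \<le> (\<Prod>i<n. exp (v i + (- 1 / 2 - \<kappa>) * (v i)\<^sup>2))"
        by (simp add: exp_sum[symmetric])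
    qed (use C in \<open>auto simp: algebra_simps\<close>)
    also have "- ?t + (- \<kappa>) * x\<^sup>2 + (\<bar>1\<bar> + C) * \<beta> = - x\<^sup>2 / 2 + (- (\<delta> * (\<kappa> - 1 / 2) * x) + (1 + C) * \<beta>)"
      by (simp add: algebra_simps)
    also have "exp \<dots> \<le> exp (- x\<^sup>2 / 2) * (exp (- (\<delta> * (\<kappa> - 1 / 2) * x)) * exp 1)"
    proof -
      have "(1 + C) * \<beta> \<le> 1" using \<beta> C by (simp add: field_simps)
      then show ?thesis by (simp add: exp_add[symmetric])
    qed
    finally have le: "measure P ?A \<le> exp (- x\<^sup>2 / 2) * (exp (- (\<delta> * (\<kappa> - 1 / 2) * x)) * exp 1)" .
    show "measure P ?A \<le> \<epsilon> * Phi (- x)"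
    proof (rule le_Phi_minusI[OF assms(3) x le])
      define y where "y = \<delta> * (\<kappa> - 1 / 2) * x"
      have y: "0 < y" using assms k x_pos by (simp add: y_def)
      have "y \<le> exp y" using exp_ge_add_one_self[of y] by linarith
      then have "exp (- y) \<le> 1 / y"
        using y by (simp add: exp_minus field_simps)
      then have "exp (- y) * exp 1 * x \<le> 1 / y * exp 1 * x"
        using x_pos by (intro mult_right_mono) auto
      also have "\<dots> = exp 1 / (\<delta> * (\<kappa> - 1 / 2))"
        using x_pos by (simp add: y_def)
      finally show "exp (- (\<delta> * (\<kappa> - 1 / 2) * x)) * exp 1 * x \<le> \<epsilon> * (c0 * mills c0)"
        using k2 by (simp add: y_def c1_def)
    qed (use assms in simp)
  qed
qed

text \<open>For \<open>r \<le> 2 * x\<close> the weight \<open>exp (s - s\<^sup>2 / 4)\<close>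
  leaves \<open>exp (- x\<^sup>2 / 2)\<close> and a gain \<open>exp (- \<delta> * x / 4)\<close>.
  For \<open>r > 2 * x\<close> either many coordinates exceed 1 or the sum of the others is large,
  each with probability of order \<open>exp (- x\<^sup>2)\<close>. Both gains beat
  \<open>\<epsilon> * Phi (- x)\<close> once \<open>x\<close> is large, hence
  \<open>K\<close>.\<close>

lemma upper_tail_large:
  assumes "0 < \<delta>" "0 < \<epsilon>" "0 < c0"
  shows "\<exists>K>0. \<exists>\<eta>>0. \<forall>D n x \<beta>. small_array D n x \<beta> \<longrightarrow> c0 \<le> x \<longrightarrow> K \<le> x \<longrightarrow> \<beta> \<le> \<eta> \<longrightarrow>
    measure (PiM {..<n} (\<lambda>_. D)) {v \<in> space (PiM {..<n} (\<lambda>_. D)).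
      x * sqrt (\<Sum>i<n. (v i)\<^sup>2) \<le> (\<Sum>i<n. v i) \<and> x + \<delta> \<le> sqrt (\<Sum>i<n. (v i)\<^sup>2)} \<le> \<epsilon> * Phi (- x)"
proof -
  define c1 where "c1 = c0 * mills c0"
  have c1: "0 < c1" using assms by (simp add: c1_def)
  have "((\<lambda>x. exp 1 * (exp (- (\<delta> * x / 4)) + 2 * exp (- x\<^sup>2 / 2)) * x) \<longlongrightarrow> 0) at_top"
    using assms(1) by real_asymp
  then have "eventually (\<lambda>x. exp 1 * (exp (- (\<delta> * x / 4)) + 2 * exp (- x\<^sup>2 / 2)) * x < \<epsilon> * c1) at_top"
    by (rule order_tendstoD) (use assms c1 in simp)
  then obtain K0 where K0: "\<And>x. K0 \<le> x \<Longrightarrow>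
      exp 1 * (exp (- (\<delta> * x / 4)) + 2 * exp (- x\<^sup>2 / 2)) * x < \<epsilon> * c1"
    by (auto simp: eventually_at_top_linorder)
  obtain C where C: "0 \<le> C" "\<And>s::real. exp (s + (- 1 / 4) * s\<^sup>2)
      \<le> 1 + s + (1 / 2 + (- 1 / 4)) * s\<^sup>2 + C * \<bar>s\<bar>^3"
    using exp_quadratic_le[of "- 1 / 4"] by auto
  obtain C' where C': "0 \<le> C'" "\<And>s::real. (if \<bar>s\<bar> \<le> 1 then exp (1 * s + 0 * s\<^sup>2) else 1)
    \<le> 1 + 1 * s + (1\<^sup>2 / 2 + 0) * s\<^sup>2 + C' * \<bar>s\<bar>^3"
    using exp_quadratic_le_truncated[of 1 0] by blast
  define B where "B = 1 + C + C' + exp 16"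
  have B: "0 < B" "1 + C \<le> B" "1 + C' \<le> B" "exp 16 \<le> B"
    using C(1) C'(1) by (auto simp: B_def add_pos_nonneg add_nonneg_pos)
  show ?thesis
  proof (rule exI[of _ "max K0 1"], intro exI[of _ "1 / B"] conjI allI impI)
    show "0 < 1 / B" "0 < max K0 1" using B by auto
    fix D n x \<beta>
    assume sa: "small_array D n x \<beta>" and x: "c0 \<le> x" "max K0 1 \<le> x" and \<beta>: "\<beta> \<le> 1 / B"
    interpret small_array D n x \<beta> by fact
    note le1 = mult_beta_le_1[OF \<beta> B(1)]
    let ?r = "\<lambda>v. sqrt (\<Sum>i<n. (v i)\<^sup>2)"
    let ?A = "{v \<in> space P. x * ?r v \<le> (\<Sum>i<n. v i) \<and> x + \<delta> \<le> ?r v}"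
    let ?A1 = "{v \<in> space P. x * ?r v \<le> (\<Sum>i<n. v i) \<and> x + \<delta> \<le> ?r v \<and> ?r v \<le> 2 * x}"
    let ?A2 = "{v \<in> space P. x\<^sup>2 / 16 \<le> (\<Sum>i<n. if \<bar>v i\<bar> \<le> 1 then 0 else 1)}"
    let ?A3 = "{v \<in> space P. 3 / 2 * x\<^sup>2 \<le> (\<Sum>i<n. if \<bar>v i\<bar> \<le> 1 then v i else 0)}"
    have [measurable]: "?A1 \<in> sets P"
      by (intro sets_Collect_le_P)
    have [measurable]: "?A2 \<in> sets P" "?A3 \<in> sets P"
      by (intro borel_measurable_le borel_measurable_const measurable_sum_P; measurable)+
    have "measure P ?A1 \<le> exp (- (3 / 4 * x\<^sup>2 + \<delta> * x / 4) + 1 / 4 * x\<^sup>2 + (\<bar>1\<bar> + C) * \<beta>)"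
    proof (rule chernoff[where \<psi>="\<lambda>s. exp (s + (- 1 / 4) * s\<^sup>2)"])
      fix v assume "v \<in> ?A1"
      then have S: "x * ?r v \<le> (\<Sum>i<n. v i)" and r: "x + \<delta> \<le> ?r v" "?r v \<le> 2 * x" by auto
      define d where "d = ?r v - x"
      have d: "\<delta> \<le> d" "d \<le> x" using r by (auto simp: d_def)
      have r2: "(x + d)\<^sup>2 = (\<Sum>i<n. (v i)\<^sup>2)" by (simp add: d_def sum_nonneg)
      have "0 \<le> d * (x - d)" "\<delta> * x \<le> d * x" using d assms x_pos by auto
      \<comment> \<open>The surplus \<open>x * d / 2 - d\<^sup>2 / 4\<close> is at least
        \<open>x * d / 4\<close> because \<open>d \<le> x\<close>.\<close>
      then have "3 / 4 * x\<^sup>2 + \<delta> * x / 4 \<le> x * (x + d) + (- 1 / 4) * (x + d)\<^sup>2"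
        by (simp add: power2_eq_square algebra_simps)
      also have "\<dots> \<le> (\<Sum>i<n. v i) + (- 1 / 4) * (x + d)\<^sup>2"
        using S by (simp add: d_def)
      also have "\<dots> = (\<Sum>i<n. v i + (- 1 / 4) * (v i)\<^sup>2)"
        unfolding r2 by (simp only: sum.distrib sum_distrib_left)
      finally show "exp (3 / 4 * x\<^sup>2 + \<delta> * x / 4) \<le> (\<Prod>i<n. exp (v i + (- 1 / 4) * (v i)\<^sup>2))"
        unfolding exp_sum[OF finite_lessThan, symmetric] by simp
    qed (use C in auto)
    also have "\<dots> \<le> exp (- x\<^sup>2 / 2 - \<delta> * x / 4 + 1)"
      using le1[of "1 + C"] B C(1) by simp
    finally have A1: "measure P ?A1 \<le> exp (- x\<^sup>2 / 2) * (exp 1 * exp (- (\<delta> * x / 4)))"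
      by (simp add: exp_add[symmetric] algebra_simps)
    \<comment> \<open>The parameter 16 is matched to the threshold \<open>x\<^sup>2 / 16\<close>:
      the exponent becomes \<open>- x\<^sup>2\<close>, half of which is split off.\<close>
    have "measure P ?A2 \<le> exp (- (16 * (x\<^sup>2 / 16)) + exp 16 * \<beta>)"
      by (rule count_tail) simp
    also have "\<dots> \<le> exp (- x\<^sup>2 + 1)"
      using le1[of "exp 16"] B by simp
    finally have A2: "measure P ?A2 \<le> exp (- x\<^sup>2 / 2) * (exp 1 * exp (- x\<^sup>2 / 2))"
      by (simp add: exp_add[symmetric] algebra_simps)
    have "measure P ?A3 \<le> exp (- (3 / 2 * x\<^sup>2) + 1 / 2 * x\<^sup>2 + (\<bar>1\<bar> + C') * \<beta>)"
    proof (rule chernoff[where \<psi>="\<lambda>s. if \<bar>s\<bar> \<le> 1 then exp s else 1"])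
      show "exp (3 / 2 * x\<^sup>2) \<le> (\<Prod>i<n. if \<bar>v i\<bar> \<le> 1 then exp (v i) else 1)" if "v \<in> ?A3" for v
      proof -
        have "(\<Prod>i<n. if \<bar>v i\<bar> \<le> 1 then exp (v i) else 1) = (\<Prod>i<n. exp (if \<bar>v i\<bar> \<le> 1 then v i else 0))"
          by (intro prod.cong) auto
        then show ?thesis
          using that by (simp add: exp_sum[symmetric])
      qed
      show "(if \<bar>s\<bar> \<le> 1 then exp s else 1) \<le> 1 + 1 * s + 1 / 2 * s\<^sup>2 + C' * \<bar>s\<bar>^3" for s :: real
        using C'(2)[of s] by (simp only: mult_1 mult_zero_left add_0_right power_one)
    qed (use C'(1) in auto)
    also have "\<dots> \<le> exp (- x\<^sup>2 + 1)"
      using le1[of "1 + C'"] B C'(1) by simp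
    finally have A3: "measure P ?A3 \<le> exp (- x\<^sup>2 / 2) * (exp 1 * exp (- x\<^sup>2 / 2))"
      by (simp add: exp_add[symmetric] algebra_simps)
    have sub: "?A \<subseteq> ?A1 \<union> (?A2 \<union> ?A3)"
    proof
      fix v assume v: "v \<in> ?A"
      show "v \<in> ?A1 \<union> (?A2 \<union> ?A3)"
      proof (rule ccontr)
        assume "v \<notin> ?A1 \<union> (?A2 \<union> ?A3)"
        then have r2x: "2 * x < ?r v" and N: "(\<Sum>i<n. if \<bar>v i\<bar> \<le> 1 then 0 else 1) < x\<^sup>2 / 16"
          and T: "(\<Sum>i<n. if \<bar>v i\<bar> \<le> 1 then v i else 0) < 3 / 2 * x\<^sup>2"
          and S: "x * ?r v \<le> (\<Sum>i<n. v i)"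
          using v by auto
        let ?N = "\<Sum>i<n. (if \<bar>v i\<bar> \<le> 1 then 0 else 1) :: real"
        \<comment> \<open>Cauchy-Schwarz bounds the sum of the large coordinates by
          \<open>sqrt ?N * r\<close>, hence by \<open>x * r / 4\<close>. With the bound on the small
          ones and a total of at least \<open>x * r\<close>, this would force
          \<open>r < 2 * x\<close>.\<close>
        have "(\<Sum>i<n. if \<bar>v i\<bar> \<le> 1 then 0 else v i)
            \<le> (\<Sum>i<n. \<bar>if \<bar>v i\<bar> \<le> 1 then 0 else 1\<bar> * \<bar>v i\<bar>)"
          by (intro sum_mono) auto
        also have "\<dots> \<le> L2_set (\<lambda>i. if \<bar>v i\<bar> \<le> 1 then 0 else 1) {..<n} * L2_set v {..<n}"
          by (rule L2_set_mult_ineq)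
        also have "L2_set (\<lambda>i. if \<bar>v i\<bar> \<le> 1 then 0 else 1) {..<n} = sqrt ?N"
          unfolding L2_set_def by (intro arg_cong[where f=sqrt] sum.cong) auto
        also have "sqrt ?N * L2_set v {..<n} \<le> x / 4 * ?r v"
        proof (rule mult_mono)
          have "sqrt ?N \<le> sqrt ((x / 4)\<^sup>2)"
            using N by (intro real_sqrt_le_mono) (simp add: power_divide)
          then show "sqrt ?N \<le> x / 4" using x_pos by simp
        qed (use x_pos in \<open>auto simp: L2_set_def sum_nonneg\<close>)
        finally have "(\<Sum>i<n. if \<bar>v i\<bar> \<le> 1 then 0 else v i) \<le> x / 4 * ?r v" .
        moreover have "(\<Sum>i<n. v i) = (\<Sum>i<n. if \<bar>v i\<bar> \<le> 1 then 0 else v i) + (\<Sum>i<n. if \<bar>v i\<bar> \<le> 1 then v i else 0)"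
          unfolding sum.distrib[symmetric] by (intro sum.cong) auto
        ultimately have "3 / 4 * (x * ?r v) < 3 / 2 * x\<^sup>2"
          using S T by linarith
        moreover have "x * (2 * x) \<le> x * ?r v"
          using r2x x_pos by (intro mult_left_mono) auto
        ultimately show False by (simp add: power2_eq_square)
      qed
    qed
    have "measure P ?A \<le> measure P (?A1 \<union> (?A2 \<union> ?A3))"
      by (rule P.finite_measure_mono[OF sub]) simp
    also have "\<dots> \<le> measure P ?A1 + measure P (?A2 \<union> ?A3)"
      by (rule measure_Un_le) auto
    also have "measure P (?A2 \<union> ?A3) \<le> measure P ?A2 + measure P ?A3"
      by (rule measure_Un_le) auto
    also have "measure P ?A1 + (measure P ?A2 + measure P ?A3)
      \<le> exp (- x\<^sup>2 / 2) * (exp 1 * (exp (- (\<delta> * x / 4)) + 2 * exp (- x\<^sup>2 / 2)))"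
      using A1 A2 A3 by (simp add: algebra_simps)
    finally have le: "measure P ?A \<le> exp (- x\<^sup>2 / 2) * (exp 1 * (exp (- (\<delta> * x / 4)) + 2 * exp (- x\<^sup>2 / 2)))"
      by simp
    show "measure P ?A \<le> \<epsilon> * Phi (- x)"
      by (rule le_Phi_minusI[OF assms(3) x(1) le]) (use K0[of x] x(2) assms in \<open>auto simp: c1_def\<close>)
  qed
qed

text \<open>For \<open>x \<le> K\<close> the tail is at least \<open>Phi (- K)\<close>, so a small
  absolute probability suffices and the condition on the sum is dropped. Either some coordinate
  exceeds 1, or all squares enter a Chernoff bound whose parameter may be taken arbitrarily
  large.\<close>

lemma upper_tail_small:
  assumes "0 < \<delta>" "0 < \<epsilon>" "0 < c0"
  shows "\<exists>\<eta>>0. \<forall>D n x \<beta>. small_array D n x \<beta> \<longrightarrow> c0 \<le> x \<longrightarrow> x \<le> K \<longrightarrow> \<beta> \<le> \<eta> \<longrightarrow>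
    measure (PiM {..<n} (\<lambda>_. D)) {v \<in> space (PiM {..<n} (\<lambda>_. D)).
      x + \<delta> \<le> sqrt (\<Sum>i<n. (v i)\<^sup>2)} \<le> \<epsilon> * Phi (- x)"
proof -
  have "((\<lambda>\<kappa>. exp 1 * (exp (- \<kappa>) + exp (- (2 * \<kappa> * d)))) \<longlongrightarrow> 0) at_top" if "0 < d" for d :: real
  proof -
    have "((\<lambda>\<kappa>::real. exp (- \<kappa>)) \<longlongrightarrow> 0) at_top" "((\<lambda>\<kappa>. exp (- (2 * \<kappa> * d))) \<longlongrightarrow> 0) at_top"
      using that by real_asymp+
    from tendsto_mult_left[OF tendsto_add[OF this], of "exp 1"] show ?thesis by simp
  qed
  from this[OF mult_pos_pos[OF assms(1,3)]]
  have "((\<lambda>\<kappa>. exp 1 * (exp (- \<kappa>) + exp (- (2 * \<kappa> * (\<delta> * c0))))) \<longlongrightarrow> 0) at_top" .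
  then have "eventually (\<lambda>\<kappa>. exp 1 * (exp (- \<kappa>) + exp (- (2 * \<kappa> * (\<delta> * c0)))) < \<epsilon> * Phi (- K)) at_top"
    by (rule order_tendstoD) (use assms in simp)
  \<comment> \<open>\<open>exp (- \<kappa>)\<close> will bound the chance of a large coordinate, the
    other term the excess of the truncated squares, by
    \<open>(x + \<delta>)\<^sup>2 - x\<^sup>2 \<ge> 2 * \<delta> * c0\<close>; the factor
    \<open>exp 1\<close> absorbs the contribution of \<open>\<beta>\<close>.\<close>
  from eventually_happens'[OF _ eventually_conj[OF eventually_gt_at_top[of 0] this]]
  obtain \<kappa> :: real where \<kappa>: "0 < \<kappa>"
      "exp 1 * (exp (- \<kappa>) + exp (- (2 * \<kappa> * (\<delta> * c0)))) < \<epsilon> * Phi (- K)"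
    by auto
  obtain C where C: "0 \<le> C" "\<And>s::real. (if \<bar>s\<bar> \<le> 1 then exp (0 * s + \<kappa> * s\<^sup>2) else 1)
    \<le> 1 + 0 * s + (0\<^sup>2 / 2 + \<kappa>) * s\<^sup>2 + C * \<bar>s\<bar>^3"
    using exp_quadratic_le_truncated[of 0 \<kappa>] by blast
  define B where "B = C + exp \<kappa>"
  have B: "0 < B" "C \<le> B" "exp \<kappa> \<le> B"
    using C(1) by (auto simp: B_def add_nonneg_pos)
  show ?thesis
  proof (intro exI[of _ "1 / B"] conjI allI impI)
    show "0 < 1 / B" using B by auto
    fix D n x \<beta>
    assume sa: "small_array D n x \<beta>" and x: "c0 \<le> x" "x \<le> K" and \<beta>: "\<beta> \<le> 1 / B"
    interpret small_array D n x \<beta> by fact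
    note le1 = mult_beta_le_1[OF \<beta> B(1)]
    let ?r = "\<lambda>v. sqrt (\<Sum>i<n. (v i)\<^sup>2)"
    let ?A = "{v \<in> space P. x + \<delta> \<le> ?r v}"
    let ?A1 = "{v \<in> space P. 1 \<le> (\<Sum>i<n. (if \<bar>v i\<bar> \<le> 1 then 0 else 1) :: real)}"
    let ?A2 = "{v \<in> space P. (x + \<delta>)\<^sup>2 \<le> (\<Sum>i<n. if \<bar>v i\<bar> \<le> 1 then (v i)\<^sup>2 else 0)}"
    have [measurable]: "?A1 \<in> sets P" "?A2 \<in> sets P"
      by (intro borel_measurable_le borel_measurable_const measurable_sum_P; measurable)+
    have "measure P ?A1 \<le> exp (- (\<kappa> * 1) + exp \<kappa> * \<beta>)"
      by (rule count_tail[OF \<kappa>(1)])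
    also have "\<dots> \<le> exp (- \<kappa> + 1)"
      using le1[of "exp \<kappa>"] B by simp
    finally have A1: "measure P ?A1 \<le> exp 1 * exp (- \<kappa>)"
      by (simp add: exp_add[symmetric] algebra_simps)
    have "measure P ?A2 \<le> exp (- (\<kappa> * (x + \<delta>)\<^sup>2) + \<kappa> * x\<^sup>2 + (\<bar>0\<bar> + C) * \<beta>)"
    proof (rule chernoff[where \<psi>="\<lambda>s. if \<bar>s\<bar> \<le> 1 then exp (\<kappa> * s\<^sup>2) else 1"])
      show "exp (\<kappa> * (x + \<delta>)\<^sup>2) \<le> (\<Prod>i<n. if \<bar>v i\<bar> \<le> 1 then exp (\<kappa> * (v i)\<^sup>2) else 1)" if "v \<in> ?A2" for v
      proof -
        have "(\<Prod>i<n. if \<bar>v i\<bar> \<le> 1 then exp (\<kappa> * (v i)\<^sup>2) else 1)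
            = (\<Prod>i<n. exp (\<kappa> * (if \<bar>v i\<bar> \<le> 1 then (v i)\<^sup>2 else 0)))"
          by (intro prod.cong) auto
        then show ?thesis
          using that \<kappa>(1) by (simp add: exp_sum[symmetric] sum_distrib_left[symmetric])
      qed
      show "(if \<bar>s\<bar> \<le> 1 then exp (\<kappa> * s\<^sup>2) else 1) \<le> 1 + 0 * s + \<kappa> * s\<^sup>2 + C * \<bar>s\<bar>^3" for s :: real
        using C(2)[of s] by (simp only: mult_zero_left add_0 zero_power2 div_0)
    qed (use C(1) in auto)
    also have "\<dots> \<le> exp (- (2 * \<kappa> * (\<delta> * c0)) + 1)"
    proof -
      have "2 * \<kappa> * (\<delta> * c0) \<le> 2 * \<kappa> * (\<delta> * x)"
        using x assms \<kappa>(1) by (intro mult_left_mono) auto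
      moreover have "0 \<le> \<kappa> * \<delta>\<^sup>2" using \<kappa>(1) by simp
      ultimately have "- (\<kappa> * (x + \<delta>)\<^sup>2) + \<kappa> * x\<^sup>2 \<le> - (2 * \<kappa> * (\<delta> * c0))"
        by (simp add: power2_eq_square algebra_simps)
      then show ?thesis
        using le1[of C] B C(1) by simp
    qed
    finally have A2: "measure P ?A2 \<le> exp 1 * exp (- (2 * \<kappa> * (\<delta> * c0)))"
      by (simp add: exp_add[symmetric] algebra_simps)
    have sub: "?A \<subseteq> ?A1 \<union> ?A2"
    proof
      fix v assume v: "v \<in> ?A"
      show "v \<in> ?A1 \<union> ?A2"
      proof (cases "\<forall>i<n. \<bar>v i\<bar> \<le> 1")
        case True
        then have "(\<Sum>i<n. if \<bar>v i\<bar> \<le> 1 then (v i)\<^sup>2 else 0) = (?r v)\<^sup>2"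
          by (simp add: sum_nonneg)
        also have "\<dots> \<ge> (x + \<delta>)\<^sup>2"
          using v x_pos assms by (intro power_mono) auto
        finally show ?thesis using v by auto
      next
        case False
        then obtain i where i: "i < n" "\<not> \<bar>v i\<bar> \<le> 1" by auto
        have "(if \<bar>v i\<bar> \<le> 1 then 0 else 1) \<le> (\<Sum>i<n. (if \<bar>v i\<bar> \<le> 1 then 0 else 1) :: real)"
          using i by (intro member_le_sum) auto
        then show ?thesis using v i by auto
      qed
    qed
    have "measure P ?A \<le> measure P (?A1 \<union> ?A2)"
      by (rule P.finite_measure_mono[OF sub]) simp
    also have "\<dots> \<le> measure P ?A1 + measure P ?A2"
      by (rule measure_Un_le) auto
    also have "\<dots> \<le> exp 1 * (exp (- \<kappa>) + exp (- (2 * \<kappa> * (\<delta> * c0))))"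
      using A1 A2 by (simp add: algebra_simps)
    also have "\<dots> \<le> \<epsilon> * Phi (- K)" using \<kappa>(2) by simp
    also have "\<dots> \<le> \<epsilon> * Phi (- x)"
      using x assms by (intro mult_left_mono Phi_mono) auto
    finally show "measure P ?A \<le> \<epsilon> * Phi (- x)" .
  qed
qed

section \<open>Lindeberg replacement under the tilted measure\<close>

context small_array
begin

text \<open>Moments of one step \<open>tilt s / x\<close> under the law with density \<open>exp (tilt s) / tmass\<close>, and the
  third moment error \<open>step_err\<close> made when the step is replaced by a normal step of the same mean and variance.\<close>

definition "tmass = (\<integral>s. exp (tilt s) \<partial>D)"
definition "tmean = (\<integral>s. exp (tilt s) * tilt s \<partial>D) / (tmass * x)"
definition "tsq = (\<integral>s. exp (tilt s) * (tilt s)\<^sup>2 \<partial>D) / (tmass * x\<^sup>2)"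
definition "tvar = tsq - tmean\<^sup>2"
definition "tabs3 = (\<integral>s. exp (tilt s) * \<bar>tilt s\<bar>^3 \<partial>D) / (tmass * x^3)"
definition "step_err = tabs3 + 4 * \<bar>tmean\<bar>^3 + 8 * (sqrt tvar)^3"

text \<open>Integrating the pointwise comparison: the quadratic term meets the normalization of the
  second moment exactly, while the drift and the cubic error are each controlled by
  \<open>\<beta>\<close>.\<close>

lemma expectation_quadratic:
  assumes [measurable]: "f \<in> borel_measurable borel"
    and f: "\<And>s. \<bar>f s - (a + b * s + c * s\<^sup>2)\<bar> \<le> 20 * \<bar>s\<bar>^3"
  shows "integrable D f" "\<bar>real n * ((\<integral>s. f s \<partial>D) - a) - c * x\<^sup>2\<bar> \<le> (\<bar>b\<bar> + 20) * \<beta>"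
proof -
  let ?p = "\<lambda>s. a + b * s + c * s\<^sup>2"
  let ?d = "\<lambda>s. f s - ?p s"
  have ip: "integrable D ?p" using integrable_id integrable_square by auto
  have id: "integrable D ?d"
  proof (rule integrable_cubic_bound[where K=20])
    show "\<bar>?d s\<bar> \<le> 20 * (1 + \<bar>s\<bar>^3)" for s
      using f[of s] unfolding distrib_left by linarith
  qed measurable
  have "integrable D (\<lambda>s. ?d s + ?p s)" using ip id by (rule Bochner_Integration.integrable_add[rotated])
  then show int: "integrable D f" by simp
  have Ip: "(\<integral>s. ?p s \<partial>D) = a + b * (\<integral>s. s \<partial>D) + c * (\<integral>s. s\<^sup>2 \<partial>D)"
    using integrable_id integrable_square by (simp add: D.prob_space)
  have "\<bar>\<integral>s. ?d s \<partial>D\<bar> \<le> (\<integral>s. \<bar>?d s\<bar> \<partial>D)"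
    by (rule integral_abs_bound)
  also have "\<dots> \<le> (\<integral>s. 20 * \<bar>s\<bar>^3 \<partial>D)"
    using id int3 f by (intro integral_mono integrable_abs integrable_mult_right) auto
  finally have "real n * \<bar>\<integral>s. ?d s \<partial>D\<bar> \<le> 20 * (real n * (\<integral>s. \<bar>s\<bar>^3 \<partial>D))"
    using mult_left_mono[of _ _ "real n"] by (simp add: mult.left_commute)
  also have "\<dots> \<le> 20 * \<beta>" using m3 by simp
  finally have d: "\<bar>real n * (\<integral>s. ?d s \<partial>D)\<bar> \<le> 20 * \<beta>" by (simp add: abs_mult)
  have b: "\<bar>b * (real n * (\<integral>s. s \<partial>D))\<bar> \<le> \<bar>b\<bar> * \<beta>"
    using mult_left_mono[OF m1, of "\<bar>b\<bar>"] by (simp add: abs_mult)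
  have "(\<integral>s. f s \<partial>D) = (\<integral>s. ?d s \<partial>D) + (\<integral>s. ?p s \<partial>D)"
    using id ip by (subst Bochner_Integration.integral_add[symmetric]) auto
  then have "real n * ((\<integral>s. f s \<partial>D) - a) - c * x\<^sup>2
      = real n * (\<integral>s. ?d s \<partial>D) + b * (real n * (\<integral>s. s \<partial>D))"
    unfolding Ip m2[symmetric] by (simp add: algebra_simps)
  also have "\<bar>\<dots>\<bar> \<le> 20 * \<beta> + \<bar>b\<bar> * \<beta>"
    using d b by linarith
  finally show "\<bar>real n * ((\<integral>s. f s \<partial>D) - a) - c * x\<^sup>2\<bar> \<le> (\<bar>b\<bar> + 20) * \<beta>"
    by (simp add: algebra_simps)
qed

lemma tilted_moments:
  shows integrable_tilt: "integrable D (\<lambda>s. exp (tilt s))"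
      "integrable D (\<lambda>s. exp (tilt s) * tilt s)"
      "integrable D (\<lambda>s. exp (tilt s) * (tilt s)\<^sup>2)"
      "integrable D (\<lambda>s. exp (tilt s) * \<bar>tilt s\<bar>^3)"
    and tmass_bound: "\<bar>real n * (tmass - 1)\<bar> \<le> 21 * \<beta>"
    and tilt1: "\<bar>real n * (\<integral>s. exp (tilt s) * tilt s \<partial>D) - x\<^sup>2 / 2\<bar> \<le> 21 * \<beta>"
    and tilt2: "\<bar>real n * (\<integral>s. exp (tilt s) * (tilt s)\<^sup>2 \<partial>D) - x\<^sup>2\<bar> \<le> 20 * \<beta>"
    and tilt3: "real n * (\<integral>s. exp (tilt s) * \<bar>tilt s\<bar>^3 \<partial>D) \<le> 20 * \<beta>"
proof -
  note t = tilt_bounds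
  have A: "integrable D (\<lambda>s. exp (tilt s))" "\<bar>real n * ((\<integral>s. exp (tilt s) \<partial>D) - 1) - 0 * x\<^sup>2\<bar> \<le> (\<bar>1\<bar> + 20) * \<beta>"
    by (rule expectation_quadratic[where a=1 and b=1 and c=0];
        use t(1) in \<open>simp add: diff_diff_eq\<close>)+
  have B: "integrable D (\<lambda>s. exp (tilt s) * tilt s)"
     "\<bar>real n * ((\<integral>s. exp (tilt s) * tilt s \<partial>D) - 0) - 1 / 2 * x\<^sup>2\<bar> \<le> (\<bar>1\<bar> + 20) * \<beta>"
    by (rule expectation_quadratic[where a=0 and b=1 and c="1/2"];
        use t(2) in \<open>simp add: diff_diff_eq\<close>)+
  have C: "integrable D (\<lambda>s. exp (tilt s) * (tilt s)\<^sup>2)"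
     "\<bar>real n * ((\<integral>s. exp (tilt s) * (tilt s)\<^sup>2 \<partial>D) - 0) - 1 * x\<^sup>2\<bar> \<le> (\<bar>0\<bar> + 20) * \<beta>"
    by (rule expectation_quadratic[where a=0 and b=0 and c=1];
        use t(3) in \<open>simp\<close>)+
  have E: "integrable D (\<lambda>s. exp (tilt s) * \<bar>tilt s\<bar>^3)"
     "\<bar>real n * ((\<integral>s. exp (tilt s) * \<bar>tilt s\<bar>^3 \<partial>D) - 0) - 0 * x\<^sup>2\<bar> \<le> (\<bar>0\<bar> + 20) * \<beta>"
    by (rule expectation_quadratic[where a=0 and b=0 and c=0];
        use t(4) in \<open>simp add: abs_mult\<close>)+
  show "integrable D (\<lambda>s. exp (tilt s))"
      "integrable D (\<lambda>s. exp (tilt s) * tilt s)"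
      "integrable D (\<lambda>s. exp (tilt s) * (tilt s)\<^sup>2)"
      "integrable D (\<lambda>s. exp (tilt s) * \<bar>tilt s\<bar>^3)"
    using A B C E by auto
  show "\<bar>real n * (tmass - 1)\<bar> \<le> 21 * \<beta>"
    using A(2) by (simp add: tmass_def)
  show "\<bar>real n * (\<integral>s. exp (tilt s) * tilt s \<partial>D) - x\<^sup>2 / 2\<bar> \<le> 21 * \<beta>"
    "\<bar>real n * (\<integral>s. exp (tilt s) * (tilt s)\<^sup>2 \<partial>D) - x\<^sup>2\<bar> \<le> 20 * \<beta>"
    "real n * (\<integral>s. exp (tilt s) * \<bar>tilt s\<bar>^3 \<partial>D) \<le> 20 * \<beta>"
    using B(2) C(2) E(2) by auto
qed

text \<open>With \<open>l = x / sqrt n\<close>, the L2 norm of \<open>D\<close>, this is Lyapunov's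
  inequality \<open>l^3 \<le> E \<bar>s\<bar>^3\<close>, integrated from \<open>(\<bar>s\<bar> -
  l)\<^sup>2 * (2 * \<bar>s\<bar> + l) \<ge> 0\<close>. It makes \<open>\<beta>\<close> positive and
  lets a small \<open>\<beta>\<close> force \<open>x\<^sup>2 / n\<close> to be small.\<close>

lemma lyapunov: "x^3 \<le> \<beta> * sqrt (real n)"
proof -
  define l where "l = x / sqrt (real n)"
  have l0: "0 < l" using x_pos n_pos by (simp add: l_def)
  have l2: "l\<^sup>2 = (\<integral>s. s\<^sup>2 \<partial>D)"
    using m2 n_pos by (simp add: l_def power_divide field_simps)
  have "3 * l * s\<^sup>2 \<le> 2 * \<bar>s\<bar>^3 + l^3" for s
  proof -
    have "0 \<le> (\<bar>s\<bar> - l)\<^sup>2 * (2 * \<bar>s\<bar> + l)" using l0 by simp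
    moreover have "(\<bar>s\<bar> - l)\<^sup>2 * (2 * \<bar>s\<bar> + l) = 2 * \<bar>s\<bar>^3 + l^3 - 3 * l * \<bar>s\<bar>\<^sup>2"
      by (simp add: power2_eq_square power3_eq_cube algebra_simps)
    ultimately show ?thesis by simp
  qed
  then have "(\<integral>s. 3 * l * s\<^sup>2 \<partial>D) \<le> (\<integral>s. 2 * \<bar>s\<bar>^3 + l^3 \<partial>D)"
    using integrable_square int3
    by (intro integral_mono integrable_mult_right Bochner_Integration.integrable_add) auto
  then have "3 * l * l\<^sup>2 \<le> 2 * (\<integral>s. \<bar>s\<bar>^3 \<partial>D) + l^3"
    using integrable_square int3 by (simp add: l2 D.prob_space)
  then have "l^3 \<le> (\<integral>s. \<bar>s\<bar>^3 \<partial>D)"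
    by (simp add: power2_eq_square power3_eq_cube)
  then have "real n * l^3 \<le> \<beta>"
    using m3 mult_left_mono[of "l^3" _ "real n"] by fastforce
  moreover have "real n * l^3 = x^3 / sqrt (real n)"
    using n_pos by (simp add: l_def power_divide power3_eq_cube)
  ultimately show ?thesis
    using n_pos by (simp add: field_simps)
qed

lemma beta_pos: "0 < \<beta>"
proof (rule ccontr)
  assume "\<not> 0 < \<beta>"
  then have "\<beta> * sqrt (real n) \<le> 0" by (simp add: mult_nonpos_nonneg)
  moreover have "0 < x^3" using x_pos by simp
  ultimately show False using lyapunov by linarith
qed

lemma lyapunov_squared: "x^6 \<le> \<beta>\<^sup>2 * real n"
proof -
  have "(x^3)\<^sup>2 \<le> (\<beta> * sqrt (real n))\<^sup>2"
    using lyapunov x_pos by (intro power_mono) auto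
  then show ?thesis by (simp add: power_mult_distrib)
qed

text \<open>The tilted step and the normal step with parameters \<open>tmean\<close> and
  \<open>tvar\<close> are both expanded to second order at \<open>a\<close>. Their quadratic parts
  agree, so only the two cubic remainders survive; the normal side is then evaluated exactly by
  \<open>nn_integral_gexp_normal\<close>.\<close>

lemma lindeberg_step:
  assumes \<sigma>: "0 < \<sigma>" and v: "0 < tvar" and tmass: "0 < tmass"
  shows "(\<integral>\<^sup>+s. ennreal (exp (tilt s) * gexp x \<sigma> (a + tilt s / x)) \<partial>D)
    \<le> ennreal (tmass * (gexp x (sqrt (\<sigma>\<^sup>2 + tvar)) (a + tmean) + 2 / \<sigma>^3 * step_err))"
proof -
  let ?G = "gexp x \<sigma> a" and ?G1 = "gexp1 x \<sigma> a" and ?G2 = "gexp2 x \<sigma> a"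
  let ?\<tau> = "sqrt tvar"
  have \<tau>: "0 < ?\<tau>" using v by simp
  let ?T = "?G + tmean * ?G1 + tsq / 2 * ?G2"
  let ?up = "\<lambda>s. exp (tilt s) * ?G + exp (tilt s) * tilt s * (?G1 / x)
      + exp (tilt s) * (tilt s)\<^sup>2 * (?G2 / (2 * x\<^sup>2)) + exp (tilt s) * \<bar>tilt s\<bar>^3 * (2 / (\<sigma>^3 * x^3))"
  have up: "exp (tilt s) * gexp x \<sigma> (a + tilt s / x) \<le> ?up s" for s
  proof -
    have "gexp x \<sigma> (a + tilt s / x) \<le> ?G + tilt s / x * ?G1 + (tilt s / x)\<^sup>2 / 2 * ?G2 + 2 * \<bar>tilt s / x\<bar>^3 / \<sigma>^3"
      using gexp_taylor[OF \<sigma> x_pos, of a "tilt s / x"] by linarith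
    from mult_left_mono[OF this, of "exp (tilt s)"] show ?thesis
      using x_pos by (simp add: power_divide abs_divide distrib_left mult_ac)
  qed
  have nonneg: "0 \<le> exp (tilt s) * gexp x \<sigma> (a + tilt s / x)" for s by simp
  have iup: "integrable D ?up"
    using integrable_tilt by (intro Bochner_Integration.integrable_add integrable_mult_left) auto
  have "(\<integral>s. ?up s \<partial>D) = tmass * ?G + (\<integral>s. exp (tilt s) * tilt s \<partial>D) * (?G1 / x)
      + (\<integral>s. exp (tilt s) * (tilt s)\<^sup>2 \<partial>D) * (?G2 / (2 * x\<^sup>2))
      + (\<integral>s. exp (tilt s) * \<bar>tilt s\<bar>^3 \<partial>D) * (2 / (\<sigma>^3 * x^3))"
    unfolding tmass_def using integrable_tilt by simp
  also have "\<dots> = tmass * (?T + 2 / \<sigma>^3 * tabs3)"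
    using tmass x_pos unfolding tmean_def tsq_def tabs3_def by (simp add: distrib_left mult_ac)
  finally have "(\<integral>s. ?up s \<partial>D) = tmass * (?T + 2 / \<sigma>^3 * tabs3)" .
  then have "(\<integral>\<^sup>+s. ennreal (?up s) \<partial>D) = ennreal (tmass * (?T + 2 / \<sigma>^3 * tabs3))"
    using order_trans[OF nonneg up] by (subst nn_integral_eq_integral[OF iup]) auto
  moreover have "(\<integral>\<^sup>+s. ennreal (exp (tilt s) * gexp x \<sigma> (a + tilt s / x)) \<partial>D) \<le> (\<integral>\<^sup>+s. ennreal (?up s) \<partial>D)"
    by (intro nn_integral_mono ennreal_leI up)
  ultimately have 1: "(\<integral>\<^sup>+s. ennreal (exp (tilt s) * gexp x \<sigma> (a + tilt s / x)) \<partial>D) \<le> ennreal (tmass * (?T + 2 / \<sigma>^3 * tabs3))"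
    by simp
  let ?nd = "normal_density tmean ?\<tau>"
  let ?lo = "\<lambda>u. ?nd u * ?G + ?nd u * u * ?G1 + ?nd u * u\<^sup>2 * (?G2 / 2) - ?nd u * \<bar>u\<bar>^3 * (2 / \<sigma>^3)"
  have lo: "?lo u \<le> ?nd u * gexp x \<sigma> (a + u)" for u
  proof -
    have "?G + u * ?G1 + u\<^sup>2 / 2 * ?G2 - 2 * \<bar>u\<bar>^3 / \<sigma>^3 \<le> gexp x \<sigma> (a + u)"
      using gexp_taylor[OF \<sigma> x_pos, of a u] by linarith
    from mult_left_mono[OF this, of "?nd u"] show ?thesis
      by (simp add: algebra_simps)
  qed
  have i2: "integrable lborel (\<lambda>u. ?nd u * u\<^sup>2)" and I2: "(\<integral>u. ?nd u * u\<^sup>2 \<partial>lborel) = tvar + tmean\<^sup>2"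
  proof -
    have eq: "(\<lambda>u. ?nd u * u\<^sup>2) = (\<lambda>u. ?nd u * (u - tmean)^(2 * 1) + 2 * tmean * (?nd u * u) - tmean\<^sup>2 * ?nd u)"
      by (simp add: fun_eq_iff power2_eq_square algebra_simps)
    note m = normal_moment_even[OF \<tau>, of tmean 1] normal_moment_nz_1[OF \<tau>, of tmean]
    have "has_bochner_integral lborel (\<lambda>u. ?nd u * u\<^sup>2) (tvar + 2 * tmean * tmean - tmean\<^sup>2 * 1)"
      unfolding eq using m v \<tau>
      by (intro has_bochner_integral_diff has_bochner_integral_add has_bochner_integral_mult_right)
         (auto simp: has_bochner_integral_iff fact_numeral)
    then show "integrable lborel (\<lambda>u. ?nd u * u\<^sup>2)" "(\<integral>u. ?nd u * u\<^sup>2 \<partial>lborel) = tvar + tmean\<^sup>2"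
      by (auto simp: has_bochner_integral_iff power2_eq_square)
  qed
  note i3 = normal_abs_third_moment[OF \<tau>, of tmean]
  have ilo: "integrable lborel ?lo"
    using \<tau> i2 i3(2) integrable_normal_moment_nz_1[OF \<tau>]
    by (intro Bochner_Integration.integrable_add Bochner_Integration.integrable_diff integrable_mult_left) auto
  have "(\<integral>u. ?lo u \<partial>lborel) = ?T - 2 / \<sigma>^3 * (\<integral>u. ?nd u * \<bar>u\<bar>^3 \<partial>lborel)"
    using \<tau> i2 i3(2) integrable_normal_moment_nz_1[OF \<tau>] integral_normal_moment_nz_1[OF \<tau>] I2
    by (simp add: tvar_def)
  moreover have "(\<integral>u. ?lo u \<partial>lborel) \<le> gexp x (sqrt (\<sigma>\<^sup>2 + tvar)) (a + tmean)"
  proof -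
    have ig: "integrable lborel (\<lambda>u. ?nd u * gexp x \<sigma> (a + u))"
    proof (rule Bochner_Integration.integrable_bound)
      show "integrable lborel ?nd" using \<tau> by simp
      show "AE u in lborel. norm (?nd u * gexp x \<sigma> (a + u)) \<le> norm (?nd u)"
        using gexp_le_1[OF \<sigma>, of x] x_pos by (auto simp: abs_mult intro!: mult_left_le)
    qed measurable
    have "ennreal (\<integral>u. ?nd u * gexp x \<sigma> (a + u) \<partial>lborel) = ennreal (gexp x (sqrt (\<sigma>\<^sup>2 + tvar)) (a + tmean))"
      using nn_integral_gexp_normal[OF \<sigma> \<tau>, of tmean x a] v
      by (subst nn_integral_eq_integral[OF ig, symmetric]) auto
    then have "(\<integral>u. ?nd u * gexp x \<sigma> (a + u) \<partial>lborel) = gexp x (sqrt (\<sigma>\<^sup>2 + tvar)) (a + tmean)"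
      by (simp add: integral_nonneg_AE)
    then show ?thesis
      using integral_mono[OF ilo ig lo] by simp
  qed
  moreover have "2 / \<sigma>^3 * (\<integral>u. ?nd u * \<bar>u\<bar>^3 \<partial>lborel) \<le> 2 / \<sigma>^3 * (4 * \<bar>tmean\<bar>^3 + 8 * ?\<tau>^3)"
    using i3(1) \<sigma> by (intro mult_left_mono) auto
  ultimately have "?T + 2 / \<sigma>^3 * tabs3 \<le> gexp x (sqrt (\<sigma>\<^sup>2 + tvar)) (a + tmean) + 2 / \<sigma>^3 * step_err"
    unfolding step_err_def by (simp only: distrib_left)
  then have "tmass * (?T + 2 / \<sigma>^3 * tabs3) \<le> tmass * (gexp x (sqrt (\<sigma>\<^sup>2 + tvar)) (a + tmean) + 2 / \<sigma>^3 * step_err)"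
    using tmass by simp
  with 1 show ?thesis
    by (meson ennreal_leI order_trans)
qed

lemma step_err_nonneg: "0 < tmass \<Longrightarrow> 0 < tvar \<Longrightarrow> 0 \<le> step_err"
  unfolding step_err_def tabs3_def using x_pos by (intro add_nonneg_nonneg) (auto intro!: divide_nonneg_nonneg)

text \<open>Induction on the number \<open>k\<close> of steps still to be replaced, with
  \<open>j\<close> counting the normal steps already inserted. Both \<open>j\<close> and
  \<open>a\<close> must vary, since each replacement raises the variance by \<open>tvar\<close> and
  shifts the argument by \<open>tmean\<close>.\<close>

lemma lindeberg:
  assumes h: "0 < h" and v: "0 < tvar" and tmass: "0 < tmass"
  shows "(\<integral>\<^sup>+w. ennreal ((\<Prod>i<k. exp (tilt (w i)))
        * gexp x (sqrt (h\<^sup>2 + real j * tvar)) (a + (\<Sum>i<k. tilt (w i)) / x)) \<partial>PiM {..<k} (\<lambda>_. D))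
    \<le> ennreal (tmass^k * (gexp x (sqrt (h\<^sup>2 + real (j + k) * tvar)) (a + real k * tmean)
        + (\<Sum>l<k. 2 / (sqrt (h\<^sup>2 + real (j + l) * tvar))^3 * step_err)))"
proof (induction k arbitrary: j a)
  case 0
  show ?case by (simp add: PP.nn_integral_empty lessThan_0 space_PiM_empty emeasure_PiM_empty)
next
  case (Suc k)
  let ?sg = "\<lambda>j. sqrt (h\<^sup>2 + real j * tvar)"
  have sg: "0 < ?sg j" for j using h v by (simp add: add_pos_nonneg)
  have sg_Suc: "sqrt ((?sg j)\<^sup>2 + tvar) = ?sg (Suc j)" for j
    using h v by (simp add: add_nonneg_nonneg algebra_simps)
  let ?e = "2 / (?sg j)^3 * step_err"
  have e0: "0 \<le> ?e" using step_err_nonneg[OF tmass v] sg[of j] by simp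
  let ?W = "\<lambda>w. \<Prod>i<k. exp (tilt (w i))"
  let ?Y = "\<lambda>w. (\<Sum>i<k. tilt (w i))"
  let ?F = "\<lambda>w. ennreal ((\<Prod>i<Suc k. exp (tilt (w i))) * gexp x (?sg j) (a + (\<Sum>i<Suc k. tilt (w i)) / x))"
  have W0: "0 \<le> ?W w" for w by (intro prod_nonneg) auto
  have [measurable]: "(\<lambda>w. ?W w) \<in> borel_measurable (PiM {..<k} (\<lambda>_. D))"
     "(\<lambda>w. ?Y w) \<in> borel_measurable (PiM {..<k} (\<lambda>_. D))"
    by measurable
  have "(\<integral>\<^sup>+w. ?F w \<partial>PiM {..<Suc k} (\<lambda>_. D)) = (\<integral>\<^sup>+w. ?F w \<partial>PiM (insert k {..<k}) (\<lambda>_. D))"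
    by (simp add: lessThan_Suc)
  \<comment> \<open>Coordinate \<open>k\<close> is split off and integrated first with the others
    frozen, so that \<open>lindeberg_step\<close> applies to the inner integral.\<close>
  also have "\<dots> = (\<integral>\<^sup>+w. \<integral>\<^sup>+y. ?F (w(k := y)) \<partial>D \<partial>PiM {..<k} (\<lambda>_. D))"
  proof (rule PP.product_nn_integral_insert)
    have "?F \<in> borel_measurable (PiM {..<Suc k} (\<lambda>_. D))" by measurable
    then show "?F \<in> borel_measurable (PiM (insert k {..<k}) (\<lambda>_. D))" by (simp add: lessThan_Suc)
  qed auto
  also have "\<dots> \<le> (\<integral>\<^sup>+w. ennreal (tmass * (?W w * gexp x (?sg (Suc j)) (a + tmean + ?Y w / x))) + ennreal (tmass * ?e) * ennreal (?W w) \<partial>PiM {..<k} (\<lambda>_. D))"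
  proof (rule nn_integral_mono)
    fix w
    have upd: "(\<Prod>i<k. exp (tilt ((w(k := y)) i))) = ?W w" "(\<Sum>i<k. tilt ((w(k := y)) i)) = ?Y w" for y
      by (auto intro!: prod.cong sum.cong)
    have "(\<integral>\<^sup>+y. ?F (w(k := y)) \<partial>D)
        = (\<integral>\<^sup>+y. ennreal (?W w) * ennreal (exp (tilt y) * gexp x (?sg j) (a + ?Y w / x + tilt y / x)) \<partial>D)"
      by (intro nn_integral_cong)
         (simp add: upd ennreal_mult[symmetric] W0 add_divide_distrib add_ac mult_ac del: fun_upd_apply, simp)
    also have "\<dots> = ennreal (?W w) * (\<integral>\<^sup>+y. ennreal (exp (tilt y) * gexp x (?sg j) (a + ?Y w / x + tilt y / x)) \<partial>D)"
      by (rule nn_integral_cmult) measurable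
    also have "\<dots> \<le> ennreal (?W w) * ennreal (tmass * (gexp x (?sg (Suc j)) (a + ?Y w / x + tmean) + ?e))"
      using lindeberg_step[OF sg[of j] v tmass, of "a + ?Y w / x"] unfolding sg_Suc by (intro mult_left_mono) auto
    also have "\<dots> = ennreal (tmass * (?W w * gexp x (?sg (Suc j)) (a + tmean + ?Y w / x))) + ennreal (tmass * ?e) * ennreal (?W w)"
    proof -
      have "ennreal W * ennreal (tmass * (g + e)) = ennreal (tmass * (W * g)) + ennreal (tmass * e) * ennreal W"
        if "0 \<le> W" "0 \<le> g" "0 \<le> e" for W g e :: real
      proof -
        have "ennreal W * ennreal (tmass * (g + e)) = ennreal (tmass * (W * g) + tmass * e * W)"
          using that tmass by (simp add: ennreal_mult[symmetric] algebra_simps del: ennreal_plus)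
        then show ?thesis
          using that tmass by (simp add: ennreal_mult)
      qed
      from this[OF W0[of w] gexp_nonneg e0, of x "?sg (Suc j)" "a + ?Y w / x + tmean"] show ?thesis
        by (simp only: add.assoc add.commute[of "?Y w / x"])
    qed
    finally show "(\<integral>\<^sup>+y. ?F (w(k := y)) \<partial>D)
      \<le> ennreal (tmass * (?W w * gexp x (?sg (Suc j)) (a + tmean + ?Y w / x))) + ennreal (tmass * ?e) * ennreal (?W w)" .
  qed
  also have "\<dots> = ennreal tmass * (\<integral>\<^sup>+w. ennreal (?W w * gexp x (?sg (Suc j)) (a + tmean + ?Y w / x)) \<partial>PiM {..<k} (\<lambda>_. D))
      + ennreal (tmass * ?e) * (\<integral>\<^sup>+w. ennreal (?W w) \<partial>PiM {..<k} (\<lambda>_. D))"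
    using tmass W0 e0 by (subst nn_integral_add) (auto simp: nn_integral_cmult ennreal_mult)
  also have "(\<integral>\<^sup>+w. ennreal (?W w) \<partial>PiM {..<k} (\<lambda>_. D)) = ennreal (tmass^k)"
  proof -
    have "(\<integral>\<^sup>+w. ennreal (?W w) \<partial>PiM {..<k} (\<lambda>_. D)) = (\<integral>\<^sup>+w. (\<Prod>i<k. ennreal (exp (tilt (w i)))) \<partial>PiM {..<k} (\<lambda>_. D))"
      by (simp add: prod_ennreal)
    also have "\<dots> = (\<Prod>i<k. \<integral>\<^sup>+s. ennreal (exp (tilt s)) \<partial>D)"
      by (rule PP.product_nn_integral_prod) auto
    also have "(\<integral>\<^sup>+s. ennreal (exp (tilt s)) \<partial>D) = ennreal tmass"
      unfolding tmass_def using integrable_tilt(1) by (intro nn_integral_eq_integral) auto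
    finally show ?thesis using tmass by (simp add: ennreal_power)
  qed
  also have "ennreal tmass * (\<integral>\<^sup>+w. ennreal (?W w * gexp x (?sg (Suc j)) (a + tmean + ?Y w / x)) \<partial>PiM {..<k} (\<lambda>_. D))
      + ennreal (tmass * ?e) * ennreal (tmass^k)
    \<le> ennreal tmass * ennreal (tmass^k * (gexp x (?sg (Suc j + k)) (a + tmean + real k * tmean)
        + (\<Sum>l<k. 2 / (?sg (Suc j + l))^3 * step_err))) + ennreal (tmass * ?e) * ennreal (tmass^k)"
    by (intro add_right_mono mult_left_mono Suc.IH) auto
  also have "\<dots> = ennreal (tmass^Suc k * (gexp x (?sg (j + Suc k)) (a + real (Suc k) * tmean)
        + (\<Sum>l<Suc k. 2 / (?sg (j + l))^3 * step_err)))"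
  proof -
    have s: "(\<Sum>l<Suc k. 2 / (?sg (j + l))^3 * step_err) = ?e + (\<Sum>l<k. 2 / (?sg (Suc j + l))^3 * step_err)"
      unfolding sum.lessThan_Suc_shift by simp
    have "0 \<le> (\<Sum>l<k. 2 / (?sg (Suc j + l))^3 * step_err)"
      using step_err_nonneg[OF tmass v] by (intro sum_nonneg mult_nonneg_nonneg) (auto intro!: divide_nonneg_nonneg zero_le_power simp: v less_imp_le)
    moreover have "ennreal tmass * ennreal (tmass^k * (g + r)) + ennreal (tmass * e) * ennreal (tmass^k)
        = ennreal (tmass * (tmass^k * (g + r)) + tmass * e * tmass^k)"
      if "0 \<le> r" "0 \<le> g" "0 \<le> e" for r g e :: real
      using that tmass by (subst ennreal_plus) (auto simp: ennreal_mult)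
    ultimately have "ennreal tmass * ennreal (tmass^k * (gexp x (?sg (Suc j + k)) (a + tmean + real k * tmean)
        + (\<Sum>l<k. 2 / (?sg (Suc j + l))^3 * step_err))) + ennreal (tmass * ?e) * ennreal (tmass^k)
      = ennreal (tmass * (tmass^k * (gexp x (?sg (Suc j + k)) (a + tmean + real k * tmean)
        + (\<Sum>l<k. 2 / (?sg (Suc j + l))^3 * step_err))) + tmass * ?e * tmass^k)"
      using e0 gexp_nonneg by blast
    also have "tmass * (tmass^k * (gexp x (?sg (Suc j + k)) (a + tmean + real k * tmean)
        + (\<Sum>l<k. 2 / (?sg (Suc j + l))^3 * step_err))) + tmass * ?e * tmass^k
      = tmass^Suc k * (gexp x (?sg (j + Suc k)) (a + real (Suc k) * tmean)
        + (\<Sum>l<Suc k. 2 / (?sg (j + l))^3 * step_err))"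
    proof -
      have "a + tmean + real k * tmean = a + real (Suc k) * tmean" "Suc j + k = j + Suc k"
        by (simp_all add: algebra_simps)
      then show ?thesis unfolding s by (simp only: power_Suc distrib_left mult_ac add_ac)
    qed
    finally show ?thesis .
  qed
  finally show ?case .
qed

end

section \<open>Moderate deviations of self-normalized sums\<close>

text \<open>Telescoping, from
  \<open>1 / sqrt (n + 1) \<le> 2 * (sqrt (n + 1) - sqrt n)\<close>.\<close>

lemma sum_inverse_sqrt_le: "(\<Sum>l<n. 1 / sqrt (real (Suc l))) \<le> 2 * sqrt (real n)"
proof (induction n)
  case (Suc n)
  have "1 / sqrt (real (Suc n)) \<le> 2 * (sqrt (real (Suc n)) - sqrt (real n))"
  proof -
    let ?a = "sqrt (real (Suc n))" and ?b = "sqrt (real n)"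
    have p: "0 < ?a" "?b \<le> ?a" "0 \<le> ?b" by auto
    have "(?a - ?b) * (?a + ?b) = 1"
      by (simp add: algebra_simps flip: power2_eq_square)
    moreover have "(?a - ?b) * (?a + ?b) \<le> (?a - ?b) * (2 * ?a)"
      using p by (intro mult_left_mono) auto
    ultimately have "1 \<le> 2 * (?a - ?b) * ?a" by linarith
    then show ?thesis using p(1) by (simp only: pos_divide_le_eq)
  qed
  then show ?case using Suc by simp
qed simp

section \<open>Size of the tilted parameters and the probability of the tilted event\<close>

context small_array
begin

text \<open>The thresholds on \<open>\<beta>\<close> have one task each: \<open>1 / 42\<close> keeps
  \<open>tmass\<close> above 1/2, \<open>126 * \<beta> \<le> c0\<^sup>2\<close> keeps the total mean
  between 0 and \<open>x\<close>, and \<open>2 * K * \<beta> \<le> 1\<close> keeps the total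
  variance between 1/2 and 3/2. In \<open>K\<close> the multiple of \<open>1 / c0\<^sup>2\<close>
  pays for the second moment and \<open>1 / c0^4\<close> for the squared mean.\<close>

lemma tilted_parameters:
  assumes c0: "0 < c0" "c0 \<le> x"
    and K: "K = 164 / c0\<^sup>2 + 1 / c0^4"
    and b: "\<beta> \<le> 1 / 42" "126 * \<beta> \<le> c0\<^sup>2" "2 * K * \<beta> \<le> 1"
  shows "1 / 2 \<le> tmass" "tmass^n \<le> exp (21 * \<beta>)" "\<bar>real n * tmean - x / 2\<bar> \<le> 63 * \<beta> / x"
    "\<bar>real n * tvar - 1\<bar> \<le> K * \<beta>" "x\<^sup>2 / real n \<le> \<beta> / c0^4"
    "step_err \<le> 68 * \<beta> / (real n * x^3)"
proof -
  have n: "0 < real n" "1 \<le> real n" using n_pos by auto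
  have b0: "0 < \<beta>" by (rule beta_pos)
  have b1: "\<beta> \<le> 1" using b(1) by simp
  have mwb: "\<bar>tmass - 1\<bar> \<le> 21 * \<beta> / real n"
    using tmass_bound n unfolding abs_mult by (simp add: pos_le_divide_eq mult.commute)
  also have "\<dots> \<le> 21 * \<beta> / 1" using b0 n by (intro divide_left_mono) auto
  also have "\<dots> \<le> 1 / 2" using b(1) by simp
  finally show mw2: "1 / 2 \<le> tmass" by linarith
  have "tmass^n \<le> (exp (21 * \<beta> / real n))^n"
  proof (rule power_mono)
    have "tmass \<le> 1 + 21 * \<beta> / real n" using mwb by linarith
    also have "\<dots> \<le> exp (21 * \<beta> / real n)" by (rule exp_ge_add_one_self)
    finally show "tmass \<le> exp (21 * \<beta> / real n)" .
  qed (use mw2 in simp)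
  then show "tmass^n \<le> exp (21 * \<beta>)"
    using n by (simp add: exp_of_nat_mult[symmetric])
  have c0x: "c0\<^sup>2 \<le> x\<^sup>2" "c0^4 \<le> x^4" using c0 by (auto intro!: power_mono)
  have "x\<^sup>2 / real n = x^6 / (x^4 * real n)"
    using x_pos by (simp add: eval_nat_numeral)
  also have "\<dots> \<le> \<beta>\<^sup>2 * real n / (x^4 * real n)"
    using lyapunov_squared x_pos n by (intro divide_right_mono) auto
  also have "\<dots> = \<beta> * \<beta> / x^4" using n by (simp add: power2_eq_square)
  also have "\<dots> \<le> \<beta> * 1 / c0^4"
    using b0 b1 c0x c0 by (intro frac_le mult_left_mono) auto
  finally show xn: "x\<^sup>2 / real n \<le> \<beta> / c0^4" by simp
  have x2n: "x\<^sup>2 \<le> real n"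
  proof -
    have "(x\<^sup>2)^3 \<le> 1 * real n"
      using lyapunov_squared b0 b1 n by (intro order_trans[OF _ mult_right_mono[of "\<beta>\<^sup>2" 1]])
        (auto intro!: power_le_one simp: power_mult[symmetric])
    also have "\<dots> \<le> real n^3" using power_increasing[of 1 3 "real n"] n by simp
    finally show ?thesis using n by (subst (asm) power_mono_iff) auto
  qed
  have mwx: "\<bar>(tmass - 1) * x\<^sup>2\<bar> \<le> 21 * \<beta>"
  proof -
    have "\<bar>(tmass - 1) * x\<^sup>2\<bar> \<le> (21 * \<beta> / real n) * real n"
      unfolding abs_mult using mwb x2n b0 n by (intro mult_mono) auto
    then show ?thesis using n by simp
  qed
  let ?m1 = "\<integral>s. exp (tilt s) * tilt s \<partial>D" and ?m2 = "\<integral>s. exp (tilt s) * (tilt s)\<^sup>2 \<partial>D"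
  have mw0: "0 < tmass" using mw2 by simp
  have div_mw: "\<bar>u / tmass\<bar> \<le> 2 * B" if "\<bar>u\<bar> \<le> B" for u B
  proof -
    have "\<bar>u / tmass\<bar> \<le> B / (1 / 2)"
      unfolding abs_divide using that mw2 by (intro frac_le) auto
    then show ?thesis by simp
  qed
  have th_eq: "real n * tmean - x / 2 = (real n * ?m1 - x\<^sup>2 / 2 - (tmass - 1) * x\<^sup>2 / 2) / tmass / x"
    using mw0 x_pos by (simp add: tmean_def field_simps power2_eq_square)
  have "\<bar>real n * ?m1 - x\<^sup>2 / 2 - (tmass - 1) * x\<^sup>2 / 2\<bar> \<le> 63 / 2 * \<beta>"
    using tilt1 mwx by linarith
  from div_mw[OF this] show thb: "\<bar>real n * tmean - x / 2\<bar> \<le> 63 * \<beta> / x"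
    unfolding th_eq abs_divide[of _ x] abs_of_pos[OF x_pos] using x_pos by (intro divide_right_mono) auto
  have q2_eq: "real n * tsq - 1 = (real n * ?m2 - x\<^sup>2 - (tmass - 1) * x\<^sup>2) / tmass / x\<^sup>2"
    using mw0 x_pos by (simp add: tsq_def field_simps power2_eq_square)
  have "\<bar>real n * ?m2 - x\<^sup>2 - (tmass - 1) * x\<^sup>2\<bar> \<le> 41 * \<beta>"
    using tilt2 mwx by linarith
  from div_mw[OF this] have "\<bar>real n * tsq - 1\<bar> \<le> 82 * \<beta> / x\<^sup>2"
    unfolding q2_eq abs_divide[of _ "x\<^sup>2"] abs_power2 using x_pos by (intro divide_right_mono) auto
  also have "\<dots> \<le> 82 * \<beta> / c0\<^sup>2"
    using b0 c0x c0 by (intro divide_left_mono) auto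
  finally have q2b: "\<bar>real n * tsq - 1\<bar> \<le> 82 * \<beta> / c0\<^sup>2" .
  have "63 * \<beta> / x \<le> x / 2"
    using b(2) c0x x_pos by (simp add: field_simps power2_eq_square)
  then have nth: "0 \<le> real n * tmean" "real n * tmean \<le> x" using thb by linarith+
  have th0: "0 \<le> tmean" "tmean \<le> x / real n"
    using nth n by (auto simp: zero_le_mult_iff field_simps)
  have nth2: "real n * tmean\<^sup>2 \<le> \<beta> / c0^4"
  proof -
    have "real n * tmean\<^sup>2 = (real n * tmean)\<^sup>2 / real n" using n by (simp add: power2_eq_square)
    also have "\<dots> \<le> x\<^sup>2 / real n" using nth n by (intro divide_right_mono power_mono) auto
    finally show ?thesis using xn by linarith
  qed
  have "\<bar>real n * tvar - 1\<bar> \<le> \<bar>real n * tsq - 1\<bar> + real n * tmean\<^sup>2"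
  proof -
    have "0 \<le> real n * tmean\<^sup>2" by simp
    moreover have "real n * tvar - 1 = (real n * tsq - 1) - real n * tmean\<^sup>2" by (simp add: tvar_def algebra_simps)
    ultimately show ?thesis by linarith
  qed
  also have "\<dots> \<le> 82 * \<beta> / c0\<^sup>2 + \<beta> / c0^4" using q2b nth2 by linarith
  also have "\<dots> \<le> K * \<beta>"
    using b0 c0 by (simp add: K algebra_simps divide_right_mono)
  finally show vvb: "\<bar>real n * tvar - 1\<bar> \<le> K * \<beta>" .
  then have nvv: "1 / 2 \<le> real n * tvar" "real n * tvar \<le> 3 / 2" using b(3) by linarith+
  then have "0 < real n * tvar" by linarith
  then have tvar: "0 < tvar" "tvar \<le> 2 / real n"
    using nvv n by (auto simp: zero_less_mult_iff field_simps)
  have nx: "0 < real n * x^3" using n x_pos by simp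
  have g1: "tabs3 \<le> 40 * \<beta> / (real n * x^3)"
  proof -
    have "tabs3 = (real n * (\<integral>s. exp (tilt s) * \<bar>tilt s\<bar>^3 \<partial>D)) / tmass / (real n * x^3)"
      using n mw0 by (simp add: tabs3_def)
    also have "\<dots> \<le> (20 * \<beta>) / (1 / 2) / (real n * x^3)"
      using tilt3 mw2 nx b0 by (intro divide_right_mono frac_le) auto
    finally show ?thesis by simp
  qed
  have g2: "\<bar>tmean\<bar>^3 \<le> \<beta> / (real n * x^3)"
  proof -
    have "\<bar>tmean\<bar>^3 \<le> (x / real n)^3" using th0 by (intro power_mono) auto
    also have "\<dots> = x^6 / real n^2 / (real n * x^3)"
      using n x_pos by (simp add: field_simps eval_nat_numeral)
    also have "\<dots> \<le> \<beta> / (real n * x^3)"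
    proof (rule divide_right_mono)
      have "\<beta>\<^sup>2 * real n \<le> \<beta> * (real n)\<^sup>2"
        unfolding power2_eq_square mult.assoc using b0 b1 n by (intro mult_left_mono mult_mono) auto
      then have "x^6 \<le> \<beta> * (real n)\<^sup>2" using lyapunov_squared by linarith
      then show "x^6 / (real n)\<^sup>2 \<le> \<beta>" using n by (simp add: field_simps)
    qed (use nx in simp)
    finally show ?thesis .
  qed
  have g3: "(sqrt tvar)^3 \<le> 3 * \<beta> / (real n * x^3)"
  proof -
    have s2: "sqrt 2 \<le> 3 / 2" by (rule real_le_lsqrt) (auto simp: power2_eq_square)
    have "(sqrt tvar)^3 \<le> (sqrt (2 / real n))^3" using tvar by (intro power_mono real_sqrt_le_mono) auto
    also have "\<dots> = 2 / real n * (sqrt 2 / sqrt (real n))"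
      using n by (simp add: power3_eq_cube real_sqrt_divide)
    also have "\<dots> \<le> 2 / real n * ((3 / 2) * (\<beta> / x^3))"
    proof (intro mult_left_mono)
      have "1 / sqrt (real n) \<le> \<beta> / x^3"
        using lyapunov x_pos n by (simp add: field_simps)
      then have "sqrt 2 * (1 / sqrt (real n)) \<le> (3 / 2) * (\<beta> / x^3)"
        using s2 by (intro mult_mono) auto
      then show "sqrt 2 / sqrt (real n) \<le> (3 / 2) * (\<beta> / x^3)" by simp
    qed (use n in auto)
    finally show ?thesis by simp
  qed
  have "step_err \<le> 40 * \<beta> / (real n * x^3) + 4 * (\<beta> / (real n * x^3)) + 8 * (3 * \<beta> / (real n * x^3))"
    unfolding step_err_def using g1 g2 g3 by linarith
  also have "\<dots> = 68 * \<beta> / (real n * x^3)" by (simp add: add_divide_distrib[symmetric])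
  finally show "step_err \<le> 68 * \<beta> / (real n * x^3)" .
qed

text \<open>On the event the constant times the weighted \<open>gexp\<close> is at least 1: undoing the tilt leaves
  \<open>exp (- x * u)\<close> with \<open>u \<ge> - \<zeta> / (2 * x)\<close>, which \<open>gexp\<close> shifted by \<open>\<zeta> / x\<close> dominates up to a factor near 1.\<close>

lemma tilt_event_bound:
  assumes "0 < h" "0 < tvar" "0 < tmass" "0 < \<zeta>" "0 < \<eta>" "h = \<eta> / x"
  shows "measure P {w \<in> space P. x\<^sup>2 / 2 - \<zeta> / 2 \<le> (\<Sum>i<n. tilt (w i))}
    \<le> exp (- x\<^sup>2 / 2) * (exp \<zeta> / Phi (\<zeta> / 2 / \<eta> - \<eta>)) * (tmass^n *
      (gexp x (sqrt (h\<^sup>2 + real n * tvar)) (\<zeta> / x - x / 2 + real n * tmean)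
        + (\<Sum>l<n. 2 / (sqrt (h\<^sup>2 + real l * tvar))^3 * step_err)))"
proof -
  let ?A = "{w \<in> space P. x\<^sup>2 / 2 - \<zeta> / 2 \<le> (\<Sum>i<n. tilt (w i))}"
  let ?c = "exp (- x\<^sup>2 / 2) * (exp \<zeta> / Phi (\<zeta> / 2 / \<eta> - \<eta>))"
  let ?F = "\<lambda>w. (\<Prod>i<n. exp (tilt (w i))) * gexp x (sqrt (h\<^sup>2 + real 0 * tvar)) (\<zeta> / x - x / 2 + (\<Sum>i<n. tilt (w i)) / x)"
  let ?R = "tmass^n * (gexp x (sqrt (h\<^sup>2 + real n * tvar)) (\<zeta> / x - x / 2 + real n * tmean)
        + (\<Sum>l<n. 2 / (sqrt (h\<^sup>2 + real l * tvar))^3 * step_err))"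
  have c: "0 \<le> ?c" by simp
  have A: "?A \<in> sets P"
    by (intro borel_measurable_le borel_measurable_const measurable_sum_P borel_measurable_tilt)
  have "1 \<le> ?c * ?F w" if "w \<in> ?A" for w
  proof -
    define Y where "Y = (\<Sum>i<n. tilt (w i))"
    define a where "a = \<zeta> / x - x / 2 + Y / x"
    have Y: "x\<^sup>2 / 2 - \<zeta> / 2 \<le> Y" using that by (simp add: Y_def)
    have xa: "x * a = \<zeta> - x\<^sup>2 / 2 + Y" using x_pos by (simp add: a_def field_simps power2_eq_square)
    then have "\<zeta> / 2 \<le> x * a" using Y by simp
    \<comment> \<open>With \<open>h = \<eta> / x\<close> one has
      \<open>a / h = x * a / \<eta>\<close> and \<open>x * h = \<eta>\<close>, so the lower bound on
      the \<open>Phi\<close> factor of \<open>gexp\<close> is the same for all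
      \<open>x\<close>.\<close>
    then have "\<zeta> / 2 / \<eta> \<le> x * a / \<eta>" using assms by (intro divide_right_mono) auto
    also have "\<dots> = a / h" using assms x_pos by simp
    finally have "\<zeta> / 2 / \<eta> \<le> a / h" .
    then have "Phi (\<zeta> / 2 / \<eta> - \<eta>) \<le> Phi (a / h - x * h)"
      using assms x_pos by (intro Phi_mono) auto
    moreover have "exp (- (x * a)) \<le> exp (- x * a + x\<^sup>2 * h\<^sup>2 / 2)" by simp
    ultimately have "exp (- (x * a)) * Phi (\<zeta> / 2 / \<eta> - \<eta>) \<le> gexp x h a"
      unfolding gexp_def by (intro mult_mono) auto
    then have "?c * (exp Y * (exp (- (x * a)) * Phi (\<zeta> / 2 / \<eta> - \<eta>))) \<le> ?c * (exp Y * gexp x h a)"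
      by (intro mult_left_mono) auto
    also have "?c * (exp Y * (exp (- (x * a)) * Phi (\<zeta> / 2 / \<eta> - \<eta>)))
        = exp (- x\<^sup>2 / 2) * exp \<zeta> * exp Y * exp (- (x * a))"
      using Phi_pos[of "\<zeta> / 2 / \<eta> - \<eta>"] by (simp del: Phi_pos)
    also have "\<dots> = 1" unfolding xa by (simp add: exp_add[symmetric])
    finally show ?thesis
      using assms(1) by (simp add: a_def Y_def exp_sum)
  qed
  then have "emeasure P ?A \<le> (\<integral>\<^sup>+w. ennreal (?c * ?F w) \<partial>P)"
    unfolding nn_integral_indicator[OF A, symmetric]
    by (intro nn_integral_mono) (auto simp: indicator_def intro!: order_trans[OF _ ennreal_leI])
  also have "\<dots> = ennreal ?c * (\<integral>\<^sup>+w. ennreal (?F w) \<partial>P)"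
    unfolding ennreal_mult'[OF c] by (rule nn_integral_cmult) measurable
  also have "\<dots> \<le> ennreal ?c * ennreal ?R"
    using lindeberg[OF assms(1-3), where k=n and j=0 and a="\<zeta> / x - x / 2"] by (intro mult_left_mono) auto
  also have "\<dots> = ennreal (?c * ?R)" using c by (simp only: ennreal_mult')
  finally have "ennreal (measure P ?A) \<le> ennreal (?c * ?R)" by (simp only: P.emeasure_eq_measure)
  moreover have "0 \<le> ?c * ?R"
    using step_err_nonneg[OF assms(3,2)] assms(1-3)
    by (intro mult_nonneg_nonneg add_nonneg_nonneg sum_nonneg) (auto intro!: divide_nonneg_nonneg zero_le_power)
  ultimately show ?thesis by (simp only: ennreal_le_iff)
qed

text \<open>\<open>c * x\<close> is a lower bound for the argument
  \<open>x * \<sigma> - a / \<sigma>\<close> of the final \<open>mills\<close> value, from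
  \<open>\<sigma> \<ge> sqrt (1 - K * \<beta>)\<close> and
  \<open>a \<le> (\<zeta> + 63 * \<beta>) / x\<close>. The replacement errors add up to order
  \<open>\<beta> / (\<eta>\<^sup>2 * x)\<close> and become relative through
  \<open>c0 * mills c0\<close>.\<close>

lemma tilt_event_estimate:
  assumes c0: "0 < c0" "c0 \<le> x"
    and K: "K = 164 / c0\<^sup>2 + 1 / c0^4"
    and b: "\<beta> \<le> 1 / 42" "126 * \<beta> \<le> c0\<^sup>2" "2 * K * \<beta> \<le> 1" "\<beta> \<le> \<eta>\<^sup>2 * c0^4"
    and pos: "0 < \<zeta>" "0 < \<eta>"
    and c: "c = sqrt (1 - K * \<beta>) - (\<zeta> + 63 * \<beta>) / (c0\<^sup>2 * sqrt (1 - K * \<beta>))" "0 < c"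
  shows "measure P {w \<in> space P. x\<^sup>2 / 2 - \<zeta> / 2 \<le> (\<Sum>i<n. tilt (w i))}
    \<le> Phi (- x) * (exp \<zeta> / Phi (\<zeta> / 2 / \<eta> - \<eta>) * exp (21 * \<beta>) * (1 / c + 408 * \<beta> / (\<eta>\<^sup>2 * (c0 * mills c0))))"
proof -
  note tp = tilted_parameters[OF c0 K b(1-3)]
  have n: "0 < real n" "1 \<le> real n" using n_pos by auto
  have b0: "0 < \<beta>" by (rule beta_pos)
  have mw0: "0 < tmass" using tp(1) by simp
  have nv: "1 - K * \<beta> \<le> real n * tvar" "1 / 2 \<le> real n * tvar" using tp(4) b(3) by linarith+
  then have vv2: "1 / (2 * real n) \<le> tvar" using n by (simp add: field_simps)
  have "0 < 1 / (2 * real n)" using n by simp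
  then have tvar: "0 < tvar" "1 / (2 * real n) \<le> tvar"
    using vv2 by linarith+
  define h where "h = \<eta> / x"
  have h0: "0 < h" using pos x_pos by (simp add: h_def)
  \<comment> \<open>The smoothing is no finer than a single step, so \<open>h\<^sup>2\<close> can
    stand in for one more variance term: \<open>l\<close> becomes \<open>l + 1\<close> below, which
    keeps the term \<open>l = 0\<close> finite.\<close>
  have h2: "1 / (2 * real n) \<le> h\<^sup>2"
  proof -
    have "x\<^sup>2 / real n \<le> \<eta>\<^sup>2"
      using tp(5) b(4) c0 by (intro order_trans[OF tp(5)]) (simp add: field_simps)
    then have "1 / real n \<le> h\<^sup>2" using x_pos n by (simp add: h_def field_simps)
    moreover have "1 / (2 * real n) \<le> 1 / real n" using n by (simp add: field_simps)
    ultimately show ?thesis by linarith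
  qed
  have gap0: "0 \<le> step_err" by (rule step_err_nonneg[OF mw0 tvar(1)])
  have sum: "(\<Sum>l<n. 2 / (sqrt (h\<^sup>2 + real l * tvar))^3 * step_err) \<le> 408 * \<beta> / \<eta>\<^sup>2 * (1 / x)"
  proof -
    \<comment> \<open>Of the three factors of \<open>?s^3\<close>, two are bounded below by
      \<open>h\<close> and one by the growing variance, which leaves a sum of inverse square
      roots.\<close>
    have "2 / (sqrt (h\<^sup>2 + real l * tvar))^3 * step_err \<le> 2 * sqrt (2 * real n) / h\<^sup>2 * step_err * (1 / sqrt (real (Suc l)))" for l
    proof -
      let ?s = "sqrt (h\<^sup>2 + real l * tvar)"
      have s0: "0 \<le> h\<^sup>2 + real l * tvar" using tvar by simp
      have "real (Suc l) / (2 * real n) = 1 / (2 * real n) + real l * (1 / (2 * real n))"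
        by (simp add: add_divide_distrib)
      also have "\<dots> \<le> h\<^sup>2 + real l * tvar"
        using h2 tvar by (intro add_mono mult_left_mono) auto
      finally have "sqrt (real (Suc l) / (2 * real n)) \<le> ?s" by (rule real_sqrt_le_mono)
      moreover have "h\<^sup>2 \<le> ?s\<^sup>2" using s0 tvar by simp
      ultimately have "h\<^sup>2 * sqrt (real (Suc l) / (2 * real n)) \<le> ?s\<^sup>2 * ?s"
        by (intro mult_mono) auto
      then have "h\<^sup>2 * sqrt (real (Suc l) / (2 * real n)) \<le> ?s^3"
        by (simp only: power3_eq_cube power2_eq_square)
      then have "2 / ?s^3 \<le> 2 / (h\<^sup>2 * sqrt (real (Suc l) / (2 * real n)))"
        using h0 n by (intro divide_left_mono) (auto intro!: mult_pos_pos zero_less_power add_pos_nonneg simp: tvar less_imp_le)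
      also have "\<dots> = 2 * sqrt (2 * real n) / h\<^sup>2 * (1 / sqrt (real (Suc l)))"
        by (simp add: real_sqrt_divide)
      finally show ?thesis
        using mult_right_mono[OF _ gap0] by (fastforce simp: mult_ac)
    qed
    then have "(\<Sum>l<n. 2 / (sqrt (h\<^sup>2 + real l * tvar))^3 * step_err)
      \<le> (\<Sum>l<n. 2 * sqrt (2 * real n) / h\<^sup>2 * step_err * (1 / sqrt (real (Suc l))))"
      by (rule sum_mono)
    also have "\<dots> = 2 * sqrt (2 * real n) / h\<^sup>2 * step_err * (\<Sum>l<n. 1 / sqrt (real (Suc l)))"
      by (simp only: sum_distrib_left)
    also have "\<dots> \<le> 2 * sqrt (2 * real n) / h\<^sup>2 * step_err * (2 * sqrt (real n))"
      using gap0 by (intro mult_left_mono sum_inverse_sqrt_le mult_nonneg_nonneg divide_nonneg_nonneg) auto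
    also have "\<dots> = 4 * sqrt 2 * real n / h\<^sup>2 * step_err"
      by (simp add: real_sqrt_mult)
    also have "\<dots> \<le> 6 * real n / h\<^sup>2 * (68 * \<beta> / (real n * x^3))"
    proof (intro mult_mono divide_right_mono)
      have "sqrt 2 \<le> 3 / 2" by (rule real_le_lsqrt) (auto simp: power2_eq_square)
      then show "4 * sqrt 2 \<le> 6" by simp
    qed (use gap0 tp(6) in auto)
    also have "\<dots> = 408 * \<beta> / \<eta>\<^sup>2 * (1 / x)"
      using n x_pos pos by (simp add: h_def field_simps eval_nat_numeral)
    finally show ?thesis .
  qed
  define \<sigma> where "\<sigma> = sqrt (h\<^sup>2 + real n * tvar)"
  define a where "a = \<zeta> / x - x / 2 + real n * tmean"
  define s0 where "s0 = sqrt (1 - K * \<beta>)"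
  have s0: "0 < s0" using b(3) by (simp add: s0_def)
  have s01: "s0 \<le> 1"
  proof -
    have "0 \<le> K * \<beta>" using b0 c0 by (simp add: K)
    then show ?thesis by (simp add: s0_def)
  qed
  have \<sigma>s: "s0 \<le> \<sigma>"
    unfolding s0_def \<sigma>_def using nv zero_le_power2[of h] by (intro real_sqrt_le_mono) linarith
  have \<sigma>0: "0 < \<sigma>" using s0 \<sigma>s by simp
  have a: "a \<le> (\<zeta> + 63 * \<beta>) / x"
    using tp(3) unfolding a_def add_divide_distrib by linarith
  have "a / \<sigma> \<le> (\<zeta> + 63 * \<beta>) / x / \<sigma>" using a \<sigma>0 by (intro divide_right_mono) auto
  also have "\<dots> \<le> (\<zeta> + 63 * \<beta>) / x / s0"
    using \<sigma>s s0 b0 pos x_pos by (intro divide_left_mono) auto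
  also have "\<dots> \<le> x * ((\<zeta> + 63 * \<beta>) / (c0\<^sup>2 * s0))"
  proof -
    have "c0\<^sup>2 \<le> x\<^sup>2" using c0 by (intro power_mono) auto
    then have "c0\<^sup>2 * ((\<zeta> + 63 * \<beta>) * s0) \<le> x\<^sup>2 * ((\<zeta> + 63 * \<beta>) * s0)"
      using b0 pos s0 by (intro mult_right_mono) auto
    then show ?thesis using c0 x_pos s0 by (simp add: field_simps power2_eq_square)
  qed
  finally have aS: "a / \<sigma> \<le> x * ((\<zeta> + 63 * \<beta>) / (c0\<^sup>2 * s0))" .
  have "x * s0 \<le> x * \<sigma>" using \<sigma>s x_pos by simp
  then have y: "c * x \<le> x * \<sigma> - a / \<sigma>"
    using aS unfolding c(1) s0_def[symmetric] mult.commute[of _ x] right_diff_distrib by linarith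
  have c1: "c \<le> 1"
    using s01 s0 b0 pos c0 unfolding c(1) s0_def[symmetric] by (smt (verit) divide_pos_pos mult_pos_pos zero_less_power)
  have "gexp x \<sigma> a \<le> mills (x * \<sigma> - a / \<sigma>)"
    unfolding gexp_eq_mills[OF \<sigma>0] using less_imp_le[OF mills_pos] by (intro mult_left_le_one_le) auto
  also have "\<dots> \<le> mills (c * x)" using y c(2) x_pos by (intro mills_antimono) auto
  also have "\<dots> \<le> mills x / c" using x_pos c(2) c1 by (rule mills_scale)
  finally have gexp: "gexp x \<sigma> a \<le> mills x / c" .
  have x1: "1 / x \<le> mills x / (c0 * mills c0)"
    using mult_mills_mono[OF c0] c0 x_pos by (simp add: field_simps)
  have "408 * \<beta> / \<eta>\<^sup>2 * (1 / x) \<le> 408 * \<beta> / \<eta>\<^sup>2 * (mills x / (c0 * mills c0))"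
    using b0 x1 by (intro mult_left_mono) auto
  also have "\<dots> = mills x * (408 * \<beta> / (\<eta>\<^sup>2 * (c0 * mills c0)))" by simp
  finally have "gexp x \<sigma> a + (\<Sum>l<n. 2 / (sqrt (h\<^sup>2 + real l * tvar))^3 * step_err)
      \<le> mills x * (1 / c + 408 * \<beta> / (\<eta>\<^sup>2 * (c0 * mills c0)))"
    using sum gexp by (simp add: distrib_left)
  then have "tmass^n * (gexp x \<sigma> a + (\<Sum>l<n. 2 / (sqrt (h\<^sup>2 + real l * tvar))^3 * step_err))
      \<le> exp (21 * \<beta>) * (mills x * (1 / c + 408 * \<beta> / (\<eta>\<^sup>2 * (c0 * mills c0))))"
    using tp(2) gap0 h0 tvar
    by (intro mult_mono add_nonneg_nonneg sum_nonneg) (auto intro!: divide_nonneg_nonneg zero_le_power)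
  then have "exp (- x\<^sup>2 / 2) * (exp \<zeta> / Phi (\<zeta> / 2 / \<eta> - \<eta>)) *
      (tmass^n * (gexp x \<sigma> a + (\<Sum>l<n. 2 / (sqrt (h\<^sup>2 + real l * tvar))^3 * step_err)))
    \<le> exp (- x\<^sup>2 / 2) * (exp \<zeta> / Phi (\<zeta> / 2 / \<eta> - \<eta>)) *
      (exp (21 * \<beta>) * (mills x * (1 / c + 408 * \<beta> / (\<eta>\<^sup>2 * (c0 * mills c0)))))"
    by (intro mult_left_mono) auto
  with tilt_event_bound[OF h0 tvar(1) mw0 pos h_def]
  show ?thesis
    unfolding Phi_minus_eq_mills \<sigma>_def[symmetric] a_def[symmetric]
    by (simp only: mult_ac)
qed

end

text \<open>The order of choices matters: \<open>\<zeta>\<close> brings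
  \<open>exp \<zeta> / (1 - \<zeta> / c0\<^sup>2)\<close> below \<open>1 + \<epsilon>\<close>, then
  \<open>\<eta>\<close> makes \<open>\<zeta> / 2 / \<eta> - \<eta>\<close> so large that the
  \<open>Phi\<close> in the denominator is near 1, and only then is \<open>\<beta>\<close> made
  small against both. The window \<open>\<delta>\<close> is \<open>sqrt \<zeta>\<close>.\<close>

lemma main_term:
  assumes "0 < \<epsilon>" "0 < c0"
  shows "\<exists>\<delta>>0. \<exists>\<eta>>0. \<forall>D n x \<beta>. small_array D n x \<beta> \<longrightarrow> c0 \<le> x \<longrightarrow> \<beta> \<le> \<eta> \<longrightarrow>
    measure (PiM {..<n} (\<lambda>_. D)) {w \<in> space (PiM {..<n} (\<lambda>_. D)).
      x\<^sup>2 / 2 - \<delta>\<^sup>2 / 2 \<le> (\<Sum>i<n. tilt (w i))} \<le> (1 + \<epsilon>) * Phi (- x)"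
proof -
  define K where "K = 164 / c0\<^sup>2 + 1 / c0^4"
  have "((\<lambda>\<zeta>. exp \<zeta> * (1 / (1 - \<zeta> / c0\<^sup>2))) \<longlongrightarrow> exp 0 * (1 / (1 - 0 / c0\<^sup>2))) (at_right 0)"
    using assms by (intro tendsto_intros) auto
  then have "eventually (\<lambda>\<zeta>. exp \<zeta> * (1 / (1 - \<zeta> / c0\<^sup>2)) < 1 + \<epsilon>) (at_right 0)"
    by (rule order_tendstoD) (use assms in simp)
  moreover have "eventually (\<lambda>\<zeta>::real. \<zeta> < c0\<^sup>2) (at_right 0)"
    using assms by (auto simp: eventually_at_right_field intro!: exI[of _ "c0\<^sup>2"])
  moreover have "eventually (\<lambda>\<zeta>::real. 0 < \<zeta>) (at_right 0)"
    by (rule eventually_at_right_less)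
  ultimately have "eventually (\<lambda>\<zeta>. 0 < \<zeta> \<and> \<zeta> < c0\<^sup>2 \<and> exp \<zeta> * (1 / (1 - \<zeta> / c0\<^sup>2)) < 1 + \<epsilon>) (at_right 0)"
    by eventually_elim auto
  then obtain \<zeta> where \<zeta>: "0 < \<zeta>" "\<zeta> < c0\<^sup>2" "exp \<zeta> * (1 / (1 - \<zeta> / c0\<^sup>2)) < 1 + \<epsilon>"
    using eventually_happens'[of "at_right (0::real)"] by auto
  have "filterlim (\<lambda>\<eta>. \<zeta> / 2 / \<eta> - \<eta>) at_top (at_right 0)"
    using \<zeta>(1) by real_asymp
  from filterlim_compose[OF Phi_tendsto_at_top this]
  have "((\<lambda>\<eta>. exp \<zeta> / Phi (\<zeta> / 2 / \<eta> - \<eta>) * (1 / (1 - \<zeta> / c0\<^sup>2))) \<longlongrightarrow> exp \<zeta> / 1 * (1 / (1 - \<zeta> / c0\<^sup>2))) (at_right 0)"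
    by (intro tendsto_intros) auto
  then have "eventually (\<lambda>\<eta>. exp \<zeta> / Phi (\<zeta> / 2 / \<eta> - \<eta>) * (1 / (1 - \<zeta> / c0\<^sup>2)) < 1 + \<epsilon>) (at_right 0)"
    by (rule order_tendstoD) (use \<zeta> in simp)
  moreover have "eventually (\<lambda>\<eta>::real. 0 < \<eta>) (at_right 0)"
    by (rule eventually_at_right_less)
  ultimately have "eventually (\<lambda>\<eta>. 0 < \<eta> \<and> exp \<zeta> / Phi (\<zeta> / 2 / \<eta> - \<eta>) * (1 / (1 - \<zeta> / c0\<^sup>2)) < 1 + \<epsilon>) (at_right 0)"
    by eventually_elim auto
  then obtain \<eta> where \<eta>: "0 < \<eta>" "exp \<zeta> / Phi (\<zeta> / 2 / \<eta> - \<eta>) * (1 / (1 - \<zeta> / c0\<^sup>2)) < 1 + \<epsilon>"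
    using eventually_happens'[of "at_right (0::real)"] by auto
  define A where "A = exp \<zeta> / Phi (\<zeta> / 2 / \<eta> - \<eta>)"
  define c where "c \<beta> = sqrt (1 - K * \<beta>) - (\<zeta> + 63 * \<beta>) / (c0\<^sup>2 * sqrt (1 - K * \<beta>))" for \<beta>
  have "(c \<longlongrightarrow> sqrt (1 - K * 0) - (\<zeta> + 63 * 0) / (c0\<^sup>2 * sqrt (1 - K * 0))) (at_right 0)"
    unfolding c_def[abs_def] using assms by (intro tendsto_intros) auto
  then have clim: "(c \<longlongrightarrow> 1 - \<zeta> / c0\<^sup>2) (at_right 0)" by simp
  have c0pos: "0 < 1 - \<zeta> / c0\<^sup>2" using \<zeta> assms by simp
  have "((\<lambda>\<beta>. A * exp (21 * \<beta>) * (1 / c \<beta> + 408 * \<beta> / (\<eta>\<^sup>2 * (c0 * mills c0))))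
      \<longlongrightarrow> A * exp (21 * 0) * (1 / (1 - \<zeta> / c0\<^sup>2) + 408 * 0 / (\<eta>\<^sup>2 * (c0 * mills c0)))) (at_right 0)"
    using c0pos assms \<eta> less_imp_neq[OF mills_pos] by (intro tendsto_intros clim) auto
  then have "eventually (\<lambda>\<beta>. A * exp (21 * \<beta>) * (1 / c \<beta> + 408 * \<beta> / (\<eta>\<^sup>2 * (c0 * mills c0))) < 1 + \<epsilon>) (at_right 0)"
    by (rule order_tendstoD) (use \<eta> in \<open>simp add: A_def\<close>)
  moreover have "eventually (\<lambda>\<beta>. 0 < c \<beta>) (at_right 0)"
    using clim c0pos by (rule order_tendstoD)
  moreover have "eventually (\<lambda>\<beta>. k * \<beta> \<le> d) (at_right 0)" if "0 < d" for k d :: real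
  proof -
    have "((\<lambda>\<beta>. k * \<beta>) \<longlongrightarrow> k * 0) (at_right 0)" by (intro tendsto_intros)
    from order_tendstoD(2)[OF this, of d] that show ?thesis
      by (auto elim: eventually_mono)
  qed
  note lin = this
  ultimately have "eventually (\<lambda>\<beta>. A * exp (21 * \<beta>) * (1 / c \<beta> + 408 * \<beta> / (\<eta>\<^sup>2 * (c0 * mills c0))) < 1 + \<epsilon>
      \<and> 0 < c \<beta> \<and> 1 * \<beta> \<le> 1 / 42 \<and> 126 * \<beta> \<le> c0\<^sup>2 \<and> 2 * K * \<beta> \<le> 1 \<and> 1 * \<beta> \<le> \<eta>\<^sup>2 * c0^4) (at_right 0)"
    using assms \<eta> by (intro eventually_conj lin) auto
  then obtain b where b: "0 < b" "\<And>\<beta>. 0 < \<beta> \<Longrightarrow> \<beta> < b \<Longrightarrow>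
      A * exp (21 * \<beta>) * (1 / c \<beta> + 408 * \<beta> / (\<eta>\<^sup>2 * (c0 * mills c0))) < 1 + \<epsilon>
      \<and> 0 < c \<beta> \<and> 1 * \<beta> \<le> 1 / 42 \<and> 126 * \<beta> \<le> c0\<^sup>2 \<and> 2 * K * \<beta> \<le> 1 \<and> 1 * \<beta> \<le> \<eta>\<^sup>2 * c0^4"
    unfolding eventually_at_right_field by auto
  show ?thesis
  proof (rule exI[of _ "sqrt \<zeta>"], intro exI[of _ "b / 2"] conjI allI impI)
    show "0 < sqrt \<zeta>" "0 < b / 2" using \<zeta> b by auto
    fix D n x \<beta>
    assume sa: "small_array D n x \<beta>" and x: "c0 \<le> x" and \<beta>: "\<beta> \<le> b / 2"
    interpret small_array D n x \<beta> by fact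
    have "\<beta> < b" using \<beta> b(1) by simp
    note B = b(2)[OF beta_pos this]
    have "measure P {w \<in> space P. x\<^sup>2 / 2 - \<zeta> / 2 \<le> (\<Sum>i<n. tilt (w i))}
      \<le> Phi (- x) * (A * exp (21 * \<beta>) * (1 / c \<beta> + 408 * \<beta> / (\<eta>\<^sup>2 * (c0 * mills c0))))"
      unfolding A_def
      by (rule tilt_event_estimate[OF assms(2) x K_def]) (use B \<zeta> \<eta> in \<open>auto simp: c_def\<close>)
    also have "\<dots> \<le> Phi (- x) * (1 + \<epsilon>)"
      using B by (intro mult_left_mono) auto
    finally show "measure P {w \<in> space P. x\<^sup>2 / 2 - (sqrt \<zeta>)\<^sup>2 / 2 \<le> (\<Sum>i<n. tilt (w i))} \<le> (1 + \<epsilon>) * Phi (- x)"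
      using \<zeta>(1) by (simp add: mult.commute)
  qed
qed

text \<open>The window \<open>\<delta>\<close> is dictated by \<open>main_term\<close>, and the
  tails are estimated for that \<open>\<delta>\<close>. The cut \<open>K\<close> comes from the
  large regime; the small regime accepts any \<open>K\<close>, so the two cover all
  \<open>x \<ge> c0\<close>.\<close>

theorem self_normalized_upper:
  assumes "0 < \<epsilon>" "0 < c0"
  shows "\<exists>\<eta>>0. \<forall>D n x \<beta>. small_array D n x \<beta> \<longrightarrow> c0 \<le> x \<longrightarrow> \<beta> \<le> \<eta> \<longrightarrow>
    measure (PiM {..<n} (\<lambda>_. D)) {v \<in> space (PiM {..<n} (\<lambda>_. D)).
      x * sqrt (\<Sum>i<n. (v i)\<^sup>2) \<le> (\<Sum>i<n. v i)} \<le> (1 + \<epsilon>) * Phi (- x)"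
proof -
  have e4: "0 < \<epsilon> / 4" using assms by simp
  obtain \<delta> \<eta>1 where \<delta>: "0 < \<delta>" and \<eta>1: "0 < \<eta>1"
    and main: "\<And>D n x \<beta>. small_array D n x \<beta> \<Longrightarrow> c0 \<le> x \<Longrightarrow> \<beta> \<le> \<eta>1 \<Longrightarrow>
      measure (PiM {..<n} (\<lambda>_. D)) {w \<in> space (PiM {..<n} (\<lambda>_. D)).
      x\<^sup>2 / 2 - \<delta>\<^sup>2 / 2 \<le> (\<Sum>i<n. tilt (w i))} \<le> (1 + \<epsilon> / 4) * Phi (- x)"
    using main_term[OF e4 assms(2)] by blast
  obtain \<eta>2 where \<eta>2: "0 < \<eta>2" and lower: "\<And>D n x \<beta>. small_array D n x \<beta> \<Longrightarrow> c0 \<le> x \<Longrightarrow> \<beta> \<le> \<eta>2 \<Longrightarrow>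
    measure (PiM {..<n} (\<lambda>_. D)) {v \<in> space (PiM {..<n} (\<lambda>_. D)).
      x * sqrt (\<Sum>i<n. (v i)\<^sup>2) \<le> (\<Sum>i<n. v i) \<and> sqrt (\<Sum>i<n. (v i)\<^sup>2) \<le> x - \<delta>} \<le> \<epsilon> / 4 * Phi (- x)"
    using lower_tail[OF \<delta> e4 assms(2)] by blast
  obtain K \<eta>3 where K: "0 < K" and \<eta>3: "0 < \<eta>3"
    and large: "\<And>D n x \<beta>. small_array D n x \<beta> \<Longrightarrow> c0 \<le> x \<Longrightarrow> K \<le> x \<Longrightarrow> \<beta> \<le> \<eta>3 \<Longrightarrow>
    measure (PiM {..<n} (\<lambda>_. D)) {v \<in> space (PiM {..<n} (\<lambda>_. D)).
      x * sqrt (\<Sum>i<n. (v i)\<^sup>2) \<le> (\<Sum>i<n. v i) \<and> x + \<delta> \<le> sqrt (\<Sum>i<n. (v i)\<^sup>2)} \<le> \<epsilon> / 4 * Phi (- x)"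
    using upper_tail_large[OF \<delta> e4 assms(2)] by blast
  obtain \<eta>4 where \<eta>4: "0 < \<eta>4"
    and small: "\<And>D n x \<beta>. small_array D n x \<beta> \<Longrightarrow> c0 \<le> x \<Longrightarrow> x \<le> K \<Longrightarrow> \<beta> \<le> \<eta>4 \<Longrightarrow>
    measure (PiM {..<n} (\<lambda>_. D)) {v \<in> space (PiM {..<n} (\<lambda>_. D)).
      x + \<delta> \<le> sqrt (\<Sum>i<n. (v i)\<^sup>2)} \<le> \<epsilon> / 4 * Phi (- x)"
    using upper_tail_small[OF \<delta> e4 assms(2)] by blast
  show ?thesis
  proof (intro exI[of _ "min (min \<eta>1 \<eta>2) (min \<eta>3 \<eta>4)"] conjI allI impI)
    show "0 < min (min \<eta>1 \<eta>2) (min \<eta>3 \<eta>4)" using \<eta>1 \<eta>2 \<eta>3 \<eta>4 by simp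
    fix D n x \<beta>
    assume sa: "small_array D n x \<beta>" and x: "c0 \<le> x" and \<beta>: "\<beta> \<le> min (min \<eta>1 \<eta>2) (min \<eta>3 \<eta>4)"
    interpret small_array D n x \<beta> by fact
    let ?r = "\<lambda>v. sqrt (\<Sum>i<n. (v i)\<^sup>2)"
    let ?A = "{v \<in> space P. x * ?r v \<le> (\<Sum>i<n. v i)}"
    let ?M = "{w \<in> space P. x\<^sup>2 / 2 - \<delta>\<^sup>2 / 2 \<le> (\<Sum>i<n. tilt (w i))}"
    let ?L = "{v \<in> space P. x * ?r v \<le> (\<Sum>i<n. v i) \<and> ?r v \<le> x - \<delta>}"
    let ?U = "{v \<in> space P. x * ?r v \<le> (\<Sum>i<n. v i) \<and> x + \<delta> \<le> ?r v}"
    let ?U' = "{v \<in> space P. x + \<delta> \<le> ?r v}"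
    have M: "?M \<in> sets P"
      by (intro borel_measurable_le borel_measurable_const measurable_sum_P borel_measurable_tilt)
    have L: "?L \<in> sets P" and U: "?U \<in> sets P" and U': "?U' \<in> sets P"
      by (intro sets_Collect_le_P)+
    have U_le: "measure P ?U \<le> \<epsilon> / 4 * Phi (- x)"
    proof (cases "K \<le> x")
      case True
      then show ?thesis using large[OF sa x] \<beta> by simp
    next
      case False
      have "measure P ?U \<le> measure P ?U'"
        using U' by (intro P.finite_measure_mono) auto
      then show ?thesis using small[OF sa x] False \<beta> by simp
    qed
    have sub: "?A \<subseteq> ?M \<union> (?L \<union> ?U)"
    proof
      fix v assume v: "v \<in> ?A"
      show "v \<in> ?M \<union> (?L \<union> ?U)"
      proof (cases "v \<in> ?L \<union> ?U")
        case False
        then have d: "\<bar>?r v - x\<bar> \<le> \<delta>" using v by auto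
        have r2: "(?r v)\<^sup>2 = (\<Sum>i<n. (v i)\<^sup>2)" by (simp add: sum_nonneg)
        have "\<bar>?r v - x\<bar>\<^sup>2 \<le> \<delta>\<^sup>2" using d by (intro power_mono) auto
        then have "x\<^sup>2 / 2 - \<delta>\<^sup>2 / 2 \<le> x * ?r v - (?r v)\<^sup>2 / 2"
          unfolding power2_abs power2_diff by (simp add: field_simps)
        also have "\<dots> \<le> (\<Sum>i<n. v i) - (?r v)\<^sup>2 / 2" using v by simp
        also have "\<dots> = (\<Sum>i<n. tilt (v i))"
          unfolding r2 by (simp add: tilt_def sum_subtractf sum_divide_distrib)
        finally show ?thesis using v by auto
      qed auto
    qed
    have "measure P ?A \<le> measure P (?M \<union> (?L \<union> ?U))"
      using M L U by (intro P.finite_measure_mono[OF sub]) auto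
    also have "\<dots> \<le> measure P ?M + measure P (?L \<union> ?U)"
      using M L U by (intro measure_Un_le) auto
    also have "measure P (?L \<union> ?U) \<le> measure P ?L + measure P ?U"
      using L U by (intro measure_Un_le) auto
    also have "measure P ?M + (measure P ?L + measure P ?U)
      \<le> (1 + \<epsilon> / 4) * Phi (- x) + (\<epsilon> / 4 * Phi (- x) + \<epsilon> / 4 * Phi (- x))"
      using main[OF sa x] lower[OF sa x] U_le \<beta> by (intro add_mono) auto
    also have "\<dots> = (1 + 3 * \<epsilon> / 4) * Phi (- x)" by (simp add: algebra_simps)
    also have "\<dots> \<le> (1 + \<epsilon>) * Phi (- x)"
      using assms by (intro mult_right_mono) auto
    finally show "measure P ?A \<le> (1 + \<epsilon>) * Phi (- x)" by simp
  qed
qed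

section \<open>Truncated means\<close>

text \<open>The event is invariant under positive rescaling, so \<open>b\<close> can be chosen to
  normalize the second moment; the two smallness hypotheses are then the cubic and the drift
  condition with \<open>\<beta> = \<eta>\<close>. The sign \<open>sg\<close> yields both tails, and
  \<open>\<eta>\<close> precedes \<open>M\<close> because the space will change with
  \<open>n\<close>.\<close>

lemma self_normalized_iid_upper:
  assumes "0 < \<epsilon>" "0 < c0"
  shows "\<exists>\<eta>>0. \<forall>M n x X sg. prob_space M \<longrightarrow> 0 < n \<longrightarrow> c0 \<le> x \<longrightarrow> \<bar>sg\<bar> = 1 \<longrightarrow>
    prob_space.indep_vars M (\<lambda>_. borel) X {..<n} \<longrightarrow>
    (\<forall>i<n. distr M borel (X i) = distr M borel (X 0)) \<longrightarrow>
    integrable M (\<lambda>\<omega>. \<bar>X 0 \<omega>\<bar>^3) \<longrightarrow> 0 < (\<integral>\<omega>. (X 0 \<omega>)\<^sup>2 \<partial>M) \<longrightarrow>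
    x^3 / sqrt (real n) * ((\<integral>\<omega>. \<bar>X 0 \<omega>\<bar>^3 \<partial>M) / (sqrt (\<integral>\<omega>. (X 0 \<omega>)\<^sup>2 \<partial>M))^3) \<le> \<eta> \<longrightarrow>
    sqrt (real n) * x * (\<bar>\<integral>\<omega>. X 0 \<omega> \<partial>M\<bar> / sqrt (\<integral>\<omega>. (X 0 \<omega>)\<^sup>2 \<partial>M)) \<le> \<eta> \<longrightarrow>
    measure M {\<omega> \<in> space M. x * sqrt (\<Sum>i<n. (X i \<omega>)\<^sup>2) \<le> sg * (\<Sum>i<n. X i \<omega>)} \<le> (1 + \<epsilon>) * Phi (- x)"
proof -
  obtain \<eta> where \<eta>: "0 < \<eta>" and main: "\<And>D n x \<beta>. small_array D n x \<beta> \<Longrightarrow> c0 \<le> x \<Longrightarrow> \<beta> \<le> \<eta> \<Longrightarrow>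
    measure (PiM {..<n} (\<lambda>_. D)) {v \<in> space (PiM {..<n} (\<lambda>_. D)).
      x * sqrt (\<Sum>i<n. (v i)\<^sup>2) \<le> (\<Sum>i<n. v i)} \<le> (1 + \<epsilon>) * Phi (- x)"
    using self_normalized_upper[OF assms] by blast
  show ?thesis
  proof (intro exI[of _ \<eta>] conjI allI impI)
    show "0 < \<eta>" by fact
    fix M :: "'a measure" and n :: nat and x sg :: real and X :: "nat \<Rightarrow> 'a \<Rightarrow> real"
    define \<sigma> where "\<sigma> = sqrt (\<integral>\<omega>. (X 0 \<omega>)\<^sup>2 \<partial>M)"
    assume M: "prob_space M" and n: "0 < n" and x: "c0 \<le> x" and sg: "\<bar>sg\<bar> = 1"
      and ind: "prob_space.indep_vars M (\<lambda>_. borel) X {..<n}"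
      and ident: "\<forall>i<n. distr M borel (X i) = distr M borel (X 0)"
      and i3: "integrable M (\<lambda>\<omega>. \<bar>X 0 \<omega>\<bar>^3)" and pos: "0 < (\<integral>\<omega>. (X 0 \<omega>)\<^sup>2 \<partial>M)"
      and L3: "x^3 / sqrt (real n) * ((\<integral>\<omega>. \<bar>X 0 \<omega>\<bar>^3 \<partial>M) / (sqrt (\<integral>\<omega>. (X 0 \<omega>)\<^sup>2 \<partial>M))^3) \<le> \<eta>"
      and L1: "sqrt (real n) * x * (\<bar>\<integral>\<omega>. X 0 \<omega> \<partial>M\<bar> / sqrt (\<integral>\<omega>. (X 0 \<omega>)\<^sup>2 \<partial>M)) \<le> \<eta>"
    interpret prob_space M by fact
    have x0: "0 < x" using x assms by simp
    have \<sigma>: "0 < \<sigma>" "\<sigma>\<^sup>2 = (\<integral>\<omega>. (X 0 \<omega>)\<^sup>2 \<partial>M)" using pos by (auto simp: \<sigma>_def)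
    have Xm [measurable]: "X i \<in> borel_measurable M" if "i < n" for i
      using ind that unfolding indep_vars_def by auto
    have X0m [measurable]: "X 0 \<in> borel_measurable M" using Xm n by simp
    define b where "b = x / (sqrt (real n) * \<sigma>)"
    have b: "0 < b" using x0 n \<sigma> by (simp add: b_def)
    define D where "D = distr M borel (\<lambda>\<omega>. sg * b * X 0 \<omega>)"
    have sg2: "sg\<^sup>2 = 1" using sg by (metis one_power2 power2_abs)
    have D: "distr M borel (\<lambda>\<omega>. sg * b * X i \<omega>) = D" if "i < n" for i
    proof -
      have "distr M borel (\<lambda>\<omega>. sg * b * X i \<omega>) = distr (distr M borel (X i)) borel (\<lambda>y. sg * b * y)"
        using that by (subst distr_distr) (auto simp: comp_def)
      also have "\<dots> = distr (distr M borel (X 0)) borel (\<lambda>y. sg * b * y)"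
        by (simp only: ident[rule_format, OF that])
      also have "\<dots> = D"
        unfolding D_def by (subst distr_distr) (auto simp: comp_def)
      finally show ?thesis .
    qed
    have nb: "real n * b\<^sup>2 * \<sigma>\<^sup>2 = x\<^sup>2" "real n * b^3 = x^3 / sqrt (real n) * (1 / \<sigma>^3)"
      "real n * b = sqrt (real n) * x / \<sigma>"
    proof -
      define r where "r = sqrt (real n)"
      have r: "0 < r" "real n = r\<^sup>2" using n by (auto simp: r_def)
      show "real n * b\<^sup>2 * \<sigma>\<^sup>2 = x\<^sup>2" "real n * b^3 = x^3 / sqrt (real n) * (1 / \<sigma>^3)"
        "real n * b = sqrt (real n) * x / \<sigma>"
        unfolding b_def r_def[symmetric] using \<sigma>(1) r(1)
        by (simp_all add: r(2) field_simps power2_eq_square power3_eq_cube)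
    qed
    have sa: "small_array D n x \<eta>"
    proof (rule small_array.intro)
      show "prob_space D" unfolding D_def by (rule prob_space_distr) simp
      show "sets D = sets borel" by (simp add: D_def)
      show "integrable D (\<lambda>s. \<bar>s\<bar>^3)"
        unfolding D_def using i3 by (subst integrable_distr_eq) (auto simp: abs_mult power_mult_distrib)
      have "real n * (\<integral>s. s\<^sup>2 \<partial>D) = real n * b\<^sup>2 * \<sigma>\<^sup>2"
        unfolding D_def \<sigma>(2) by (subst integral_distr) (auto simp: power_mult_distrib sg2)
      then show "real n * (\<integral>s. s\<^sup>2 \<partial>D) = x\<^sup>2" using nb(1) by simp
      have "real n * (\<integral>s. \<bar>s\<bar>^3 \<partial>D) = real n * b^3 * (\<integral>\<omega>. \<bar>X 0 \<omega>\<bar>^3 \<partial>M)"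
        unfolding D_def using b by (subst integral_distr) (auto simp: abs_mult power_mult_distrib sg)
      also have "\<dots> = x^3 / sqrt (real n) * ((\<integral>\<omega>. \<bar>X 0 \<omega>\<bar>^3 \<partial>M) / \<sigma>^3)"
        unfolding nb(2) by simp
      finally show "real n * (\<integral>s. \<bar>s\<bar>^3 \<partial>D) \<le> \<eta>" using L3 by (simp add: \<sigma>_def)
      have "real n * \<bar>\<integral>s. s \<partial>D\<bar> = real n * b * \<bar>\<integral>\<omega>. X 0 \<omega> \<partial>M\<bar>"
        unfolding D_def using b by (subst integral_distr) (auto simp: abs_mult sg)
      also have "\<dots> = sqrt (real n) * x * (\<bar>\<integral>\<omega>. X 0 \<omega> \<partial>M\<bar> / \<sigma>)"
        unfolding nb(3) by simp
      finally show "real n * \<bar>\<integral>s. s \<partial>D\<bar> \<le> \<eta>" using L1 by (simp add: \<sigma>_def)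
    qed (use n x0 in auto)
    interpret sa: small_array D n x \<eta> by fact
    let ?Y = "\<lambda>\<omega>. \<lambda>i\<in>{..<n}. sg * b * X i \<omega>"
    let ?A = "{v \<in> space sa.P. x * sqrt (\<Sum>i<n. (v i)\<^sup>2) \<le> (\<Sum>i<n. v i)}"
    have sP: "sets sa.P = sets (PiM {..<n} (\<lambda>_. borel :: real measure))"
      by (intro sets_PiM_cong) (auto simp: sa.sets_D)
    have "indep_vars (\<lambda>_. borel) (\<lambda>i \<omega>. sg * b * X i \<omega>) {..<n}"
      by (rule indep_vars_compose2[OF ind]) simp
    moreover have rv: "random_variable borel (\<lambda>\<omega>. sg * b * X i \<omega>)" if "i \<in> {..<n}" for i
      using that by simp
    \<comment> \<open>Independence identifies the joint law of the scaled variables with the product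
      of their laws; each factor is then \<open>D\<close>.\<close>
    ultimately have "distr M (PiM {..<n} (\<lambda>_. borel)) ?Y = PiM {..<n} (\<lambda>i. distr M borel (\<lambda>\<omega>. sg * b * X i \<omega>))"
      using n by (subst (asm) indep_vars_iff_distr_eq_PiM') auto
    also have "\<dots> = sa.P" by (intro PiM_cong) (auto simp: D)
    finally have dist: "distr M (PiM {..<n} (\<lambda>_. borel)) ?Y = sa.P" .
    have Ym: "?Y \<in> measurable M (PiM {..<n} (\<lambda>_. borel))"
      by (intro measurable_restrict rv)
    have A: "?A \<in> sets sa.P" by (intro sa.sets_Collect_le_P)
    have spP: "space sa.P = space (PiM {..<n} (\<lambda>_. borel :: real measure))"
      by (rule sets_eq_imp_space_eq[OF sP])
    have "measure sa.P ?A = measure (distr M (PiM {..<n} (\<lambda>_. borel)) ?Y) ?A" by (simp only: dist)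
    also have "\<dots> = measure M (?Y -` ?A \<inter> space M)"
      using A by (intro measure_distr Ym) (simp only: sP)
    also have "?Y -` ?A \<inter> space M = {\<omega> \<in> space M. x * sqrt (\<Sum>i<n. (X i \<omega>)\<^sup>2) \<le> sg * (\<Sum>i<n. X i \<omega>)}"
    proof -
      have "?Y \<omega> \<in> ?A \<longleftrightarrow> x * sqrt (\<Sum>i<n. (X i \<omega>)\<^sup>2) \<le> sg * (\<Sum>i<n. X i \<omega>)" if "\<omega> \<in> space M" for \<omega>
      proof -
        have "?Y \<omega> \<in> space sa.P" using measurable_space[OF Ym that] by (simp only: spP)
        moreover have "(\<Sum>i<n. (?Y \<omega> i)\<^sup>2) = b\<^sup>2 * (\<Sum>i<n. (X i \<omega>)\<^sup>2)"
          by (simp add: sum_distrib_left power_mult_distrib sg2)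
        moreover have "(\<Sum>i<n. ?Y \<omega> i) = b * (sg * (\<Sum>i<n. X i \<omega>))"
          by (simp add: sum_distrib_left mult_ac)
        ultimately show ?thesis
          using b by (simp add: real_sqrt_mult mult.left_commute[of x])
      qed
      then show ?thesis by blast
    qed
    finally show "measure M {\<omega> \<in> space M. x * sqrt (\<Sum>i<n. (X i \<omega>)\<^sup>2) \<le> sg * (\<Sum>i<n. X i \<omega>)} \<le> (1 + \<epsilon>) * Phi (- x)"
      using main[OF sa x order_refl] by simp
  qed
qed

section \<open>Bias and variance loss caused by truncation\<close>

lemma borel_measurable_trunc [measurable]: "trunc \<tau> \<in> borel_measurable borel"
  unfolding trunc_def[abs_def] by measurable

text \<open>Beyond \<tau> the change is at most \<open>\<bar>z\<bar>\<close>, and the factor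
  \<open>\<bar>z\<bar> / \<tau> > 1\<close> may be inserted once or twice. One factor serves the
  variance, two serve the bias.\<close>

lemma trunc_bounds:
  assumes "0 < \<tau>"
  shows "\<bar>trunc \<tau> z\<bar> \<le> \<bar>z\<bar>" "\<bar>trunc \<tau> z - z\<bar> \<le> z\<^sup>2 / \<tau>" "\<bar>trunc \<tau> z - z\<bar> \<le> \<bar>z\<bar>^3 / \<tau>\<^sup>2"
proof -
  show a: "\<bar>trunc \<tau> z\<bar> \<le> \<bar>z\<bar>" using assms by (auto simp: trunc_def)
  have "\<bar>trunc \<tau> z - z\<bar> \<le> z\<^sup>2 / \<tau> \<and> \<bar>trunc \<tau> z - z\<bar> \<le> \<bar>z\<bar>^3 / \<tau>\<^sup>2"
  proof (cases "\<bar>z\<bar> \<le> \<tau>")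
    case True
    then have "trunc \<tau> z = z" by (auto simp: trunc_def)
    then show ?thesis using assms by simp
  next
    case False
    then have d: "\<bar>trunc \<tau> z - z\<bar> \<le> \<bar>z\<bar>" using assms by (auto simp: trunc_def)
    have "\<tau> * \<bar>z\<bar> \<le> \<bar>z\<bar> * \<bar>z\<bar>" using False by (intro mult_right_mono) auto
    then have "\<bar>z\<bar> \<le> z\<^sup>2 / \<tau>" using assms by (simp add: field_simps power2_eq_square)
    moreover have "\<tau>\<^sup>2 * \<bar>z\<bar> \<le> \<bar>z\<bar>\<^sup>2 * \<bar>z\<bar>" using False assms by (intro mult_right_mono power_mono) auto
    then have "\<bar>z\<bar> \<le> \<bar>z\<bar>^3 / \<tau>\<^sup>2" using assms by (simp add: field_simps power2_eq_square power3_eq_cube)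
    ultimately show ?thesis using d by linarith
  qed
  then show "\<bar>trunc \<tau> z - z\<bar> \<le> z\<^sup>2 / \<tau>" "\<bar>trunc \<tau> z - z\<bar> \<le> \<bar>z\<bar>^3 / \<tau>\<^sup>2" by auto
qed

text \<open>The bias takes the cubic form of the truncation error, hence order
  \<open>1 / \<tau>\<^sup>2\<close>. In the second moment that error is multiplied by a factor
  linear in \<open>\<bar>W\<bar>\<close>, so only its quadratic form stays within third moments, at
  order \<open>1 / \<tau>\<close>. \<open>B\<close> bounds both \<open>\<bar>\<mu>\<bar>\<close> and
  the mean of \<open>1 + \<bar>W\<bar>^3\<close>.\<close>

lemma (in prob_space) truncated_moments:
  assumes [measurable]: "W \<in> borel_measurable M"
    and i3: "integrable M (\<lambda>\<omega>. \<bar>W \<omega>\<bar>^3)" and m3: "expectation (\<lambda>\<omega>. \<bar>W \<omega>\<bar>^3) \<le> C1"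
    and mean: "expectation W = \<mu>" and var: "C2 \<le> expectation (\<lambda>\<omega>. (W \<omega> - \<mu>)\<^sup>2)"
    and \<tau>: "0 < \<tau>" and B: "B = 1 + C1"
  defines "X \<equiv> \<lambda>\<omega>. trunc \<tau> (W \<omega>) - \<mu>"
  shows "integrable M (\<lambda>\<omega>. \<bar>X \<omega>\<bar>^3)" "expectation (\<lambda>\<omega>. \<bar>X \<omega>\<bar>^3) \<le> 4 * C1 + 4 * B^3"
    "\<bar>expectation X\<bar> \<le> C1 / \<tau>\<^sup>2" "C2 - 2 * (C1 + B\<^sup>2) / \<tau> \<le> expectation (\<lambda>\<omega>. (X \<omega>)\<^sup>2)"
proof -
  have int: "integrable M f" if [measurable]: "f \<in> borel_measurable M"
    and "\<And>\<omega>. \<bar>f \<omega>\<bar> \<le> c + d * \<bar>W \<omega>\<bar>^3" for f :: "'a \<Rightarrow> real" and c d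
  proof (rule Bochner_Integration.integrable_bound)
    show "integrable M (\<lambda>\<omega>. c + d * \<bar>W \<omega>\<bar>^3)" using i3 by auto
    show "AE \<omega> in M. norm (f \<omega>) \<le> norm (c + d * \<bar>W \<omega>\<bar>^3)"
      using that(2) by (auto intro!: AE_I2) (meson abs_ge_self order_trans)
  qed measurable
  have w: "\<bar>W \<omega>\<bar> \<le> 1 + \<bar>W \<omega>\<bar>^3" "(W \<omega>)\<^sup>2 \<le> 1 + \<bar>W \<omega>\<bar>^3" for \<omega>
    using power_le_one_plus_cube[of "\<bar>W \<omega>\<bar>" 1] power_le_one_plus_cube[of "\<bar>W \<omega>\<bar>" 2] by auto
  have i1: "integrable M W" by (rule int[of _ 1 1]) (use w in auto)
  have i2: "integrable M (\<lambda>\<omega>. (W \<omega>)\<^sup>2)" by (rule int[of _ 1 1]) (use w in auto)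
  have C1: "0 \<le> C1" by (rule order_trans[OF _ m3]) simp
  have E1: "expectation (\<lambda>\<omega>. 1 + \<bar>W \<omega>\<bar>^3) \<le> B" using i3 m3 by (simp add: B prob_space)
  have "\<bar>\<mu>\<bar> \<le> expectation (\<lambda>\<omega>. \<bar>W \<omega>\<bar>)" unfolding mean[symmetric] by (rule integral_abs_bound)
  also have "\<dots> \<le> expectation (\<lambda>\<omega>. 1 + \<bar>W \<omega>\<bar>^3)" using i1 i3 w by (intro integral_mono) auto
  finally have \<mu>: "\<bar>\<mu>\<bar> \<le> B" using E1 by simp
  have X3: "\<bar>X \<omega>\<bar>^3 \<le> 4 * B^3 + 4 * \<bar>W \<omega>\<bar>^3" for \<omega>
  proof -
    have "\<bar>X \<omega>\<bar> \<le> B + \<bar>W \<omega>\<bar>" using trunc_bounds(1)[OF \<tau>, of "W \<omega>"] \<mu> unfolding X_def by linarith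
    then have "\<bar>X \<omega>\<bar>^3 \<le> (B + \<bar>W \<omega>\<bar>)^3" by (intro power_mono) auto
    also have "\<dots> \<le> 4 * B^3 + 4 * \<bar>W \<omega>\<bar>^3"
      using C1 by (intro add_cube_le) (auto simp: B)
    finally show ?thesis .
  qed
  have [measurable]: "X \<in> borel_measurable M" unfolding X_def by measurable
  show iX3: "integrable M (\<lambda>\<omega>. \<bar>X \<omega>\<bar>^3)"
    by (rule int[of _ "4 * B^3" 4]) (use X3 in auto)
  have "expectation (\<lambda>\<omega>. \<bar>X \<omega>\<bar>^3) \<le> expectation (\<lambda>\<omega>. 4 * B^3 + 4 * \<bar>W \<omega>\<bar>^3)"
    using iX3 i3 X3 by (intro integral_mono) auto
  also have "\<dots> = 4 * B^3 + 4 * expectation (\<lambda>\<omega>. \<bar>W \<omega>\<bar>^3)" using i3 by (simp add: prob_space)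
  finally show "expectation (\<lambda>\<omega>. \<bar>X \<omega>\<bar>^3) \<le> 4 * C1 + 4 * B^3" using m3 by simp
  have iT: "integrable M (\<lambda>\<omega>. trunc \<tau> (W \<omega>))"
    by (rule int[of _ 1 1]) (use w trunc_bounds(1)[OF \<tau>] order_trans in \<open>auto, blast\<close>)
  have "expectation X = expectation (\<lambda>\<omega>. trunc \<tau> (W \<omega>) - W \<omega>)"
    using iT i1 by (simp add: X_def mean prob_space)
  also have "\<bar>\<dots>\<bar> \<le> expectation (\<lambda>\<omega>. \<bar>trunc \<tau> (W \<omega>) - W \<omega>\<bar>)" by (rule integral_abs_bound)
  also have "\<dots> \<le> expectation (\<lambda>\<omega>. \<bar>W \<omega>\<bar>^3 / \<tau>\<^sup>2)"
    using iT i1 i3 trunc_bounds(3)[OF \<tau>] by (intro integral_mono) auto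
  also have "\<dots> \<le> C1 / \<tau>\<^sup>2" using m3 by (simp add: divide_right_mono)
  finally show "\<bar>expectation X\<bar> \<le> C1 / \<tau>\<^sup>2" .
  have iX2: "integrable M (\<lambda>\<omega>. (X \<omega>)\<^sup>2)"
  proof (rule int[of _ "1 + 4 * B^3" 4])
    show "\<bar>(X \<omega>)\<^sup>2\<bar> \<le> 1 + 4 * B^3 + 4 * \<bar>W \<omega>\<bar>^3" for \<omega>
      using power_le_one_plus_cube[of "\<bar>X \<omega>\<bar>" 2] X3[of \<omega>] by simp
  qed measurable
  \<comment> \<open>A difference of two squares: one factor is the truncation error, the other is at
    most \<open>2 * \<bar>W\<bar> + 2 * B\<close>.\<close>
  have le: "(W \<omega> - \<mu>)\<^sup>2 \<le> (X \<omega>)\<^sup>2 + 2 / \<tau> * (B + (1 + B) * \<bar>W \<omega>\<bar>^3)" for \<omega>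
  proof -
    let ?t = "trunc \<tau> (W \<omega>)" and ?w = "W \<omega>"
    have "(?w - \<mu>)\<^sup>2 - (X \<omega>)\<^sup>2 = (?w - ?t) * (?w + ?t - 2 * \<mu>)"
      by (simp add: X_def power2_eq_square algebra_simps)
    also have "\<dots> \<le> \<bar>?w - ?t\<bar> * \<bar>?w + ?t - 2 * \<mu>\<bar>"
      using abs_ge_self[of "(?w - ?t) * (?w + ?t - 2 * \<mu>)"] by (simp only: abs_mult)
    also have "\<dots> \<le> (?w\<^sup>2 / \<tau>) * (2 * \<bar>?w\<bar> + 2 * B)"
    proof (rule mult_mono)
      show "\<bar>?w - ?t\<bar> \<le> ?w\<^sup>2 / \<tau>" using trunc_bounds(2)[OF \<tau>, of ?w] by linarith
      show "\<bar>?w + ?t - 2 * \<mu>\<bar> \<le> 2 * \<bar>?w\<bar> + 2 * B"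
        using trunc_bounds(1)[OF \<tau>, of ?w] \<mu> by linarith
    qed (use \<tau> in auto)
    also have "\<dots> = 2 / \<tau> * (\<bar>?w\<bar>^3 + B * ?w\<^sup>2)"
      by (simp add: power2_eq_square power3_eq_cube algebra_simps abs_mult_self_eq flip: abs_mult)
    also have "\<dots> \<le> 2 / \<tau> * (\<bar>?w\<bar>^3 + B * (1 + \<bar>?w\<bar>^3))"
      using \<tau> C1 w(2) by (intro mult_left_mono add_left_mono) (auto simp: B)
    finally show ?thesis by (simp add: algebra_simps)
  qed
  have "C2 \<le> expectation (\<lambda>\<omega>. (W \<omega> - \<mu>)\<^sup>2)" by (rule var)
  also have "\<dots> \<le> expectation (\<lambda>\<omega>. (X \<omega>)\<^sup>2 + 2 / \<tau> * (B + (1 + B) * \<bar>W \<omega>\<bar>^3))"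
    using i1 i2 iX2 i3 le by (intro integral_mono) (auto simp: power2_diff)
  also have "\<dots> = expectation (\<lambda>\<omega>. (X \<omega>)\<^sup>2) + 2 / \<tau> * (B + (1 + B) * expectation (\<lambda>\<omega>. \<bar>W \<omega>\<bar>^3))"
    using iX2 i3 by (simp add: prob_space)
  also have "\<dots> \<le> expectation (\<lambda>\<omega>. (X \<omega>)\<^sup>2) + 2 / \<tau> * (C1 + B\<^sup>2)"
  proof -
    have "(1 + B) * expectation (\<lambda>\<omega>. \<bar>W \<omega>\<bar>^3) \<le> (1 + B) * C1"
      using m3 C1 by (intro mult_left_mono) (auto simp: B)
    also have "B + (1 + B) * C1 = C1 + B\<^sup>2" by (simp add: B power2_eq_square algebra_simps)
    finally have "B + (1 + B) * expectation (\<lambda>\<omega>. \<bar>W \<omega>\<bar>^3) \<le> C1 + B\<^sup>2" by simp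
    then show ?thesis using \<tau> by (intro add_left_mono mult_left_mono) auto
  qed
  finally show "C2 - 2 * (C1 + B\<^sup>2) / \<tau> \<le> expectation (\<lambda>\<omega>. (X \<omega>)\<^sup>2)" by simp
qed

text \<open>The equation for \<open>t\<close> lacks the square root of the exact Student inversion
  \<open>t / sqrt (1 + t\<^sup>2 / n)\<close>; this only widens the interval, so every solution \<open>t\<close> is admissible.\<close>

lemma not_covered_imp_self_normalized:
  fixes n :: nat and t z \<tau> \<mu> :: real and xs :: "nat \<Rightarrow> real"
  assumes n: "0 < n" and t: "t / (1 + t\<^sup>2 / real n) = z" and z: "0 < z"
  defines "S \<equiv> (\<Sum>i<n. trunc \<tau> (xs i) - \<mu>)" and "V \<equiv> (\<Sum>i<n. (trunc \<tau> (xs i) - \<mu>)\<^sup>2)"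
  assumes out: "\<not> (ci_L \<tau> t n xs < \<mu> \<and> \<mu> < ci_U \<tau> t n xs)"
  shows "z * sqrt V \<le> 1 * S \<or> z * sqrt V \<le> (- 1) * S"
proof -
  let ?F = "\<Sum>i<n. trunc \<tau> (xs i)" and ?N = "real n"
  let ?Q = "(\<Sum>i<n. (trunc \<tau> (xs i))\<^sup>2) - 1 / ?N * ?F\<^sup>2"
  let ?k = "1 + t\<^sup>2 / ?N"
  have N: "0 < ?N" using n by simp
  have k: "1 \<le> ?k" by simp
  have t0: "0 < t" using t z k by (metis less_le_trans zero_less_divide_iff zero_less_one not_less_iff_gr_or_eq order_less_trans)
  have F: "?F = S + ?N * \<mu>" by (simp add: S_def sum_subtractf)
  \<comment> \<open>The centred sum of squares is invariant under shifts, so the radicand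
    \<open>?Q\<close> can be computed from the variables shifted by \<open>\<mu>\<close>.\<close>
  have "V = (\<Sum>i<n. (trunc \<tau> (xs i))\<^sup>2) - 2 * \<mu> * ?F + ?N * \<mu>\<^sup>2"
    by (simp add: V_def power2_diff sum.distrib sum_subtractf sum_distrib_left mult_ac)
  moreover have "1 / ?N * ?F\<^sup>2 = S\<^sup>2 / ?N + 2 * (\<mu> * S) + ?N * \<mu>\<^sup>2"
    unfolding F using N by (simp add: field_simps power2_eq_square)
  moreover have "2 * \<mu> * ?F = 2 * (\<mu> * S) + 2 * (?N * \<mu>\<^sup>2)"
    unfolding F by (simp add: algebra_simps power2_eq_square)
  ultimately have Q: "?Q = V - S\<^sup>2 / ?N" by linarith
  have V0: "0 \<le> V" unfolding V_def by (intro sum_nonneg) auto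
  have "S\<^sup>2 \<le> ?N * V"
    using sum_squared_le_sum_of_squares[of "\<lambda>i. trunc \<tau> (xs i) - \<mu>" "{..<n}"]
    unfolding S_def V_def by (simp add: mult.commute)
  then have Q0: "0 \<le> ?Q" unfolding Q using N by (simp add: field_simps)
  have L: "ci_L \<tau> t n xs = S / ?N + \<mu> - t / ?N * sqrt ?Q" and U: "ci_U \<tau> t n xs = S / ?N + \<mu> + t / ?N * sqrt ?Q"
    unfolding ci_L_def ci_U_def using F N by (simp_all add: add_divide_distrib)
  have "t * sqrt ?Q \<le> \<bar>S\<bar>"
  proof -
    have "t / ?N * sqrt ?Q \<le> \<bar>S / ?N\<bar>" using out unfolding L U by linarith
    then show ?thesis using N by (simp add: field_simps abs_divide)
  qed
  then have "(t * sqrt ?Q)\<^sup>2 \<le> \<bar>S\<bar>\<^sup>2" using t0 Q0 by (intro power_mono) auto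
  then have "t\<^sup>2 * (V - S\<^sup>2 / ?N) \<le> S\<^sup>2" using Q0 by (simp add: power_mult_distrib flip: Q)
  then have "t\<^sup>2 * V \<le> S\<^sup>2 * ?k" by (simp add: algebra_simps)
  moreover have "z * ?k = t" using t k by (simp add: field_simps)
  then have "t\<^sup>2 = z\<^sup>2 * ?k\<^sup>2" by (metis power_mult_distrib)
  \<comment> \<open>One factor \<open>?k\<close> cancels; the other is at least 1 and is
    dropped.\<close>
  ultimately have "z\<^sup>2 * V * ?k * ?k \<le> S\<^sup>2 * ?k" by (simp only: power2_eq_square mult_ac)
  then have "z\<^sup>2 * V * ?k \<le> S\<^sup>2" using k by (subst (asm) mult_le_cancel_right) linarith
  moreover have "z\<^sup>2 * V * 1 \<le> z\<^sup>2 * V * ?k" using k V0 by (intro mult_left_mono) auto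
  ultimately have "z\<^sup>2 * V \<le> S\<^sup>2" by linarith
  then have "sqrt (z\<^sup>2 * V) \<le> sqrt (S\<^sup>2)" by (rule real_sqrt_le_mono)
  then have "z * sqrt V \<le> \<bar>S\<bar>" using z by (simp add: real_sqrt_mult)
  then show ?thesis by linarith
qed

section \<open>Simultaneous coverage: union bound over coordinates and signs, and the limit in
  \<open>n\<close>\<close>

theorem theorem4p5:
  fixes M :: "nat \<Rightarrow> 'a measure"
    and Z \<epsilon> :: "nat \<Rightarrow> nat \<Rightarrow> nat \<Rightarrow> 'a \<Rightarrow> real"
    and \<mu> :: "nat \<Rightarrow> nat \<Rightarrow> real"
    and p :: "nat \<Rightarrow> nat"
    and \<tau> t0 :: "nat \<Rightarrow> real"
    and \<alpha> C1 C2 :: real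
  assumes prob: "\<And>n. prob_space (M n)"
    and p_pos: "\<And>n. p n \<ge> 1"
    and model: "\<And>n i j \<omega>. i < n \<Longrightarrow> j < p n \<Longrightarrow> \<omega> \<in> space (M n) \<Longrightarrow>
                   Z n i j \<omega> = \<mu> n j + \<epsilon> n i j \<omega>"
    and meas: "\<And>n i j. i < n \<Longrightarrow> j < p n \<Longrightarrow> \<epsilon> n i j \<in> borel_measurable (M n)"
    and indep: "\<And>n. prob_space.indep_vars (M n) (\<lambda>_. PiM {..<p n} (\<lambda>_. borel))
                   (\<lambda>i \<omega>. \<lambda>j\<in>{..<p n}. \<epsilon> n i j \<omega>) {..<n}"
    and ident: "\<And>n i. i < n \<Longrightarrow>
                   distr (M n) (PiM {..<p n} (\<lambda>_. borel)) (\<lambda>\<omega>. \<lambda>j\<in>{..<p n}. \<epsilon> n i j \<omega>)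
                 = distr (M n) (PiM {..<p n} (\<lambda>_. borel)) (\<lambda>\<omega>. \<lambda>j\<in>{..<p n}. \<epsilon> n 0 j \<omega>)"
    and mean0: "\<And>n i j. i < n \<Longrightarrow> j < p n \<Longrightarrow>
                   integrable (M n) (\<epsilon> n i j) \<and> prob_space.expectation (M n) (\<epsilon> n i j) = 0"
    and C1_pos: "C1 > 0" and C2_pos: "C2 > 0"
    and moment3: "\<And>n i j. i < n \<Longrightarrow> j < p n \<Longrightarrow>
                   integrable (M n) (\<lambda>\<omega>. \<bar>Z n i j \<omega>\<bar> ^ 3) \<and>
                   prob_space.expectation (M n) (\<lambda>\<omega>. \<bar>Z n i j \<omega>\<bar> ^ 3) \<le> C1"
    and var_lb: "\<And>n i j. i < n \<Longrightarrow> j < p n \<Longrightarrow> prob_space.variance (M n) (\<epsilon> n i j) \<ge> C2"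
    and alpha: "0 < \<alpha>" "\<alpha> < 1"
    and tau_pos: "\<And>n. \<tau> n > 0"
    and growth_p: "(\<lambda>n. ln (real (p n) / \<alpha>)) \<in> o(\<lambda>n. real n powr (1/3))"
    and growth_tau: "(\<lambda>n. real n powr (1/3)) \<in> o(\<lambda>n. \<tau> n)"
    and t0_def: "eventually (\<lambda>n. t0 n / (1 + (t0 n)\<^sup>2 / real n)
                   = Phi_inv (1 - \<alpha> / (2 * real (p n)))) sequentially"
  shows "\<exists>g. g \<longlonglongrightarrow> 0 \<and>
           eventually (\<lambda>n. measure (M n)
              {\<omega> \<in> space (M n). \<forall>j<p n.
                  ci_L (\<tau> n) (t0 n) n (\<lambda>i. Z n i j \<omega>) < \<mu> n j \<and>
                  \<mu> n j < ci_U (\<tau> n) (t0 n) n (\<lambda>i. Z n i j \<omega>)}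
              \<ge> 1 - \<alpha> - g n) sequentially"
proof -
  define x where "x n = Phi_inv (1 - \<alpha> / (2 * real (p n)))" for n
  \<comment> \<open>The quantile for a single coordinate: positive because
    \<open>\<alpha> < 1\<close>, and below every \<open>x n\<close> because
    \<open>p n \<ge> 1\<close>. It is the uniform lower bound that the tail estimate asks
    for.\<close>
  define c0 where "c0 = Phi_inv (1 - \<alpha> / 2)"
  have p1: "1 \<le> real (p n)" for n using p_pos[of n] by simp
  have q: "0 < \<alpha> / (2 * real (p n))" "\<alpha> / (2 * real (p n)) \<le> \<alpha> / 2" for n
  proof -
    have "\<alpha> * 1 \<le> \<alpha> * real (p n)" using p1[of n] alpha by (intro mult_left_mono) auto
    then show "\<alpha> / (2 * real (p n)) \<le> \<alpha> / 2" using p1[of n] by (simp add: field_simps)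
    show "0 < \<alpha> / (2 * real (p n))" using p1[of n] alpha by simp
  qed
  have Phix: "Phi (x n) = 1 - \<alpha> / (2 * real (p n))" for n
    unfolding x_def using q[of n] alpha by (intro Phi_Phi_inv) auto
  then have Phi_mx: "Phi (- x n) = \<alpha> / (2 * real (p n))" for n by (simp add: Phi_minus)
  have Phic0: "Phi c0 = 1 - \<alpha> / 2" unfolding c0_def using alpha by (intro Phi_Phi_inv) auto
  have c0: "0 < c0"
  proof (rule ccontr)
    assume "\<not> 0 < c0"
    then have "Phi c0 \<le> Phi 0" by (intro Phi_mono) auto
    then show False using Phic0 alpha by (simp add: Phi_0)
  qed
  have c0x: "c0 \<le> x n" for n
  proof (rule ccontr)
    assume "\<not> c0 \<le> x n"
    then have "Phi (x n) < Phi c0" by (intro Phi_strict_mono) auto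
    then show False using q(2)[of n] by (simp add: Phix Phic0)
  qed
  have x0: "0 < x n" for n using c0 c0x[of n] by simp
  \<comment> \<open>Taking logarithms in \<open>Phi (- x n) \<le> exp (- (x n)\<^sup>2 / 2)\<close>;
    the growth of \<open>ln (p / \<alpha>)\<close> enters through this bound.\<close>
  have x_sq: "(x n)\<^sup>2 \<le> 2 * (ln 2 + ln (real (p n) / \<alpha>))" for n
  proof -
    have "ln (\<alpha> / (2 * real (p n))) \<le> ln (exp (- (x n)\<^sup>2 / 2))"
      using q(1)[of n] Phi_minus_le_exp[OF x0[of n]] unfolding Phi_mx by (intro ln_mono) auto
    moreover have "ln (\<alpha> / (2 * real (p n))) = - (ln 2 + ln (real (p n) / \<alpha>))"
      using p1[of n] alpha by (simp add: ln_div ln_mult)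
    ultimately show ?thesis by simp
  qed
  \<comment> \<open>\<open>r\<close> tends to 0 exactly when \<open>x n\<close> is of smaller order
    than \<open>n powr (1/6)\<close>; its cube is the Lyapunov factor
    \<open>x^3 / sqrt n\<close>.\<close>
  define r where "r n = x n / real n powr (1/6)" for n
  have r: "r \<longlonglongrightarrow> 0"
  proof -
    have "(\<lambda>n. 2 * (ln 2 + ln (real (p n) / \<alpha>))) \<in> o(\<lambda>n. real n powr (1/3))"
    proof -
      have "(\<lambda>n::nat. ln 2 :: real) \<in> o(\<lambda>n. real n powr (1/3))" by real_asymp
      from sum_in_smallo(1)[OF this growth_p] show ?thesis by (subst landau_o.small.cmult_in_iff) auto
    qed
    then have "(\<lambda>n. 2 * (ln 2 + ln (real (p n) / \<alpha>)) / real n powr (1/3)) \<longlonglongrightarrow> 0"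
      by (rule smalloD_tendsto)
    then have lim: "(\<lambda>n. (r n)\<^sup>2) \<longlonglongrightarrow> 0"
    proof (rule tendsto_sandwich[OF _ _ tendsto_const, rotated 2])
      show "eventually (\<lambda>n. (r n)\<^sup>2 \<le> 2 * (ln 2 + ln (real (p n) / \<alpha>)) / real n powr (1/3)) sequentially"
        using eventually_gt_at_top[of 0]
      proof eventually_elim
        case (elim n)
        have "(real n powr (1/6))\<^sup>2 = real n powr (1/3)"
          using elim by (simp add: powr_power)
        then have "(r n)\<^sup>2 = (x n)\<^sup>2 / real n powr (1/3)" by (simp add: r_def power_divide)
        then show ?case using x_sq[of n] by (simp add: divide_right_mono)
      qed
    qed auto
    then show ?thesis by simp
  qed
  define qq where "qq n = real n powr (1/3) / \<tau> n" for n
  have qq: "qq \<longlonglongrightarrow> 0"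
    unfolding qq_def[abs_def] using growth_tau by (rule smalloD_tendsto)
  define B where "B = 1 + C1"
  define C3 where "C3 = 4 * C1 + 4 * B^3"
  \<comment> \<open>Half of \<open>C2\<close> is the part of the variance bound that survives
    truncation once \<open>\<tau> n\<close> exceeds the \<open>T\<close> below, which solves
    \<open>2 * (C1 + B\<^sup>2) / T = C2 / 2\<close>.\<close>
  define s where "s = sqrt (C2 / 2)"
  have s: "0 < s" "s\<^sup>2 = C2 / 2" using C2_pos by (auto simp: s_def)
  have C3: "0 \<le> C3" using C1_pos by (simp add: C3_def B_def)
  have lim3: "(\<lambda>n. (x n)^3 / sqrt (real n) * (C3 / s^3)) \<longlonglongrightarrow> 0"
  proof -
    have "(\<lambda>n. (r n)^3 * (C3 / s^3)) \<longlonglongrightarrow> 0^3 * (C3 / s^3)" by (intro tendsto_intros r)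
    moreover have "eventually (\<lambda>n. (r n)^3 * (C3 / s^3) = (x n)^3 / sqrt (real n) * (C3 / s^3)) sequentially"
      using eventually_gt_at_top[of 0]
    proof eventually_elim
      case (elim n)
      have "(real n powr (1/6))^3 = sqrt (real n)"
        using elim by (simp add: powr_power powr_half_sqrt)
      then show ?case by (simp add: r_def power_divide)
    qed
    ultimately show ?thesis by (simp add: tendsto_cong)
  qed
  \<comment> \<open>Since 1/2 = 2/3 - 1/6, the scaled bias
    \<open>sqrt n * x / \<tau>\<^sup>2\<close> is \<open>r\<close> times the square of
    \<open>qq\<close>.\<close>
  have lim1: "(\<lambda>n. sqrt (real n) * x n * (C1 / (\<tau> n)\<^sup>2 / s)) \<longlonglongrightarrow> 0"
  proof -
    have "(\<lambda>n. r n * (qq n)\<^sup>2 * (C1 / s)) \<longlonglongrightarrow> 0 * 0\<^sup>2 * (C1 / s)" by (intro tendsto_intros r qq)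
    moreover have "eventually (\<lambda>n. r n * (qq n)\<^sup>2 * (C1 / s) = sqrt (real n) * x n * (C1 / (\<tau> n)\<^sup>2 / s)) sequentially"
      using eventually_gt_at_top[of 0]
    proof eventually_elim
      case (elim n)
      have "(real n powr (1/3))\<^sup>2 / real n powr (1/6) = real n powr (1/2)"
        using elim by (simp add: powr_power powr_diff[symmetric])
      then have "(real n powr (1/3))\<^sup>2 / real n powr (1/6) = sqrt (real n)"
        using elim by (simp add: powr_half_sqrt)
      moreover have "r n * (qq n)\<^sup>2 * (C1 / s)
          = (real n powr (1/3))\<^sup>2 / real n powr (1/6) * x n * (C1 / (\<tau> n)\<^sup>2 / s)"
        by (simp add: r_def qq_def power_divide mult_ac)
      ultimately show ?case by simp
    qed
    ultimately show ?thesis by (simp add: tendsto_cong)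
  qed
  define T where "T = 4 * (C1 + B\<^sup>2) / C2"
  have T0: "0 < T" using C1_pos C2_pos by (simp add: T_def add_pos_nonneg)
  have evT: "eventually (\<lambda>n. T \<le> \<tau> n) sequentially"
    using landau_o.smallD[OF growth_tau divide_pos_pos[OF zero_less_one T0]] eventually_ge_at_top[of 1]
  proof eventually_elim
    case (elim n)
    from elim(2) have "1 \<le> real n powr (1/3)" by (intro ge_one_powr_ge_zero) auto
    also have "\<dots> \<le> 1 / T * \<tau> n" using elim(1) tau_pos[of n] by simp
    finally have "1 \<le> 1 / T * \<tau> n" .
    then show ?case using T0 by (simp add: field_simps)
  qed
  define G where "G n = {\<omega> \<in> space (M n). \<forall>j<p n.
      ci_L (\<tau> n) (t0 n) n (\<lambda>i. Z n i j \<omega>) < \<mu> n j \<and>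
      \<mu> n j < ci_U (\<tau> n) (t0 n) n (\<lambda>i. Z n i j \<omega>)}" for n
  \<comment> \<open>The error is multiplicative for each coordinate, so \<open>2 * p n\<close>
    events of probability at most \<open>(1 + e) * \<alpha> / (2 * p n)\<close> cost
    \<open>(1 + e) * \<alpha>\<close> in total, however fast \<open>p\<close> grows.\<close>
  have claim: "eventually (\<lambda>n. 1 - (1 + e) * \<alpha> \<le> measure (M n) (G n)) sequentially" if e: "0 < e" for e
  proof -
    obtain \<eta> where \<eta>: "0 < \<eta>" and tail:
      "\<And>(M :: 'a measure) n x X sg. prob_space M \<Longrightarrow> 0 < n \<Longrightarrow> c0 \<le> x \<Longrightarrow> \<bar>sg\<bar> = 1 \<Longrightarrow>
        prob_space.indep_vars M (\<lambda>_. borel) X {..<n} \<Longrightarrow>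
        (\<forall>i<n. distr M borel (X i) = distr M borel (X 0)) \<Longrightarrow>
        integrable M (\<lambda>\<omega>. \<bar>X 0 \<omega>\<bar>^3) \<Longrightarrow> 0 < (\<integral>\<omega>. (X 0 \<omega>)\<^sup>2 \<partial>M) \<Longrightarrow>
        x^3 / sqrt (real n) * ((\<integral>\<omega>. \<bar>X 0 \<omega>\<bar>^3 \<partial>M) / (sqrt (\<integral>\<omega>. (X 0 \<omega>)\<^sup>2 \<partial>M))^3) \<le> \<eta> \<Longrightarrow>
        sqrt (real n) * x * (\<bar>\<integral>\<omega>. X 0 \<omega> \<partial>M\<bar> / sqrt (\<integral>\<omega>. (X 0 \<omega>)\<^sup>2 \<partial>M)) \<le> \<eta> \<Longrightarrow>
        measure M {\<omega> \<in> space M. x * sqrt (\<Sum>i<n. (X i \<omega>)\<^sup>2) \<le> sg * (\<Sum>i<n. X i \<omega>)} \<le> (1 + e) * Phi (- x)"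
      using self_normalized_iid_upper[OF e c0, where 'a='a] by blast
    have ev: "eventually (\<lambda>n. (x n)^3 / sqrt (real n) * (C3 / s^3) < \<eta>) sequentially"
      "eventually (\<lambda>n. sqrt (real n) * x n * (C1 / (\<tau> n)\<^sup>2 / s) < \<eta>) sequentially"
      using order_tendstoD(2)[OF lim3 \<eta>] order_tendstoD(2)[OF lim1 \<eta>] by auto
    show ?thesis
      using ev evT t0_def eventually_gt_at_top[of 0]
    proof eventually_elim
      case (elim n)
      note n = elim(5)
      interpret prob_space "M n" by (rule prob)
      \<comment> \<open>Written with \<open>\<mu> + \<epsilon>\<close>, since \<open>Z\<close> is
        tied to the model only on \<open>space (M n)\<close>, while measurability, independence and
        the common law are given for \<open>\<epsilon>\<close>.\<close>
      define X where "X j i \<omega> = trunc (\<tau> n) (\<mu> n j + \<epsilon> n i j \<omega>) - \<mu> n j" for j i \<omega>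
      have \<epsilon>m [measurable]: "\<epsilon> n i j \<in> borel_measurable (M n)" if "i < n" "j < p n" for i j
        using meas that by simp
      have Xm [measurable]: "X j i \<in> borel_measurable (M n)" if "i < n" "j < p n" for i j
        unfolding X_def[abs_def] using \<epsilon>m[OF that] by measurable
      define bad where "bad j sg = {\<omega> \<in> space (M n). x n * sqrt (\<Sum>i<n. (X j i \<omega>)\<^sup>2) \<le> sg * (\<Sum>i<n. X j i \<omega>)}" for j sg
      have bad_sets: "bad j sg \<in> events" if "j < p n" for j sg
        unfolding bad_def using Xm that
        by (intro borel_measurable_le borel_measurable_times borel_measurable_const borel_measurable_sqrt
            borel_measurable_sum borel_measurable_power) auto
      have bad_le: "prob (bad j sg) \<le> (1 + e) * (\<alpha> / (2 * real (p n)))" if j: "j < p n" and sg: "\<bar>sg\<bar> = 1" for j sg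
        unfolding bad_def Phi_mx[symmetric]
      proof (rule tail)
        \<comment> \<open>One coordinate as a function of the whole error vector, because
          independence and identical distribution are given for vectors.\<close>
        let ?f = "\<lambda>v :: nat \<Rightarrow> real. trunc (\<tau> n) (\<mu> n j + v j) - \<mu> n j"
        let ?E = "\<lambda>i \<omega>. \<lambda>j\<in>{..<p n}. \<epsilon> n i j \<omega>"
        have f [measurable]: "?f \<in> borel_measurable (PiM {..<p n} (\<lambda>_. borel))"
          by (measurable; use j in simp)
        have fE: "?f (?E i \<omega>) = X j i \<omega>" for i \<omega> using j by (simp add: X_def)
        have Em: "?E i \<in> measurable (M n) (PiM {..<p n} (\<lambda>_. borel))" if "i < n" for i
          using that by (intro measurable_restrict) auto
        have "indep_vars (\<lambda>_. borel) (\<lambda>i \<omega>. ?f (?E i \<omega>)) {..<n}"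
          by (rule indep_vars_compose2[OF indep]) (rule f)
        then show "indep_vars (\<lambda>_. borel) (X j) {..<n}"
          unfolding fE by simp
        have XE: "distr (M n) borel (X j i) = distr (distr (M n) (PiM {..<p n} (\<lambda>_. borel)) (?E i)) borel ?f"
          if "i < n" for i
          unfolding distr_distr[OF f Em[OF that]] comp_def fE by simp
        show "\<forall>i<n. distr (M n) borel (X j i) = distr (M n) borel (X j 0)"
        proof (intro allI impI)
          fix i assume i: "i < n"
          show "distr (M n) borel (X j i) = distr (M n) borel (X j 0)"
            unfolding XE[OF i] XE[OF n] ident[OF i] ..
        qed
        let ?W = "\<lambda>\<omega>. \<mu> n j + \<epsilon> n 0 j \<omega>"
        have W: "Z n 0 j \<omega> = ?W \<omega>" if "\<omega> \<in> space (M n)" for \<omega> using model[OF n j that] .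
        have Wm: "?W \<in> borel_measurable (M n)" using n j by simp
        have W3: "integrable (M n) (\<lambda>\<omega>. \<bar>?W \<omega>\<bar>^3)" "expectation (\<lambda>\<omega>. \<bar>?W \<omega>\<bar>^3) \<le> C1"
          using moment3[OF n j] by (simp_all add: W cong: Bochner_Integration.integrable_cong Bochner_Integration.integral_cong)
        have Wmean: "expectation ?W = \<mu> n j" using mean0[OF n j] by (simp add: prob_space)
        have Wvar: "C2 \<le> expectation (\<lambda>\<omega>. (?W \<omega> - \<mu> n j)\<^sup>2)"
          using var_lb[OF n j] mean0[OF n j] by simp
        note tm = truncated_moments[OF Wm W3 Wmean Wvar tau_pos[of n] B_def, folded X_def]
        let ?v = "expectation (\<lambda>\<omega>. (X j 0 \<omega>)\<^sup>2)"
        have v: "s\<^sup>2 \<le> ?v"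
        proof -
          have "2 * (C1 + B\<^sup>2) / \<tau> n \<le> 2 * (C1 + B\<^sup>2) / T"
            using elim(3) T0 C1_pos tau_pos[of n] by (intro divide_left_mono) auto
          also have "\<dots> = C2 / 2"
          proof -
            have "0 < C1 + B\<^sup>2" using C1_pos by (simp add: add_pos_nonneg)
            then show ?thesis using C2_pos unfolding T_def by (simp add: field_simps)
          qed
          finally show ?thesis using tm(4) s(2) by linarith
        qed
        have sv: "s \<le> sqrt ?v" using v s(1) by (simp add: real_le_rsqrt)
        show "integrable (M n) (\<lambda>\<omega>. \<bar>X j 0 \<omega>\<bar>^3)" by (rule tm(1))
        show "0 < ?v" using v s(1) by (meson less_le_trans zero_less_power)
        have "(x n)^3 / sqrt (real n) * (expectation (\<lambda>\<omega>. \<bar>X j 0 \<omega>\<bar>^3) / (sqrt ?v)^3)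
            \<le> (x n)^3 / sqrt (real n) * (C3 / s^3)"
          using tm(2) sv s(1) C3 x0[of n] unfolding C3_def
          by (intro mult_left_mono frac_le power_mono) auto
        then show "(x n)^3 / sqrt (real n) * (expectation (\<lambda>\<omega>. \<bar>X j 0 \<omega>\<bar>^3) / (sqrt ?v)^3) \<le> \<eta>"
          using elim(1) by linarith
        have "sqrt (real n) * x n * (\<bar>expectation (X j 0)\<bar> / sqrt ?v)
            \<le> sqrt (real n) * x n * (C1 / (\<tau> n)\<^sup>2 / s)"
          using tm(3) sv s(1) x0[of n] C1_pos by (intro mult_left_mono frac_le) auto
        then show "sqrt (real n) * x n * (\<bar>expectation (X j 0)\<bar> / sqrt ?v) \<le> \<eta>"
          using elim(2) by linarith
      qed (use prob n c0x sg in auto)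
      let ?bad = "\<Union>j\<in>{..<p n}. bad j 1 \<union> bad j (- 1)"
      have bad_ev: "?bad \<in> events" using bad_sets by auto
      have "prob ?bad \<le> (\<Sum>j<p n. prob (bad j 1 \<union> bad j (- 1)))"
        using bad_sets by (intro finite_measure_subadditive_finite) auto
      also have "\<dots> \<le> (\<Sum>j<p n. (1 + e) * (\<alpha> / real (p n)))"
      proof (rule sum_mono)
        fix j assume "j \<in> {..<p n}"
        then have j: "j < p n" by simp
        have "prob (bad j 1 \<union> bad j (- 1)) \<le> prob (bad j 1) + prob (bad j (- 1))"
          using bad_sets[OF j] by (intro measure_Un_le) auto
        also have "\<dots> \<le> (1 + e) * (\<alpha> / (2 * real (p n))) + (1 + e) * (\<alpha> / (2 * real (p n)))"
          by (intro add_mono bad_le j) auto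
        finally show "prob (bad j 1 \<union> bad j (- 1)) \<le> (1 + e) * (\<alpha> / real (p n))" by (simp add: mult.commute)
      qed
      also have "\<dots> = (1 + e) * \<alpha>" using p1[of n] by simp
      finally have pb: "prob ?bad \<le> (1 + e) * \<alpha>" .
      have G_eq: "G n = {\<omega> \<in> space (M n). \<forall>j<p n.
          ci_L (\<tau> n) (t0 n) n (\<lambda>i. \<mu> n j + \<epsilon> n i j \<omega>) < \<mu> n j \<and>
          \<mu> n j < ci_U (\<tau> n) (t0 n) n (\<lambda>i. \<mu> n j + \<epsilon> n i j \<omega>)}"
      proof -
        have "ci_L (\<tau> n) (t0 n) n (\<lambda>i. Z n i j \<omega>) = ci_L (\<tau> n) (t0 n) n (\<lambda>i. \<mu> n j + \<epsilon> n i j \<omega>) \<and>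
            ci_U (\<tau> n) (t0 n) n (\<lambda>i. Z n i j \<omega>) = ci_U (\<tau> n) (t0 n) n (\<lambda>i. \<mu> n j + \<epsilon> n i j \<omega>)"
          if "j < p n" "\<omega> \<in> space (M n)" for j \<omega>
        proof -
          have "(\<Sum>i<n. f (Z n i j \<omega>)) = (\<Sum>i<n. f (\<mu> n j + \<epsilon> n i j \<omega>))" for f :: "real \<Rightarrow> real"
            using model that by (intro sum.cong) auto
          from this[of "trunc (\<tau> n)"] this[of "\<lambda>z. (trunc (\<tau> n) z)\<^sup>2"] show ?thesis
            by (simp only: ci_L_def ci_U_def)
        qed
        then show ?thesis unfolding G_def by auto
      qed
      have G_ev: "G n \<in> events"
      proof -
        have tr: "(\<lambda>\<omega>. trunc (\<tau> n) (\<mu> n j + \<epsilon> n i j \<omega>)) \<in> borel_measurable (M n)" if "i < n" "j < p n" for i j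
          using \<epsilon>m[OF that] by measurable
        have "{\<omega> \<in> space (M n). ci_L (\<tau> n) (t0 n) n (\<lambda>i. \<mu> n j + \<epsilon> n i j \<omega>) < \<mu> n j \<and>
          \<mu> n j < ci_U (\<tau> n) (t0 n) n (\<lambda>i. \<mu> n j + \<epsilon> n i j \<omega>)} \<in> events" if "j < p n" for j
          unfolding ci_L_def ci_U_def divide_inverse using that
          by (intro sets.sets_Collect_conj borel_measurable_less borel_measurable_const borel_measurable_diff
              borel_measurable_add borel_measurable_times borel_measurable_sqrt borel_measurable_power
              borel_measurable_sum tr) auto
        then have "{\<omega> \<in> space (M n). \<forall>j\<in>{..<p n}. ci_L (\<tau> n) (t0 n) n (\<lambda>i. \<mu> n j + \<epsilon> n i j \<omega>) < \<mu> n j \<and>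
          \<mu> n j < ci_U (\<tau> n) (t0 n) n (\<lambda>i. \<mu> n j + \<epsilon> n i j \<omega>)} \<in> events"
          by (intro sets.sets_Collect_finite_All) auto
        then show ?thesis unfolding G_eq Ball_def lessThan_iff .
      qed
      have sub: "space (M n) - ?bad \<subseteq> G n"
      proof
        fix \<omega> assume w: "\<omega> \<in> space (M n) - ?bad"
        show "\<omega> \<in> G n"
          unfolding G_eq
        proof (intro CollectI conjI allI impI)
          show "\<omega> \<in> space (M n)" using w by simp
          fix j assume j: "j < p n"
          have nb: "\<omega> \<notin> bad j 1" "\<omega> \<notin> bad j (- 1)" using w j by auto
          have "ci_L (\<tau> n) (t0 n) n (\<lambda>i. \<mu> n j + \<epsilon> n i j \<omega>) < \<mu> n j \<and>
            \<mu> n j < ci_U (\<tau> n) (t0 n) n (\<lambda>i. \<mu> n j + \<epsilon> n i j \<omega>)"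
          proof (rule ccontr)
            assume "\<not> ?thesis"
            from not_covered_imp_self_normalized[OF n elim(4)[folded x_def] x0 this]
            show False using nb w by (auto simp: bad_def X_def)
          qed
          then show "ci_L (\<tau> n) (t0 n) n (\<lambda>i. \<mu> n j + \<epsilon> n i j \<omega>) < \<mu> n j"
            "\<mu> n j < ci_U (\<tau> n) (t0 n) n (\<lambda>i. \<mu> n j + \<epsilon> n i j \<omega>)" by auto
        qed
      qed
      have "1 - (1 + e) * \<alpha> \<le> prob (space (M n) - ?bad)"
        unfolding prob_compl[OF bad_ev] using pb by simp
      also have "\<dots> \<le> prob (G n)" by (rule finite_measure_mono[OF sub G_ev])
      finally show ?case .
    qed
  qed
  \<comment> \<open>The shortfall from \<open>1 - \<alpha>\<close>, cut off at 0, satisfies the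
    inequality by construction; only its convergence remains, and \<open>claim\<close> at
    \<open>e / 2\<close> gives it because \<open>\<alpha> < 1\<close>.\<close>
  define g where "g n = max 0 (1 - \<alpha> - measure (M n) (G n))" for n
  have "g \<longlonglongrightarrow> 0"
  proof (rule tendstoI)
    fix e :: real assume e: "0 < e"
    then have "0 < e / 2" by simp
    from claim[OF this] show "eventually (\<lambda>n. dist (g n) 0 < e) sequentially"
    proof eventually_elim
      case (elim n)
      have "e / 2 * \<alpha> < e * 1" using e alpha by (intro mult_strict_mono) auto
      moreover have "1 - \<alpha> - e / 2 * \<alpha> \<le> measure (M n) (G n)"
        using elim by (simp add: algebra_simps)
      ultimately have "1 - \<alpha> - measure (M n) (G n) < e" by linarith
      then show ?case using e by (simp add: g_def dist_real_def)
    qed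
  qed
  moreover have "eventually (\<lambda>n. 1 - \<alpha> - g n \<le> measure (M n) (G n)) sequentially"
    by (intro always_eventually allI) (simp add: g_def)
  ultimately show ?thesis
    unfolding G_def by blast
qed

end
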